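(* Let $a,b>-2$, let $N\ge2$ be even, $w(x)=(1-x)^{a/2}(1+x)^{b/2}$ on $[-1,1]$, and let $f\in C^1[-1,1]$ be real-valued with $f(-1)=f(1)=0$. Define $$G_N^{(1)}(f)=\frac{\int_{[-1,1]^N}\prod_{1\le j<k\le N}|x_j-x_k|\prod_{j=1}^N w(x_j)(1+f(x_j))\,dx_j}{\int_{[-1,1]^N}\prod_{1\le j<k\le N}|x_j-x_k|\prod_{j=1}^N w(x_j)\,dx_j}.$$ For $j\ge0$ let $\varphi_j^{(1)}(x)=\frac{P_j^{(a+1,b+1)}(x)}{\sqrt{h_j^{(a+1,b+1)}}}(1-x)^{a/2}(1+x)^{b/2}$, let $S_N^{(1)}$ be the integral operator on $L^2[-1,1]$ with kernel $S_N^{(1)}(x,y)=\sum_{j=0}^{N-1}(1-x^2)\varphi_j^{(1)}(x)\varphi_j^{(1)}(y)$, and let $$C_N^{(1)}=\sqrt{\frac{N(N+a+1)(N+b+1)(N+a+b+2)}{(2N+a+b+1)(2N+a+b+3)}}.$$ Then $\left[G_N^{(1)}(f)\right]^2=\det(I+T_{\mathrm{JOE}})$, where $$T_{\mathrm{JOE}}=S_N^{(1)}(f^2+2f)-S_N^{(1)}\varepsilon f'-S_N^{(1)}f\varepsilon f'+C_N^{(1)}\big(\varepsilon\varphi_N^{(1)}\big)\otimes\varphi_{N-1}^{(1)}(f^2+2f)$$ $$\qquad+C_N^{(1)}\big(\varepsilon\varphi_N^{(1)}\big)\otimes\big(\varepsilon\varphi_{N-1}^{(1)}\big)f'-C_N^{(1)}\big(\varepsilon\varphi_N^{(1)}\big)\otimes\varphi_{N-1}^{(1)}f\varepsilon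 f'.$$
   Context: $P_j^{(\alpha,\beta)}$ is the Jacobi polynomial of degree $j$ (Szegő normalization) with $\int_{-1}^1P_j^{(\alpha,\beta)}P_k^{(\alpha,\beta)}(1-x)^{\alpha}(1+x)^{\beta}dx=h_j^{(\alpha,\beta)}\delta_{jk}$, $h_j^{(\alpha,\beta)}=\frac{2^{\alpha+\beta+1}\Gamma(j+\alpha+1)\Gamma(j+\beta+1)}{j!(2j+\alpha+\beta+1)\Gamma(j+\alpha+\beta+1)}$. $\varepsilon$ is the integral operator with kernel $\varepsilon(x,y)=\frac12\mathrm{sgn}(x-y)$ on $[-1,1]$. In $T_{\mathrm{JOE}}$, $f$, $f'$ and $f^2+2f$ denote the corresponding multiplication operators, products of operators are compositions (e.g. $S_N^{(1)}f\varepsilon f'=S_N^{(1)}\circ M_f\circ\varepsilon\circ M_{f'}$), and for functions $u,v$, $u\otimes v$ is the rank-one operator with kernel $u(x)v(y)$. $\det$ is the Fredholm determinant on $L^2[-1,1]$. *)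

theory Defs
  imports "HOL-Analysis.Analysis"
begin

text \<open>Explicit formula (Szego 4.3.2):
  P_n^(al,be)(x) = sum_{s=0}^n C(n+al, n-s) C(n+be, s) ((x-1)/2)^s ((x+1)/2)^(n-s).\<close>
definition jacobiP :: "real \<Rightarrow> real \<Rightarrow> nat \<Rightarrow> real \<Rightarrow> real" where
  "jacobiP al be n x =
     (\<Sum>s\<le>n. ((real n + al) gchoose (n - s)) * ((real n + be) gchoose s)
              * ((x - 1) / 2) ^ s * ((x + 1) / 2) ^ (n - s))"

text \<open>Squared norm h_j. For j = 0 the factor (2j+al+be+1) Gamma(j+al+be+1) is written
  as Gamma(al+be+2) (its value whenever the paper's formula is defined).\<close>
definition jacobi_h :: "real \<Rightarrow> real \<Rightarrow> nat \<Rightarrow> real" where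
  "jacobi_h al be j =
     (if j = 0 then 2 powr (al + be + 1) * Gamma (al + 1) * Gamma (be + 1) / Gamma (al + be + 2)
      else 2 powr (al + be + 1) * Gamma (real j + al + 1) * Gamma (real j + be + 1)
           / (fact j * (2 * real j + al + be + 1) * Gamma (real j + al + be + 1)))"

definition phi1 :: "real \<Rightarrow> real \<Rightarrow> nat \<Rightarrow> real \<Rightarrow> real" where
  "phi1 a b j x = jacobiP (a + 1) (b + 1) j x / sqrt (jacobi_h (a + 1) (b + 1) j)
                  * (1 - x) powr (a / 2) * (1 + x) powr (b / 2)"

definition SN1 :: "real \<Rightarrow> real \<Rightarrow> nat \<Rightarrow> real \<Rightarrow> real \<Rightarrow> real" where
  "SN1 a b N x y = (\<Sum>j<N. (1 - x\<^sup>2) * phi1 a b j x * phi1 a b j y)"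

definition CN1 :: "real \<Rightarrow> real \<Rightarrow> nat \<Rightarrow> real" where
  "CN1 a b N = sqrt (real N * (real N + a + 1) * (real N + b + 1) * (real N + a + b + 2)
                     / ((2 * real N + a + b + 1) * (2 * real N + a + b + 3)))"

abbreviation I11 :: "real measure" where
  "I11 \<equiv> restrict_space lborel {-1..1}"

definition eps_kernel :: "real \<Rightarrow> real \<Rightarrow> real" where
  "eps_kernel x y = sgn (x - y) / 2"

definition eps_op :: "(real \<Rightarrow> real) \<Rightarrow> real \<Rightarrow> real" where
  "eps_op g x = integral\<^sup>L I11 (\<lambda>y. eps_kernel x y * g y)"

text \<open>Integral operators on L^2[-1,1] are represented by their kernels.
  Composition of operators, right multiplication by M_g, and rank-one operators:\<close>
definition kcomp :: "(real \<Rightarrow> real \<Rightarrow> real) \<Rightarrow> (real \<Rightarrow> real \<Rightarrow> real) \<Rightarrow> real \<Rightarrow> real \<Rightarrow> real" where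
  "kcomp A B x y = integral\<^sup>L I11 (\<lambda>z. A x z * B z y)"

definition kmulr :: "(real \<Rightarrow> real \<Rightarrow> real) \<Rightarrow> (real \<Rightarrow> real) \<Rightarrow> real \<Rightarrow> real \<Rightarrow> real" where
  "kmulr A g x y = A x y * g y"

definition ktensor :: "(real \<Rightarrow> real) \<Rightarrow> (real \<Rightarrow> real) \<Rightarrow> real \<Rightarrow> real \<Rightarrow> real" where
  "ktensor u v x y = u x * v y"

definition T_JOE :: "real \<Rightarrow> real \<Rightarrow> nat \<Rightarrow> (real \<Rightarrow> real) \<Rightarrow> (real \<Rightarrow> real) \<Rightarrow> real \<Rightarrow> real \<Rightarrow> real" where
  "T_JOE a b N f f' x y =
     (let S = SN1 a b N; C = CN1 a b N; g = (\<lambda>t. (f t)\<^sup>2 + 2 * f t);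
          u = eps_op (phi1 a b N); v = phi1 a b (N - 1) in
       kmulr S g x y
     - kmulr (kcomp S eps_kernel) f' x y
     - kmulr (kcomp (kmulr S f) eps_kernel) f' x y
     + C * kmulr (ktensor u v) g x y
     + C * kmulr (ktensor u (eps_op v)) f' x y
     - C * kmulr (kcomp (kmulr (ktensor u v) f) eps_kernel) f' x y)"

definition leibniz_det :: "nat \<Rightarrow> (nat \<Rightarrow> nat \<Rightarrow> real) \<Rightarrow> real" where
  "leibniz_det n M = (\<Sum>p | p permutes {..<n}. of_int (sign p) * (\<Prod>i<n. M i (p i)))"

definition fredholm_term :: "(real \<Rightarrow> real \<Rightarrow> real) \<Rightarrow> nat \<Rightarrow> real" where
  "fredholm_term K n = (1 / fact n) *
     integral\<^sup>L (PiM {..<n} (\<lambda>_. I11)) (\<lambda>x. leibniz_det n (\<lambda>i j. K (x i) (x j)))"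

definition fredholm_det :: "(real \<Rightarrow> real \<Rightarrow> real) \<Rightarrow> real" where
  "fredholm_det K = (\<Sum>n. fredholm_term K n)"

definition wJ :: "real \<Rightarrow> real \<Rightarrow> real \<Rightarrow> real" where
  "wJ a b x = (1 - x) powr (a / 2) * (1 + x) powr (b / 2)"

definition GN1 :: "real \<Rightarrow> real \<Rightarrow> nat \<Rightarrow> (real \<Rightarrow> real) \<Rightarrow> real" where
  "GN1 a b N f =
     integral\<^sup>L (PiM {..<N} (\<lambda>_. I11))
       (\<lambda>x. (\<Prod>k<N. \<Prod>j<k. \<bar>x j - x k\<bar>) * (\<Prod>j<N. wJ a b (x j) * (1 + f (x j))))
   / integral\<^sup>L (PiM {..<N} (\<lambda>_. I11))
       (\<lambda>x. (\<Prod>k<N. \<Prod>j<k. \<bar>x j - x k\<bar>) * (\<Prod>j<N. wJ a b (x j)))"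

end

theory Submission
  imports Defs "Jordan_Normal_Form.Determinant"
begin

text \<open>
Write \<open>\<psi>\<^sub>l = x\<^sup>l w\<close> and \<open>\<langle>u, v\<rangle> = \<integral> u (\<epsilon> v)\<close>, a skew form. De Bruijn's formula expresses the integral of
\<open>\<Prod>|x\<^sub>j - x\<^sub>k| \<Prod> w (1 + f)\<close> as a constant times the Pfaffian of \<open>M\<^sub>f = (\<langle>(1 + f) \<psi>\<^sub>j, (1 + f) \<psi>\<^sub>k\<rangle>)\<close>, so that
the square of the ratio is \<open>det M\<^sub>f / det M\<^sub>0\<close>.

On the other side, \<open>(1 - x\<^sup>2) \<phi>\<^sub>j\<close> is \<open>\<epsilon>\<close> applied to its derivative, which is \<open>w\<close> times a polynomial of degree
\<open>j + 1\<close>; for \<open>j = N - 1\<close> the term \<open>C \<epsilon> \<phi>\<^sub>N\<close> cancels the leading coefficient. Hence the kernel is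
\<open>\<Sum>\<^sub>j\<^sub><\<^sub>N (\<epsilon> \<chi>\<^sub>j)(x) (\<phi>\<^sub>j A)(y)\<close> with \<open>\<chi>\<^sub>j\<close> in \<open>w\<close> times the polynomials of degree below \<open>N\<close>, \<open>\<langle>\<phi>\<^sub>j, \<chi>\<^sub>k\<rangle> = \<delta>\<^sub>j\<^sub>k\<close> and
\<open>A = f\<^sup>2 + 2f - \<epsilon>f' - f\<epsilon>f'\<close>. The commutator identity \<open>\<epsilon> f' \<epsilon> = f \<epsilon> - \<epsilon> f\<close> gives
\<open>(1 + A) \<epsilon> = (1 + f) \<epsilon> (1 + f)\<close>. So the Fredholm determinant is \<open>det (\<langle>(1 + f) \<phi>\<^sub>j, (1 + f) \<chi>\<^sub>k\<rangle>)\<close>, and a change of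
basis turns it into \<open>det M\<^sub>f / det M\<^sub>0\<close>.
\<close>

section \<open>Determinants and Pfaffian sums\<close>

text \<open>For \<open>a <= -1\<close> or \<open>b <= -1\<close> the weight \<open>w\<close> is
  integrable but not square integrable, so no L^2 argument is available. Functions are kept in L^1,
  \<open>eps_op\<close> sends them to bounded functions, and integrals are exchanged only for an L^1
  tensor product times a bounded kernel. Orthogonality lives on the weight (1 - x^2) w^2, whose
  exponents \<open>a + 1\<close> and \<open>b + 1\<close> exceed -1; this is the origin of the
  shifted Jacobi parameters. Evenness of \<open>N\<close> enters twice. Pfaffians need it; and the
  correction by C phi_N leaves the biorthogonality intact only because the skew form is degenerate
  on the odd-dimensional space of degree at most \<open>N\<close>, with phi_N in its radical. The
  constant C is a quotient of leading coefficients. No normalization is evaluated. The combinatorial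
  constants of the Pfaffians cancel in the quotient. At f = 0 biorthogonality says that the product
  of the two base change determinants and det M_0 is 1; this gives both the right prefactor and det
  M_0 different from 0, which in turn forces the denominator of \<open>GN1\<close> to be
  nonzero.\<close>

lemma leibniz_det_eq_det: "leibniz_det n M = Determinant.det (mat n n (\<lambda>(i,j). M i j))"
proof -
  have **: "(\<Prod>i<n. M i (p i)) = (\<Prod>i = 0..<n. mat n n (\<lambda>(i,j). M i j) $$ (i, p i))"
    if p: "p permutes {0..<n}" for p
  proof (rule prod.cong)
    show "{..<n} = {0..<n}" by (rule lessThan_atLeast0)
  next
    fix i assume i: "i \<in> {0..<n}"
    then have "p i < n" using permutes_in_image[OF p, of i] by simp
    with i show "M i (p i) = mat n n (\<lambda>(i,j). M i j) $$ (i, p i)" by simp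
  qed
  have "Determinant.det (mat n n (\<lambda>(i,j). M i j)) = (\<Sum> p \<in> {p. p permutes {0 ..< n}}. 
     of_int (sign p) * (\<Prod> i = 0 ..< n. mat n n (\<lambda>(i,j). M i j) $$ (i, p i)))"
    by (rule det_def') (rule mat_carrier)
  also have "\<dots> = leibniz_det n M"
    unfolding leibniz_det_def lessThan_atLeast0
  proof (rule sum.cong[OF refl])
    fix p assume "p \<in> {p. p permutes {0 ..< n}}"
    then show "of_int (sign p) * (\<Prod> i = 0 ..< n. mat n n (\<lambda>(i,j). M i j) $$ (i, p i))
       = of_int (sign p) * (\<Prod>i\<in>{0..<n}. M i (p i))" using **[of p] unfolding lessThan_atLeast0 by simp
  qed
  finally show ?thesis by simp
qed
lemma leibniz_det_cong:
  assumes "\<And>i j. i < n \<Longrightarrow> j < n \<Longrightarrow> A i j = B i j"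
  shows "leibniz_det n A = leibniz_det n B"
  unfolding leibniz_det_eq_det by (rule arg_cong[where f = Determinant.det]) (use assms in auto)

lemma leibniz_det_mult:
  "leibniz_det n (\<lambda>i j. \<Sum>k<n. A i k * B k j) = leibniz_det n A * leibniz_det n B"
  unfolding leibniz_det_eq_det
  by (subst Determinant.det_mult[symmetric, of _ n])
     (auto intro!: arg_cong[where f = Determinant.det] sum.cong simp: scalar_prod_def atLeast0LessThan)

lemma leibniz_det_transpose: "leibniz_det n (\<lambda>i j. A j i) = leibniz_det n A"
  unfolding leibniz_det_eq_det
  by (subst Determinant.det_transpose[symmetric, of _ n])
     (auto intro!: arg_cong[where f = Determinant.det])

lemma leibniz_det_triangular:
  assumes "\<And>i j. i < j \<Longrightarrow> j < n \<Longrightarrow> A i j = 0"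
  shows "leibniz_det n A = (\<Prod>i<n. A i i)"
  unfolding leibniz_det_eq_det
  by (subst det_lower_triangular[of n])
     (use assms in \<open>auto simp: diag_mat_def prod.list_conv_set_nth atLeast0LessThan intro!: prod.cong\<close>)

lemma leibniz_det_neg: "leibniz_det n (\<lambda>i j. - A i j) = (-1) ^ n * leibniz_det n A"
  unfolding leibniz_det_def sum_distrib_left
  by (intro sum.cong refl) (simp add: prod_uminus)

lemma leibniz_det_zero_kernel:
  assumes "leibniz_det n A = 0"
  obtains v where "\<exists>i<n. v i \<noteq> 0" "\<And>i. i < n \<Longrightarrow> (\<Sum>j<n. A i j * v j) = 0"
proof -
  let ?A = "mat n n (\<lambda>(i,j). A i j)"
  from assms obtain v where v: "v \<in> carrier_vec n" "v \<noteq> 0\<^sub>v n" "?A *\<^sub>v v = 0\<^sub>v n"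
    using det_0_iff_vec_prod_zero_field[of ?A n] unfolding leibniz_det_eq_det by auto
  have "\<exists>i<n. vec_index v i \<noteq> 0" 
  proof (rule ccontr)
    assume "\<not> ?thesis" then have "v = 0\<^sub>v n" using v(1) by (intro eq_vecI) auto
    with v(2) show False by simp
  qed
  moreover have "(\<Sum>j<n. A i j * vec_index v j) = 0" if "i < n" for i
  proof -
    have "vec_index (?A *\<^sub>v v) i = 0" using v(3) that by simp
    then show ?thesis using that v(1) by (simp add: scalar_prod_def atLeast0LessThan)
  qed
  ultimately show ?thesis using that by blast
qed

lemma permutes_lessThan: "p permutes {..<n::nat} \<Longrightarrow> i < n \<Longrightarrow> p i < n"
  using permutes_in_image[of p "{..<n}" i] by simp

lemma permutes_extend:
  assumes "\<tau> \<in> {..<n} \<rightarrow> {..<n::nat}" "inj_on \<tau> {..<n}"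
  shows "(\<lambda>i. if i < n then \<tau> i else i) permutes {..<n}"
proof (rule bij_imp_permutes)
  have "bij_betw \<tau> {..<n} {..<n}"
    using assms by (simp add: bij_betw_def endo_inj_surj image_subset_iff_funcset)
  then show "bij_betw (\<lambda>i. if i < n then \<tau> i else i) {..<n} {..<n}"
    by (rule bij_betw_cong[THEN iffD1, rotated]) auto
qed auto

lemma leibniz_det_permute_columns:
  assumes "p permutes {..<n}"
  shows "leibniz_det n (\<lambda>i j. A i (p j)) = of_int (sign p) * leibniz_det n A"
proof -
  have "leibniz_det n (\<lambda>i j. A i (p j)) = leibniz_det n (\<lambda>i j. A j (p i))"
    by (rule leibniz_det_transpose[symmetric])
  also have "\<dots> = of_int (sign p) * leibniz_det n (\<lambda>i j. A j i)"
  proof -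
    let ?B = "mat n n (\<lambda>(i,j). A j i)"
    have p: "p permutes {0..<n}" using assms unfolding lessThan_atLeast0 .
    have "p i < n" if "i < n" for i using permutes_in_image[OF assms, of i] that by simp
    then have "mat n n (\<lambda>(i,j). A j (p i)) = mat n n (\<lambda>(i,j). ?B $$ (p i, j))"
      by (intro eq_matI) auto
    then show ?thesis
      using det_permute_rows[OF mat_carrier p, of "\<lambda>(i,j). A j i"] unfolding leibniz_det_eq_det by simp
  qed
  finally show ?thesis by (simp only: leibniz_det_transpose[of n A])
qed

lemma leibniz_det_repeated_column:
  assumes "\<not> inj_on \<tau> {..<n}"
  shows "leibniz_det n (\<lambda>i j. A i (\<tau> j)) = 0"
proof -
  obtain k l where "k < n" "l < n" "k \<noteq> l" "\<tau> k = \<tau> l" using assms by (auto simp: inj_on_def)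
  then show ?thesis unfolding leibniz_det_eq_det
    by (intro det_identical_columns[of _ n k l]) auto
qed

text \<open>Tuples in \<open>PiE\<close> are \<open>undefined\<close> outside \<open>{..<n}\<close>,
  permutations are the identity there. The premise \<open>cong\<close> says that \<open>g\<close>
  cannot see this difference.\<close>

lemma sum_PiE_inj_on_eq_sum_permutations:
  fixes g :: "(nat \<Rightarrow> nat) \<Rightarrow> real"
  assumes cong: "\<And>\<tau> \<tau>'. (\<And>i. i < n \<Longrightarrow> \<tau> i = \<tau>' i) \<Longrightarrow> g \<tau> = g \<tau>'"
  shows "(\<Sum>\<tau> | \<tau> \<in> {..<n} \<rightarrow>\<^sub>E {..<n} \<and> inj_on \<tau> {..<n}. g \<tau>) = (\<Sum>p | p permutes {..<n}. g p)"
proof (rule sum.reindex_bij_witness[where i = "\<lambda>p. restrict p {..<n}"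
        and j = "\<lambda>\<tau> i. if i < n then \<tau> i else i"], goal_cases)
  case (1 \<tau>) then show ?case by (auto simp: fun_eq_iff PiE_iff extensional_def)
next
  case (2 \<tau>) then show ?case by (auto intro!: permutes_extend)
next
  case (3 p) then show ?case by (auto simp: fun_eq_iff permutes_not_in)
next
  case (4 p)
  then have "\<And>i. i < n \<Longrightarrow> p i < n" using permutes_in_image[of p "{..<n}"] by auto
  with 4 show ?case by (auto simp: inj_on_restrict_eq permutes_inj_on)
next
  case (5 \<tau>) then show ?case by (intro cong) auto
qed

text \<open>For skew \<open>A\<close> this is \<open>2\<^sup>m m!\<close> times the Pfaffian; the constant cancels in all ratios, so it is not divided out.\<close>
definition pfaffian_sum :: "nat \<Rightarrow> (nat \<Rightarrow> nat \<Rightarrow> real) \<Rightarrow> real" where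
  "pfaffian_sum m A =
     (\<Sum>p | p permutes {..<2*m}. of_int (sign p) * (\<Prod>i<m. A (p (2*i)) (p (2*i+1))))"

lemma pfaffian_sum_cong:
  assumes "\<And>i j. i < 2*m \<Longrightarrow> j < 2*m \<Longrightarrow> A i j = B i j"
  shows "pfaffian_sum m A = pfaffian_sum m B"
proof -
  have "(\<Prod>i<m. A (p (2*i)) (p (2*i+1))) = (\<Prod>i<m. B (p (2*i)) (p (2*i+1)))" if "p permutes {..<2*m}" for p
    by (rule prod.cong) (auto intro!: assms permutes_lessThan[OF that])
  then show ?thesis unfolding pfaffian_sum_def by simp
qed

lemma prod_pairs:
  fixes g :: "nat \<Rightarrow> 'a::comm_monoid_mult"
  shows "(\<Prod>k<2*m. g k) = (\<Prod>i<m. g (2*i) * g (2*i+1))"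
  by (induction m) (auto simp: mult_ac)

text \<open>Distributivity, with the m chosen pairs (k, l) flattened into one tuple of length 2m
  whose entries 2i and 2i+1 are the i-th pair.\<close>

lemma prod_double_sum_pairs:
  fixes h :: "nat \<Rightarrow> 'a \<Rightarrow> 'a \<Rightarrow> real"
  assumes "finite S"
  shows "(\<Prod>i<m. \<Sum>k\<in>S. \<Sum>l\<in>S. h i k l) = (\<Sum>\<tau>\<in>{..<2*m} \<rightarrow>\<^sub>E S. \<Prod>i<m. h i (\<tau> (2*i)) (\<tau> (2*i+1)))"
proof -
  have "(\<Prod>i<m. \<Sum>k\<in>S. \<Sum>l\<in>S. h i k l) = (\<Prod>i<m. \<Sum>z\<in>S\<times>S. h i (fst z) (snd z))"
    by (simp add: sum.cartesian_product case_prod_unfold)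
  also have "\<dots> = (\<Sum>g\<in>{..<m} \<rightarrow>\<^sub>E S\<times>S. \<Prod>i<m. h i (fst (g i)) (snd (g i)))"
    using assms by (subst prod_sum_PiE) auto
  also have "\<dots> = (\<Sum>\<tau>\<in>{..<2*m} \<rightarrow>\<^sub>E S. \<Prod>i<m. h i (\<tau> (2*i)) (\<tau> (2*i+1)))"
  proof (rule sum.reindex_bij_witness[where j = "\<lambda>g. \<lambda>k\<in>{..<2*m}. if even k then fst (g (k div 2)) else snd (g (k div 2))"
        and i = "\<lambda>\<tau>. \<lambda>i\<in>{..<m}. (\<tau> (2*i), \<tau> (2*i+1))"], goal_cases)
    case (1 g)
    then have "g i = undefined" if "\<not> i < m" for i using that by (auto simp: PiE_iff extensional_def)
    then show ?case by (auto simp: fun_eq_iff)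
  next
    case (2 g)
    have "g (k div 2) \<in> S \<times> S" if "k < 2*m" for k using 2 that by (auto simp: PiE_iff)
    then show ?case by (auto simp: mem_Times_iff)
  next
    case (3 \<tau>)
    have "2 * (k div 2) = k" if "even k" for k :: nat using that by simp
    moreover have "Suc (2 * (k div 2)) = k" if "odd k" for k :: nat using that by presburger
    ultimately show ?case using 3 by (auto simp: fun_eq_iff PiE_iff extensional_def less_mult_imp_div_less)
  next
    case (4 \<tau>) then show ?case by (auto simp: PiE_iff extensional_def)
  next
    case (5 g) then show ?case by (auto intro!: prod.cong)
  qed
  finally show ?thesis .
qed

text \<open>This is Pf(B A B^T) = det B Pf A. After expansion into tuples \<tau> the sum over
  \<open>p\<close> is, for fixed \<tau>, the determinant of \<open>B\<close> with columns selected
  by \<tau>. It vanishes if \<tau> repeats a column and is a signed det B otherwise.\<close>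

theorem pfaffian_sum_congruence:
  "pfaffian_sum m (\<lambda>i j. \<Sum>k<2*m. \<Sum>l<2*m. B i k * A k l * B j l)
     = leibniz_det (2*m) B * pfaffian_sum m A"
proof -
  let ?n = "2*m"
  let ?P = "{p. p permutes {..<?n}}" and ?T = "{..<?n} \<rightarrow>\<^sub>E {..<?n}"
  have finT: "finite ?T" by (auto intro!: finite_PiE)
  have "pfaffian_sum m (\<lambda>i j. \<Sum>k<?n. \<Sum>l<?n. B i k * A k l * B j l)
      = (\<Sum>p\<in>?P. of_int (sign p) * (\<Sum>\<tau>\<in>?T. \<Prod>i<m. B (p (2*i)) (\<tau> (2*i)) * A (\<tau> (2*i)) (\<tau> (2*i+1)) * B (p (2*i+1)) (\<tau> (2*i+1))))"
    unfolding pfaffian_sum_def by (subst prod_double_sum_pairs) auto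
  also have "\<dots> = (\<Sum>p\<in>?P. \<Sum>\<tau>\<in>?T. (\<Prod>i<m. A (\<tau> (2*i)) (\<tau> (2*i+1))) * (of_int (sign p) * (\<Prod>k<?n. B (p k) (\<tau> k))))"
    unfolding sum_distrib_left prod_pairs prod.distrib by (simp only: mult_ac)
  also have "\<dots> = (\<Sum>\<tau>\<in>?T. (\<Prod>i<m. A (\<tau> (2*i)) (\<tau> (2*i+1))) * leibniz_det ?n (\<lambda>i j. B i (\<tau> j)))"
  proof (subst sum.swap, intro sum.cong refl)
    fix \<tau>
    have "leibniz_det ?n (\<lambda>i j. B i (\<tau> j)) = leibniz_det ?n (\<lambda>i j. B j (\<tau> i))"
      by (rule leibniz_det_transpose[symmetric])
    then show "(\<Sum>p\<in>?P. (\<Prod>i<m. A (\<tau> (2*i)) (\<tau> (2*i+1))) * (of_int (sign p) * (\<Prod>k<?n. B (p k) (\<tau> k))))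
      = (\<Prod>i<m. A (\<tau> (2*i)) (\<tau> (2*i+1))) * leibniz_det ?n (\<lambda>i j. B i (\<tau> j))"
      by (simp add: leibniz_det_def sum_distrib_left)
  qed
  also have "\<dots> = (\<Sum>\<tau> | \<tau> \<in> ?T \<and> inj_on \<tau> {..<?n}. (\<Prod>i<m. A (\<tau> (2*i)) (\<tau> (2*i+1))) * leibniz_det ?n (\<lambda>i j. B i (\<tau> j)))"
    by (rule sum.mono_neutral_right) (use finT in \<open>auto simp: leibniz_det_repeated_column\<close>)
  also have "\<dots> = (\<Sum>p | p permutes {..<?n}. (\<Prod>i<m. A (p (2*i)) (p (2*i+1))) * leibniz_det ?n (\<lambda>i j. B i (p j)))"
    by (rule sum_PiE_inj_on_eq_sum_permutations)
       (rule arg_cong2[where f = "(*)"], auto intro!: prod.cong leibniz_det_cong)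
  also have "\<dots> = leibniz_det ?n B * pfaffian_sum m A"
    unfolding pfaffian_sum_def sum_distrib_left
    by (intro sum.cong refl) (simp add: leibniz_det_permute_columns)
  finally show ?thesis .
qed

lemma leibniz_det_congruence:
  "leibniz_det n (\<lambda>i j. \<Sum>k<n. \<Sum>l<n. B i k * A k l * C j l)
     = leibniz_det n B * leibniz_det n A * leibniz_det n C"
proof -
  have "leibniz_det n (\<lambda>i j. \<Sum>k<n. \<Sum>l<n. B i k * A k l * C j l)
      = leibniz_det n (\<lambda>i j. \<Sum>k<n. B i k * (\<Sum>l<n. A k l * C j l))"
    by (simp add: sum_distrib_left mult.assoc)
  also have "\<dots> = leibniz_det n B * leibniz_det n A * leibniz_det n (\<lambda>i j. C j i)"
    by (simp only: leibniz_det_mult mult.assoc)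
  finally show ?thesis by (simp only: leibniz_det_transpose[of n C])
qed

text \<open>Relabelling the indices is a congruence with a permutation matrix, whose determinant is
  the sign.\<close>

lemma pfaffian_sum_permute:
  assumes "p permutes {..<2*m}"
  shows "pfaffian_sum m (\<lambda>i j. A (p i) (p j)) = of_int (sign p) * pfaffian_sum m A"
proof -
  let ?P = "\<lambda>i j. if j = p i then 1 else 0 :: real"
  have "leibniz_det (2*m) ?P = of_int (sign p) * leibniz_det (2*m) (\<lambda>i j. if i = j then 1 else 0)"
  proof -
    have "leibniz_det (2*m) ?P = leibniz_det (2*m) (\<lambda>i j. if i = inv_into UNIV p j then 1 else 0)"
      by (intro leibniz_det_cong) (use assms in \<open>auto simp: permutes_inv_eq\<close>)
    also have "\<dots> = of_int (sign (inv_into UNIV p)) * leibniz_det (2*m) (\<lambda>i j. if i = j then 1 else 0)"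
      by (rule leibniz_det_permute_columns) (rule permutes_inv[OF assms])
    finally show ?thesis
      using sign_inverse[OF permutes_imp_permutation[OF _ assms]] by simp
  qed
  moreover have "leibniz_det (2*m) (\<lambda>i j. if i = j then 1 else 0) = 1"
    by (subst leibniz_det_triangular) auto
  moreover have "pfaffian_sum m (\<lambda>i j. A (p i) (p j)) = pfaffian_sum m (\<lambda>i j. \<Sum>k<2*m. \<Sum>l<2*m. ?P i k * A k l * ?P j l)"
  proof (rule pfaffian_sum_cong)
    fix i j assume "i < 2*m" "j < 2*m"
    then have "p i < 2*m" "p j < 2*m" using assms permutes_in_image[OF assms] by auto
    moreover have "?P i k * A k l * ?P j l = (if l = p j then (if k = p i then A k l else 0) else 0)" for k l
      by simp
    ultimately show "A (p i) (p j) = (\<Sum>k<2*m. \<Sum>l<2*m. ?P i k * A k l * ?P j l)"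
      by simp
  qed
  ultimately show ?thesis by (simp add: pfaffian_sum_congruence)
qed

section \<open>The square of a Pfaffian sum\<close>

text \<open>The product of the transpositions (2i 2i+1) over i in \<open>I\<close>, written
  pointwise so that its values are found by case distinction.\<close>

definition pair_flip :: "nat set \<Rightarrow> nat \<Rightarrow> nat" where
  "pair_flip I k = (if k div 2 \<in> I then (if even k then k + 1 else k - 1) else k)"

lemma pair_flip_insert:
  assumes "i \<notin> I"
  shows "pair_flip (insert i I) = Transposition.transpose (2*i) (2*i+1) \<circ> pair_flip I"
proof
  fix k
  show "pair_flip (insert i I) k = (Transposition.transpose (2*i) (2*i+1) \<circ> pair_flip I) k"
  proof (cases "k div 2 = i")
    case True
    then have "k = 2*i \<or> k = 2*i+1" by presburger
    then show ?thesis using assms True by (auto simp: pair_flip_def Transposition.transpose_def)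
  next
    case False
    then have 1: "k \<noteq> 2*i" "k \<noteq> 2*i+1" by presburger+
    have 2: "k + 1 \<noteq> 2*i" if "even k" using that False by presburger
    have 3: "k + 1 \<noteq> 2*i + 1" using 1 by auto
    have 4: "k - 1 \<noteq> 2*i" "k - 1 \<noteq> 2*i + 1" if "odd k" using that False by presburger+
    show ?thesis using False 1 2 3 4 by (auto simp: pair_flip_def Transposition.transpose_def)
  qed
qed

lemma sign_pair_flip:
  assumes "finite I" "I \<subseteq> {..<m}"
  shows "pair_flip I permutes {..<2*m} \<and> sign (pair_flip I) = (-1) ^ card I"
  using assms
proof (induction I rule: finite_induct)
  case empty
  have "pair_flip {} = id" by (auto simp: pair_flip_def)
  then show ?case using permutes_id[of "{..<2*m}"] by (simp add: id_def)
next
  case (insert i I)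
  have t: "Transposition.transpose (2*i) (2*i+1) permutes {..<2*m}" using insert.prems by (intro permutes_swap_id) auto
  have f: "pair_flip I permutes {..<2*m}" using insert by auto
  have "sign (pair_flip (insert i I)) = - ((-1) ^ card I)"
    unfolding pair_flip_insert[OF insert.hyps(2)]
    using insert sign_compose[OF permutes_imp_permutation[OF _ t] permutes_imp_permutation[OF _ f]]
    by (simp add: sign_swap_id)
  moreover have "pair_flip (insert i I) permutes {..<2*m}"
    unfolding pair_flip_insert[OF insert.hyps(2)] by (rule permutes_compose[OF f t])
  ultimately show ?case using insert.hyps by simp
qed

text \<open>The standard symplectic matrix, a direct sum of blocks with rows (0, 1) and (-1, 0). It
  is the reference matrix by which the normalization of Pfaffian against determinant is
  fixed.\<close>

definition pair_matrix :: "nat \<Rightarrow> nat \<Rightarrow> real" where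
  "pair_matrix i j = (if even i \<and> j = i + 1 then 1 else if odd i \<and> i = j + 1 then -1 else 0)"

text \<open>Such a \<open>p\<close> performs the same permutation on the even and on the odd
  positions, so its sign is a square. Formally \<open>q\<close> is \<open>p\<close> on even indices
  and the identity on odd ones, conjugation by the flip \<phi> of all pairs moves this action to the
  odd indices, and \<open>p\<close> is the product of the two.\<close>

lemma sign_pair_preserving:
  fixes p :: "nat \<Rightarrow> nat"
  assumes p: "p permutes {..<2*m}"
    and ev: "\<And>i. i < m \<Longrightarrow> even (p (2*i))" and od: "\<And>i. i < m \<Longrightarrow> p (2*i+1) = p (2*i) + 1"
  shows "sign p = 1"
proof -
  let ?\<phi> = "pair_flip {..<m}"
  have \<phi>: "?\<phi> permutes {..<2*m}" using sign_pair_flip[of "{..<m}" m] by auto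
  define q where "q k = (if even k then p k else k)" for k
  have pe: "even (p k)" if "even k" for k
  proof (cases "k < 2*m")
    case True with ev[of "k div 2"] that show ?thesis by auto
  next
    case False with p that show ?thesis by (auto simp: permutes_not_in)
  qed
  have "inj_on q {..<2*m}"
  proof (rule inj_onI)
    fix x y assume "q x = q y"
    then show "x = y" using pe[of x] pe[of y] injD[OF permutes_inj[OF p], of x y]
      unfolding q_def by presburger
  qed
  moreover have "q \<in> {..<2*m} \<rightarrow> {..<2*m}" using permutes_lessThan[OF p] by (auto simp: q_def)
  moreover have "(\<lambda>i. if i < 2*m then q i else i) = q" using p by (auto simp: q_def permutes_not_in)
  ultimately have q: "q permutes {..<2*m}" using permutes_extend[of q "2*m"] by simp
  have "p = q \<circ> (?\<phi> \<circ> (q \<circ> ?\<phi>))"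
  proof
    fix k
    show "p k = (q \<circ> (?\<phi> \<circ> (q \<circ> ?\<phi>))) k"
    proof (cases "k < 2*m")
      case False
      then have "\<not> k div 2 < m" by auto
      moreover have "p k = k" by (rule permutes_not_in[OF p]) (use False in simp)
      ultimately show ?thesis by (simp add: q_def pair_flip_def)
    next
      case True
      then have k2: "k div 2 < m" by auto
      show ?thesis
      proof (cases "even k")
        case ek: True
        then have "Suc k div 2 = k div 2" by presburger
        with ek k2 show ?thesis by (simp add: q_def pair_flip_def)
      next
        case ok: False
        then obtain i where k: "k = 2*i+1" by (elim oddE)
        with k2 have i: "i < m" by simp
        have "p (2*i) div 2 < m" using permutes_lessThan[OF p, of "2*i"] i by auto
        then show ?thesis unfolding k using i od[OF i] ev[OF i] by (simp add: q_def pair_flip_def)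
      qed
    qed
  qed
  then have "sign p = sign (q \<circ> (?\<phi> \<circ> (q \<circ> ?\<phi>)))" by (rule arg_cong)
  also have "\<dots> = sign q * (sign ?\<phi> * (sign q * sign ?\<phi>))"
  proof -
    have "permutation q" "permutation ?\<phi>"
      using permutes_imp_permutation[OF finite_lessThan q] permutes_imp_permutation[OF finite_lessThan \<phi>] .
    then show ?thesis by (simp only: sign_compose permutation_compose)
  qed
  also have "\<dots> = (sign q * sign q) * (sign ?\<phi> * sign ?\<phi>)" by (simp only: mult_ac)
  finally show ?thesis by simp
qed

text \<open>No cancellation occurs. If the term of \<open>p\<close> is nonzero, \<open>p\<close>
  maps pairs to pairs and reverses those in \<open>I\<close>; composing with the flip of
  \<open>I\<close> gives a permutation of sign 1, so sign and product are both (-1)^|I|. Positivity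
  is all that is needed, since the value cancels later.\<close>

lemma pfaffian_sum_pair_matrix_pos: "pfaffian_sum m pair_matrix > 0"
proof -
  let ?t = "\<lambda>p. of_int (sign p) * (\<Prod>i<m. pair_matrix (p (2*i)) (p (2*i+1)))"
  have nonneg: "?t p \<ge> 0" if p: "p permutes {..<2*m}" for p
  proof (cases "(\<Prod>i<m. pair_matrix (p (2*i)) (p (2*i+1))) = 0")
    case False
    then have nz: "pair_matrix (p (2*i)) (p (2*i+1)) \<noteq> 0" if "i < m" for i
      using that by (auto simp: prod_zero_iff)
    define I where "I = {i. i < m \<and> odd (p (2*i))}"
    have I: "finite I" "I \<subseteq> {..<m}" by (auto simp: I_def)
    have fl: "pair_flip I permutes {..<2*m}" and sfl: "sign (pair_flip I) = (-1) ^ card I"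
      using sign_pair_flip[OF I] by auto
    have "sign (p \<circ> pair_flip I) = 1"
    proof (rule sign_pair_preserving)
      show "p \<circ> pair_flip I permutes {..<2*m}" by (rule permutes_compose[OF fl p])
      fix i assume i: "i < m"
      show "even ((p \<circ> pair_flip I) (2*i))" "(p \<circ> pair_flip I) (2*i+1) = (p \<circ> pair_flip I) (2*i) + 1"
        using nz[OF i] i by (auto simp: pair_flip_def pair_matrix_def I_def split: if_splits)
    qed
    then have sg: "sign p * (-1) ^ card I = 1"
      using sign_compose[OF permutes_imp_permutation[OF finite_lessThan p] permutes_imp_permutation[OF finite_lessThan fl]]
      unfolding sfl by presburger
    have "(\<Prod>i<m. pair_matrix (p (2*i)) (p (2*i+1))) = (\<Prod>i<m. if i \<in> I then -1 else 1)"
    proof (rule prod.cong)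
      fix i assume "i \<in> {..<m}"
      then show "pair_matrix (p (2*i)) (p (2*i+1)) = (if i \<in> I then -1 else 1)"
        using nz[of i] by (auto simp: pair_matrix_def I_def split: if_splits)
    qed simp
    also have "\<dots> = (-1) ^ card I"
      using I by (simp add: prod.If_cases Int_absorb1)
    finally have "?t p = of_int (sign p * (-1) ^ card I)" by simp
    then show ?thesis unfolding sg by simp
  next
    case True then show ?thesis by (simp only: mult_zero_right order_refl)
  qed
  have "0 < ?t id" by (simp add: pair_matrix_def)
  also have "?t id \<le> pfaffian_sum m pair_matrix"
    unfolding pfaffian_sum_def
    by (rule member_le_sum[of id]) (use nonneg in \<open>auto simp: permutes_id finite_permutations\<close>)
  finally show ?thesis .
qed

section \<open>Elimination for skew matrices\<close>

definition skew_upto :: "nat \<Rightarrow> (nat \<Rightarrow> nat \<Rightarrow> real) \<Rightarrow> bool" where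
  "skew_upto n A \<longleftrightarrow> (\<forall>i<n. \<forall>j<n. A j i = - A i j)"

lemma skew_upto_congruence:
  assumes "skew_upto n A"
  shows "skew_upto n (\<lambda>i j. \<Sum>k<n. \<Sum>l<n. B i k * A k l * B j l)"
  unfolding skew_upto_def
proof (intro allI impI)
  fix i j
  have "(\<Sum>k<n. \<Sum>l<n. B j k * A k l * B i l) = (\<Sum>l<n. \<Sum>k<n. B j k * A k l * B i l)"
    by (rule sum.swap)
  also have "\<dots> = (\<Sum>k<n. \<Sum>l<n. - (B i k * A k l * B j l))"
  proof (intro sum.cong refl)
    fix k l assume "k \<in> {..<n}" "l \<in> {..<n}"
    then have "A l k = - A k l" using assms unfolding skew_upto_def by blast
    then show "B j l * A l k * B i k = - (B i k * A k l * B j l)" by simp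
  qed
  finally show "(\<Sum>k<n. \<Sum>l<n. B j k * A k l * B i l) = - (\<Sum>k<n. \<Sum>l<n. B i k * A k l * B j l)"
    by (simp add: sum_negf)
qed

definition partner :: "nat \<Rightarrow> nat" where
  "partner i = (if even i then i + 1 else i - 1)"

lemma partner_less: "i < 2*k \<Longrightarrow> partner i < 2*k"
  by (auto simp: partner_def elim!: evenE)

text \<open>The invariant of the elimination: the first \<open>k\<close> pairs have been split off
  as 2x2 blocks. Only rows are mentioned because skewness transfers the statement to the
  columns.\<close>

definition paired_rows :: "nat \<Rightarrow> nat \<Rightarrow> (nat \<Rightarrow> nat \<Rightarrow> real) \<Rightarrow> bool" where
  "paired_rows n k A \<longleftrightarrow> (\<forall>i<2*k. \<forall>j<n. j \<noteq> partner i \<longrightarrow> A i j = 0)"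

text \<open>The identity Pf^2 = det in a form free of normalization. Both sides are multiplied by
  (det B)^2 when \<open>A\<close> is replaced by B A B^T, so the constant of proportionality can be
  read off at \<open>pair_matrix\<close>; multiplying out avoids divisions.\<close>

definition pfaffian_square_eq :: "nat \<Rightarrow> (nat \<Rightarrow> nat \<Rightarrow> real) \<Rightarrow> bool" where
  "pfaffian_square_eq m A \<longleftrightarrow>
     (pfaffian_sum m A)\<^sup>2 * leibniz_det (2*m) pair_matrix = (pfaffian_sum m pair_matrix)\<^sup>2 * leibniz_det (2*m) A"

lemma pfaffian_square_eq_congruence:
  assumes "leibniz_det (2*m) B \<noteq> 0"
    and "pfaffian_square_eq m (\<lambda>i j. \<Sum>k<2*m. \<Sum>l<2*m. B i k * A k l * B j l)"
  shows "pfaffian_square_eq m A"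
  using assms unfolding pfaffian_square_eq_def pfaffian_sum_congruence leibniz_det_congruence
  by (simp add: power2_eq_square)

lemma pfaffian_square_eq_permute:
  assumes p: "p permutes {..<2*m}" and "pfaffian_square_eq m (\<lambda>i j. A (p i) (p j))"
  shows "pfaffian_square_eq m A"
proof -
  have 1: "(real_of_int (sign p))\<^sup>2 = 1" by (simp add: power2_eq_square flip: of_int_mult)
  have "leibniz_det (2*m) (\<lambda>i j. A (p i) (p j)) = of_int (sign p) * leibniz_det (2*m) (\<lambda>i j. A (p i) j)"
    by (rule leibniz_det_permute_columns[OF p, of "\<lambda>i j. A (p i) j"])
  also have "leibniz_det (2*m) (\<lambda>i j. A (p i) j) = leibniz_det (2*m) (\<lambda>i j. A (p j) i)"
    by (rule leibniz_det_transpose[symmetric])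
  also have "\<dots> = of_int (sign p) * leibniz_det (2*m) (\<lambda>i j. A j i)"
    by (rule leibniz_det_permute_columns[OF p, of "\<lambda>i j. A j i"])
  also have "leibniz_det (2*m) (\<lambda>i j. A j i) = leibniz_det (2*m) A" by (rule leibniz_det_transpose)
  finally have "leibniz_det (2*m) (\<lambda>i j. A (p i) (p j)) = leibniz_det (2*m) A"
    using 1 by (simp add: power2_eq_square)
  with assms(2) 1 show ?thesis
    unfolding pfaffian_square_eq_def pfaffian_sum_permute[OF p] by (simp add: power_mult_distrib)
qed

text \<open>The end of the elimination: \<open>A\<close> is D J D with J =
  \<open>pair_matrix\<close> and a diagonal D that carries the entry of each block on the even index
  and 1 on the odd one.\<close>

lemma pfaffian_square_eq_paired:
  assumes sk: "skew_upto (2*m) A" and pr: "paired_rows (2*m) m A"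
  shows "pfaffian_square_eq m A"
proof -
  define d where "d i = (if even i then A i (i+1) else 1)" for i
  let ?D = "\<lambda>i j. if j = i then d i else 0"
  have eq: "A i j = (\<Sum>k<2*m. \<Sum>l<2*m. ?D i k * pair_matrix k l * ?D j l)" if ij: "i < 2*m" "j < 2*m" for i j
  proof -
    have "?D i k * pair_matrix k l * ?D j l = (if l = j then (if k = i then d i * pair_matrix i j * d j else 0) else 0)" for k l
      by simp
    then have "(\<Sum>k<2*m. \<Sum>l<2*m. ?D i k * pair_matrix k l * ?D j l) = d i * pair_matrix i j * d j"
      using ij by simp
    also have "\<dots> = A i j"
    proof (cases "j = partner i")
      case False
      then have "pair_matrix i j = 0" by (auto simp: pair_matrix_def partner_def)
      with False pr ij show ?thesis by (simp add: paired_rows_def)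
    next
      case True
      have "A i j = - A j i" using sk ij unfolding skew_upto_def by (metis add.inverse_inverse)
      with True show ?thesis by (cases "even i") (auto simp: pair_matrix_def partner_def d_def elim!: oddE)
    qed
    finally show ?thesis by simp
  qed
  have "pfaffian_sum m A = leibniz_det (2*m) ?D * pfaffian_sum m pair_matrix"
    unfolding pfaffian_sum_congruence[symmetric] by (rule pfaffian_sum_cong) (rule eq)
  moreover have "leibniz_det (2*m) A = leibniz_det (2*m) ?D * leibniz_det (2*m) pair_matrix * leibniz_det (2*m) ?D"
    unfolding leibniz_det_congruence[symmetric] by (rule leibniz_det_cong) (rule eq)
  ultimately show ?thesis unfolding pfaffian_square_eq_def by (simp add: power2_eq_square)
qed

text \<open>One step of symmetric Gaussian elimination with the 2x2 block at positions 2k, 2k+1 as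
  pivot. The congruence matrix \<open>B\<close> is unipotent lower triangular, hence of determinant
  1, and leaves the first 2k+2 rows in place up to column operations.\<close>

lemma pfaffian_square_eq_elimination_step:
  assumes k: "k < m" and sk: "skew_upto (2*m) A" and pr: "paired_rows (2*m) k A"
    and nz: "A (2*k) (2*k+1) \<noteq> 0"
    and IH: "\<And>A. skew_upto (2*m) A \<Longrightarrow> paired_rows (2*m) (Suc k) A \<Longrightarrow> pfaffian_square_eq m A"
  shows "pfaffian_square_eq m A"
proof -
  let ?a = "2*k" and ?b = "2*k+1" and ?n = "2*m"
  define c where "c = A ?a ?b"
  have c: "c \<noteq> 0" using nz unfolding c_def .
  \<comment> \<open>Adding \<open>x i\<close> times row 2k clears column 2k+1, because the pivot
    entry there is \<open>c\<close>; adding \<open>y i\<close> times row 2k+1 clears column 2k,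
    where the entry is \<open>- c\<close>. This accounts for the opposite signs.\<close>
  define x where "x i = (if i \<ge> 2*k+2 then - A i ?b / c else 0)" for i
  define y where "y i = (if i \<ge> 2*k+2 then A i ?a / c else 0)" for i
  define B where "B i l = (if l = i then 1 else 0) + (if l = ?a then x i else 0) + (if l = ?b then y i else 0)" for i l
  have skA: "A j i = - A i j" if "i < ?n" "j < ?n" for i j using sk that unfolding skew_upto_def by blast
  have ab: "?a < ?n" "?b < ?n" using k by auto
  have A0: "A ?a ?a = 0" "A ?b ?b = 0" "A ?b ?a = - c"
    using skA[OF ab(1) ab(1)] skA[OF ab(2) ab(2)] skA[OF ab] unfolding c_def by simp_all
  have prA: "A i j = 0" if "i < 2*k" "j < ?n" "j \<noteq> partner i" for i j using pr that by (auto simp: paired_rows_def)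
  have prA': "A j i = 0" if "i < 2*k" "j < ?n" "j \<noteq> partner i" for i j
    using prA[OF that] skA[of i j] that k by simp
  have sumB: "(\<Sum>l<?n. g l * B j l) = g j + x j * g ?a + y j * g ?b" if "j < ?n" for g :: "nat \<Rightarrow> real" and j
  proof -
    have "g l * B j l = (if l = j then g l else 0) + (if l = ?a then x j * g l else 0) + (if l = ?b then y j * g l else 0)" for l
      by (simp add: B_def algebra_simps)
    then show ?thesis using that ab by (simp add: sum.distrib)
  qed
  have sumB': "(\<Sum>l<?n. B j l * g l) = g j + x j * g ?a + y j * g ?b" if "j < ?n" for g :: "nat \<Rightarrow> real" and j
    using sumB[OF that, of g] by (simp only: mult.commute)
  let ?A' = "\<lambda>i j. \<Sum>k<?n. \<Sum>l<?n. B i k * A k l * B j l"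
  have A': "?A' i j = A i j + x j * A i ?a + y j * A i ?b + x i * (A ?a j + x j * A ?a ?a + y j * A ?a ?b)
      + y i * (A ?b j + x j * A ?b ?a + y j * A ?b ?b)" if "i < ?n" "j < ?n" for i j
  proof -
    have "?A' i j = (\<Sum>k<?n. B i k * (\<Sum>l<?n. A k l * B j l))" by (simp only: sum_distrib_left mult.assoc)
    then show ?thesis by (simp only: sumB[OF that(2)] sumB'[OF that(1)])
  qed
  have detB: "leibniz_det ?n B = 1"
  proof (subst leibniz_det_triangular)
    fix i j assume "i < j" "j < ?n" then show "B i j = 0" by (auto simp: B_def x_def y_def)
  next
    show "(\<Prod>i<?n. B i i) = 1" by (intro prod.neutral) (auto simp: B_def x_def y_def)
  qed
  have "pfaffian_square_eq m ?A'"
  proof (rule IH)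
    show "skew_upto ?n ?A'" by (rule skew_upto_congruence[OF sk])
    show "paired_rows ?n (Suc k) ?A'"
      unfolding paired_rows_def
    proof (intro allI impI)
      fix i j assume i: "i < 2 * Suc k" and j: "j < ?n" and ne: "j \<noteq> partner i"
      have i_n: "i < ?n" using i k by auto
      have xy0: "x i = 0" "y i = 0" using i by (auto simp: x_def y_def)
      have A'ij: "?A' i j = A i j + x j * A i ?a + y j * A i ?b"
        unfolding A'[OF i_n j] xy0 by simp
      have low: "?A' i j = 0" if "j < 2*k" "i \<ge> 2*k"
      proof -
        have "A i j = 0" using prA'[OF that(1) i_n] that partner_less[OF that(1)] by auto
        then show ?thesis unfolding A'ij using that by (simp add: x_def y_def)
      qed
      have "partner ?a = ?b" "partner ?b = ?a" by (simp_all add: partner_def)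
      then consider "i < 2*k" | "i \<ge> 2*k" "j < 2*k" | "i = ?a" "j = ?a \<or> j \<ge> 2*k+2" | "i = ?b" "j = ?b \<or> j \<ge> 2*k+2"
      proof -
        assume P: "partner ?a = ?b" "partner ?b = ?a"
        have "i < 2*k \<or> i = ?a \<or> i = ?b" using i by auto
        moreover have "j < 2*k \<or> j = ?a \<or> j = ?b \<or> j \<ge> 2*k+2" by linarith
        ultimately show thesis using that ne P by (metis le_add1 le_refl)
      qed
      then show "?A' i j = 0"
      proof cases
        case 1
        then have "A i ?a = 0" "A i ?b = 0" "A i j = 0"
          using prA[OF 1 j ne] prA[OF 1 ab(1)] prA[OF 1 ab(2)] partner_less[OF 1] by auto
        then show ?thesis unfolding A'ij by simp
      next
        case 2 then show ?thesis using low by blast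
      next
        case 3
        have "A ?a j = - A j ?a" using skA[OF j ab(1)] .
        then show ?thesis unfolding A'ij unfolding 3(1)
          using 3(2) A0 c c_def by (auto simp: x_def y_def)
      next
        case 4
        have "A ?b j = - A j ?b" using skA[OF j ab(2)] .
        then show ?thesis unfolding A'ij unfolding 4(1)
          using 4(2) A0 c by (auto simp: x_def y_def)
      qed
    qed
  qed
  then show ?thesis by (rule pfaffian_square_eq_congruence[rotated]) (simp add: detB)
qed

text \<open>Induction on the number of pairs still to be split off. Either the remaining block is
  zero and \<open>A\<close> already has block form, or a nonzero entry of it is permuted into the
  pivot position.\<close>

lemma pfaffian_square_eq_paired_rows:
  assumes "k \<le> m" "skew_upto (2*m) A" "paired_rows (2*m) k A"
  shows "pfaffian_square_eq m A"
  using assms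
proof (induction "m - k" arbitrary: k A)
  case 0
  then show ?case by (auto intro: pfaffian_square_eq_paired)
next
  case (Suc d)
  then have k: "k < m" by simp
  show ?case
  proof (cases "\<exists>p q. 2*k \<le> p \<and> p < 2*m \<and> 2*k \<le> q \<and> q < 2*m \<and> A p q \<noteq> 0")
    case False
    have "paired_rows (2*m) m A" unfolding paired_rows_def
    proof (intro allI impI)
      fix i j assume ij: "i < 2*m" "j < 2*m" "j \<noteq> partner i"
      consider "i < 2*k" | "j < 2*k" "2*k \<le> i" | "2*k \<le> i" "2*k \<le> j" by linarith
      then show "A i j = 0"
      proof cases
        case 1 with Suc.prems ij show ?thesis by (auto simp: paired_rows_def)
      next
        case 2
        have "i \<noteq> partner j" using ij(3) by (auto simp: partner_def split: if_splits)
        then have "A j i = 0" using 2 Suc.prems(3) ij unfolding paired_rows_def by blast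
        moreover have "A i j = - A j i" using Suc.prems(2) ij unfolding skew_upto_def by blast
        ultimately show ?thesis by simp
      next
        case 3 with False ij show ?thesis by auto
      qed
    qed
    then show ?thesis using Suc.prems by (intro pfaffian_square_eq_paired)
  next
    case True
    then obtain p q where pq: "2*k \<le> p" "p < 2*m" "2*k \<le> q" "q < 2*m" "A p q \<noteq> 0" by blast
    have "A p p = - A p p" using pq Suc.prems(2) unfolding skew_upto_def by blast
    then have "p \<noteq> q" using pq by auto
    \<comment> \<open>The transposition that brings \<open>p\<close> to 2k may displace
      \<open>q\<close>; \<open>q'\<close> is where \<open>q\<close> lies afterwards. Thus
      \<open>t\<close> sends 2k to \<open>p\<close> and 2k+1 to \<open>q\<close>.\<close>
    define q' where "q' = Transposition.transpose (2*k) p q"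
    define t where "t = Transposition.transpose (2*k) p \<circ> Transposition.transpose (2*k+1) q'"
    have q': "2*k < q'" "q' < 2*m" using pq \<open>p \<noteq> q\<close> k by (auto simp: q'_def Transposition.transpose_def)
    have tt: "t permutes {..<2*m}" unfolding t_def
      using pq q' k by (intro permutes_compose permutes_swap_id) auto
    have t_ab: "t (2*k) = p" "t (2*k+1) = q"
      using q' \<open>p \<noteq> q\<close> by (auto simp: t_def q'_def Transposition.transpose_def split: if_splits)
    have t_id: "t i = i" if "i < 2*k" for i using that q' pq by (auto simp: t_def Transposition.transpose_def)
    have "pfaffian_square_eq m (\<lambda>i j. A (t i) (t j))"
    proof (rule pfaffian_square_eq_elimination_step[OF k])
      show "skew_upto (2*m) (\<lambda>i j. A (t i) (t j))"
        using Suc.prems(2) permutes_lessThan[OF tt] unfolding skew_upto_def by blast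
      show "paired_rows (2*m) k (\<lambda>i j. A (t i) (t j))" unfolding paired_rows_def
      proof (intro allI impI)
        fix i j assume i: "i < 2*k" and j: "j < 2*m" "j \<noteq> partner i"
        have "partner i < 2*k" using i by (rule partner_less)
        then have "t j \<noteq> partner i" using j t_id permutes_inj[OF tt] by (metis injD)
        then have "A i (t j) = 0"
          using Suc.prems(3) i permutes_lessThan[OF tt j(1)] unfolding paired_rows_def by blast
        then show "A (t i) (t j) = 0" unfolding t_id[OF i] .
      qed
      show "A (t (2*k)) (t (2*k+1)) \<noteq> 0" unfolding t_ab by (rule pq)
      fix A :: "nat \<Rightarrow> nat \<Rightarrow> real"
      assume "skew_upto (2*m) A" "paired_rows (2*m) (Suc k) A"
      then show "pfaffian_square_eq m A" using Suc.hyps(1)[of "Suc k" A] Suc.hyps(2) k by simp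
    qed
    then show ?thesis by (rule pfaffian_square_eq_permute[OF tt])
  qed
qed

theorem pfaffian_sum_square:
  assumes "skew_upto (2*m) A"
  shows "(pfaffian_sum m A)\<^sup>2 * leibniz_det (2*m) pair_matrix
           = (pfaffian_sum m pair_matrix)\<^sup>2 * leibniz_det (2*m) A"
  using pfaffian_square_eq_paired_rows[of 0 m A] assms
  by (simp add: paired_rows_def pfaffian_square_eq_def)

text \<open>A unitriangular change of columns replaces the monomials by the Newton polynomials, of
  which the j-th vanishes at all x_i with i < j. The matrix becomes triangular and its diagonal is
  the product.\<close>

lemma leibniz_det_vandermonde: "leibniz_det n (\<lambda>i j. x i ^ j) = (\<Prod>k<n. \<Prod>j<k. x k - x j)"
proof -
  define p where "p j = (\<Prod>l<j. [:- x l, 1:])" for j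
  have deg: "degree (p j) = j" for j by (simp add: p_def degree_prod_eq_sum_degree)
  have lead: "coeff (p j) j = 1" for j
  proof -
    have "lead_coeff (p j) = 1" by (simp add: p_def lead_coeff_prod)
    then show ?thesis by (simp add: deg)
  qed
  have pe: "poly (p j) (x i) = (\<Sum>k<n. x i ^ k * coeff (p j) k)" if "j < n" for i j
  proof -
    have "poly (p j) (x i) = (\<Sum>k\<le>j. coeff (p j) k * x i ^ k)" by (simp add: poly_altdef deg)
    also have "\<dots> = (\<Sum>k<n. coeff (p j) k * x i ^ k)"
      by (rule sum.mono_neutral_left) (use that in \<open>auto intro: coeff_eq_0 simp: deg\<close>)
    finally show ?thesis by (simp add: mult.commute)
  qed
  have "leibniz_det n (\<lambda>i j. poly (p j) (x i)) = leibniz_det n (\<lambda>i j. \<Sum>k<n. x i ^ k * coeff (p j) k)"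
    by (rule leibniz_det_cong) (rule pe)
  also have "\<dots> = leibniz_det n (\<lambda>i j. x i ^ j) * leibniz_det n (\<lambda>i j. coeff (p j) i)"
    by (rule leibniz_det_mult)
  also have "leibniz_det n (\<lambda>i j. coeff (p j) i) = leibniz_det n (\<lambda>i j. coeff (p i) j)"
    by (rule leibniz_det_transpose)
  also have "\<dots> = 1" by (subst leibniz_det_triangular) (auto intro: coeff_eq_0 simp: deg lead)
  finally have "leibniz_det n (\<lambda>i j. x i ^ j) = leibniz_det n (\<lambda>i j. poly (p j) (x i))" by simp
  also have "\<dots> = (\<Prod>i<n. poly (p i) (x i))"
    by (rule leibniz_det_triangular) (auto simp: p_def poly_prod)
  finally show ?thesis by (simp add: p_def poly_prod)
qed

section \<open>Jacobi polynomials\<close>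

lemma sigma_finite_I11: "sigma_finite_measure I11"
  by (rule sigma_finite_measure_restrict_space) (auto intro: sigma_finite_lborel)

lemma space_I11 [simp]: "space I11 = {-1..1}"
  by (simp add: space_restrict_space)

lemma borel_measurable_I11: "g \<in> borel_measurable borel \<Longrightarrow> g \<in> borel_measurable I11"
  by (rule measurable_restrict_space1) simp

lemma has_integral_nonneg_I11:
  fixes g :: "real \<Rightarrow> real"
  assumes g: "g \<in> borel_measurable borel" "\<And>x. 0 \<le> g x" and I: "(g has_integral I) {-1..1}"
  shows "integrable I11 g" "integral\<^sup>L I11 g = I"
proof -
  have "0 \<le> I" using has_integral_nonneg[OF I] g(2) by auto
  have nn: "integral\<^sup>N lborel (\<lambda>x. ennreal (g x) * indicator {-1..1} x) = ennreal I"
  proof -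
    let ?g = "\<lambda>x. if x \<in> {-1..1} then g x else 0"
    have "?g \<in> borel_measurable borel" using g(1) by measurable
    moreover have "(?g has_integral I) UNIV" using I unfolding has_integral_restrict_UNIV .
    ultimately have "integral\<^sup>N lborel (\<lambda>x. ennreal (?g x)) = ennreal I"
      using g(2) by (intro nn_integral_has_integral_lborel) auto
    then show ?thesis by (rule trans[rotated]) (auto intro!: nn_integral_cong)
  qed
  then have nn': "integral\<^sup>N I11 (\<lambda>x. ennreal (g x)) = ennreal I"
    by (simp add: nn_integral_restrict_space)
  show i: "integrable I11 g"
    by (rule integrableI_nonneg) (use g nn' in \<open>auto intro: borel_measurable_I11\<close>)
  show "integral\<^sup>L I11 g = I"
    using nn_integral_eq_integral[OF i] g(2) nn' \<open>0 \<le> I\<close> by (auto simp: integral_nonneg_AE)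
qed

lemma integrable_I11_has_integral:
  fixes g :: "real \<Rightarrow> real"
  assumes "integrable I11 g"
  shows "(g has_integral (integral\<^sup>L I11 g)) {-1..1}"
proof -
  have "set_integrable lborel {-1..1} g"
    using assms by (simp add: integrable_restrict_space set_integrable_def)
  note set_borel_integral_eq_integral[OF this]
  moreover have "integral\<^sup>L I11 g = (LINT x:{-1..1}|lborel. g x)"
    by (simp add: integral_restrict_space set_lebesgue_integral_def)
  ultimately show ?thesis by (simp add: has_integral_iff)
qed

text \<open>The Beta integral after the substitution x = 2t - 1.\<close>

lemma jacobi_weight_integral:
  fixes al be :: real
  assumes "al > -1" "be > -1"
  shows "integrable I11 (\<lambda>x. (1 - x) powr al * (1 + x) powr be)"
    and "integral\<^sup>L I11 (\<lambda>x. (1 - x) powr al * (1 + x) powr be) = 2 powr (al + be + 1) * Beta (al + 1) (be + 1)"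
proof -
  have "((\<lambda>t. t powr (be + 1 - 1) * (1 - t) powr (al + 1 - 1)) has_integral Beta (be + 1) (al + 1)) (cbox 0 1)"
    using has_integral_Beta_real[of "be + 1" "al + 1"] assms by simp
  note aff = has_integral_affinity[OF this, of "1/2" "1/2"]
  have "((\<lambda>x. ((1 + x) / 2) powr be * ((1 - x) / 2) powr al) has_integral 2 * Beta (be + 1) (al + 1)) {-1..1}"
  proof -
    have "(\<lambda>x::real. 2 * x - 1) ` {0..1} = {-1..1}"
      using image_affinity_atLeastAtMost_diff[of 2 1 0 "1::real"] by simp
    moreover have "1/2 - x/2 = (1 - x) / 2" "1/2 + x/2 = (1 + x) / 2" for x :: real
      by (auto simp: field_simps)
    ultimately show ?thesis
      using aff by (simp add: algebra_simps add_divide_distrib diff_divide_distrib)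
  qed
  from has_integral_mult_right[OF this, of "2 powr (al + be)"]
  have *: "((\<lambda>x. 2 powr (al + be) * (((1 + x) / 2) powr be * ((1 - x) / 2) powr al)) has_integral
      2 powr (al + be) * (2 * Beta (be + 1) (al + 1))) {-1..1}" .
  have "((\<lambda>x. (1 - x) powr al * (1 + x) powr be) has_integral
      2 powr (al + be) * (2 * Beta (be + 1) (al + 1))) {-1..1}"
    by (rule has_integral_eq[OF _ *]) (auto simp: powr_divide powr_add)
  moreover have "2 powr (al + be) * (2 * Beta (be + 1) (al + 1)) = 2 powr (al + be + 1) * Beta (al + 1) (be + 1)"
    by (simp add: powr_add Beta_commute[of "be + 1"])
  ultimately have h: "((\<lambda>x. (1 - x) powr al * (1 + x) powr be) has_integral
      2 powr (al + be + 1) * Beta (al + 1) (be + 1)) {-1..1}" by simp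
  show "integrable I11 (\<lambda>x. (1 - x) powr al * (1 + x) powr be)"
    "integral\<^sup>L I11 (\<lambda>x. (1 - x) powr al * (1 + x) powr be) = 2 powr (al + be + 1) * Beta (al + 1) (be + 1)"
    by (rule has_integral_nonneg_I11[OF _ _ h]; simp)+
qed

text \<open>Pascal's rule: a difference of order n+1 of \<open>g\<close> is the difference of order
  n of g(y+1) - g(y).\<close>

lemma forward_difference_Suc:
  fixes g :: "real \<Rightarrow> real"
  shows "(\<Sum>s\<le>Suc n. (-1) ^ s * real (Suc n choose s) * g (x + real (Suc n - s)))
       = (\<Sum>s\<le>n. (-1) ^ s * real (n choose s) * (g (x + real (n - s) + 1) - g (x + real (n - s))))"
proof -
  have "(\<Sum>s\<le>Suc n. (-1) ^ s * real (Suc n choose s) * g (x + real (Suc n - s)))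
      = g (x + real (Suc n)) + (\<Sum>t\<le>n. (-1) ^ Suc t * real (n choose Suc t) * g (x + real (n - t)))
        - (\<Sum>t\<le>n. (-1) ^ t * real (n choose t) * g (x + real (n - t)))"
    by (subst sum.atMost_Suc_shift) (simp add: algebra_simps sum.distrib sum_negf sum_subtractf)
  also have "g (x + real (Suc n)) + (\<Sum>t\<le>n. (-1) ^ Suc t * real (n choose Suc t) * g (x + real (n - t)))
      = (\<Sum>s\<le>Suc n. (-1) ^ s * real (n choose s) * g (x + real (Suc n - s)))"
    by (subst sum.atMost_Suc_shift) simp
  also have "\<dots> = (\<Sum>s\<le>n. (-1) ^ s * real (n choose s) * g (x + real (n - s) + 1))"
  proof -
    have "(\<Sum>s\<le>n. (-1) ^ s * real (n choose s) * g (x + real (Suc n - s))) =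
       (\<Sum>s\<le>n. (-1) ^ s * real (n choose s) * g (x + real (n - s) + 1))"
      by (intro sum.cong refl) (auto simp: Suc_diff_le algebra_simps)
    then show ?thesis by (simp del: of_nat_Suc)
  qed
  finally show ?thesis by (simp add: right_diff_distrib sum_subtractf)
qed

text \<open>A difference of order n kills polynomials of degree below n and gives n! on monic ones
  of degree n. Rising factorials suit the induction: the first difference of (y)_(k+1) is (k+1)
  (y+1)_k, again of this kind with a shifted argument, which is why \<open>x\<close> is
  generalized.\<close>

lemma forward_difference_pochhammer:
  fixes x :: real
  assumes "m \<le> n"
  shows "(\<Sum>s\<le>n. (-1) ^ s * real (n choose s) * pochhammer (x + real (n - s)) m)
       = (if m < n then 0 else fact n)"
  using assms
proof (induction n arbitrary: m x)
  case 0
  then show ?case by simp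
next
  case (Suc n)
  show ?case
  proof (cases m)
    case 0
    then show ?thesis by (subst forward_difference_Suc[of n "\<lambda>y. pochhammer y m"]) simp
  next
    case (Suc k)
    have d: "pochhammer (y + 1) (Suc k) - pochhammer y (Suc k) = real (Suc k) * pochhammer (y + 1) k" for y :: real
      unfolding pochhammer_rec[of y k] pochhammer_rec'[of "y + 1" k] by (simp add: algebra_simps)
    have "(\<Sum>s\<le>Suc n. (-1) ^ s * real (Suc n choose s) * pochhammer (x + real (Suc n - s)) m)
        = (\<Sum>s\<le>n. (-1) ^ s * real (n choose s) * (real (Suc k) * pochhammer (x + real (n - s) + 1) k))"
      unfolding Suc by (subst forward_difference_Suc[of n "\<lambda>y. pochhammer y (Suc k)"]) (simp only: d)
    also have "\<dots> = real (Suc k) * (\<Sum>s\<le>n. (-1) ^ s * real (n choose s) * pochhammer ((x + 1) + real (n - s)) k)"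
      unfolding sum_distrib_left by (intro sum.cong refl) (simp add: algebra_simps)
    also have "\<dots> = real (Suc k) * (if k < n then 0 else fact n)"
      using Suc Suc.prems by (subst Suc.IH) auto
    finally show ?thesis using Suc Suc.prems by auto
  qed
qed

lemma pochhammer_eq_Gamma: "0 < z \<Longrightarrow> pochhammer z m = Gamma (z + real m) / Gamma z" for z :: real
  by (rule pochhammer_Gamma) (auto elim!: nonpos_Ints_cases)

lemma gbinomial_eq_Gamma:
  fixes z :: real
  assumes "z - real k + 1 > 0"
  shows "z gchoose k = Gamma (z + 1) / (fact k * Gamma (z - real k + 1))"
proof -
  have "pochhammer (z - real k + 1) k = Gamma (z + 1) / Gamma (z - real k + 1)"
    by (subst pochhammer_eq_Gamma[OF assms]) simp
  then show ?thesis by (simp add: gbinomial_pochhammer')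
qed

text \<open>At y = 0 both sides vanish for all exponents, because \<open>0 powr c = 0\<close>. So
  weights can be merged on the closed interval.\<close>

lemma power_mult_powr_nonneg: "0 \<le> y \<Longrightarrow> y ^ s * y powr c = y powr (c + real s)" for y :: real
  by (cases "y = 0") (auto simp: powr_add powr_realpow)

text \<open>Orthogonality and norm come from one computation, without the Rodrigues formula. Powers
  of (1+x)/2 merge with the weight, so every summand of the explicit formula becomes a Beta
  integral. The Gamma factors reduce the sum to an n-th difference of a rising factorial of length
  \<open>m\<close>.\<close>

lemma jacobi_moment:
  fixes al be :: real
  assumes ab: "al > -1" "be > -1" and m: "m \<le> n"
  shows "integral\<^sup>L I11 (\<lambda>x. ((1 + x) / 2) ^ m * jacobiP al be n x * ((1 - x) powr al * (1 + x) powr be))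
    = (if m < n then 0 else 2 powr (al + be + 1) * Gamma (real n + al + 1) * Gamma (real n + be + 1) / Gamma (2 * real n + al + be + 2))"
proof -
  define c where "c s = ((real n + al) gchoose (n - s)) * ((real n + be) gchoose s)" for s
  have eq: "((1 + x) / 2) ^ m * jacobiP al be n x * ((1 - x) powr al * (1 + x) powr be)
     = (\<Sum>s\<le>n. (-1) ^ s * c s / 2 ^ (n + m) * ((1 - x) powr (al + real s) * (1 + x) powr (be + real (n - s + m))))"
    if "x \<in> {-1..1}" for x
  proof -
    have "((1 + x) / 2) ^ m * jacobiP al be n x * ((1 - x) powr al * (1 + x) powr be)
       = (\<Sum>s\<le>n. c s * ((x - 1) / 2) ^ s * ((x + 1) / 2) ^ (n - s) * ((1 + x) / 2) ^ m * ((1 - x) powr al * (1 + x) powr be))"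
      unfolding jacobiP_def c_def by (simp add: sum_distrib_left sum_distrib_right mult_ac)
    also have "\<dots> = (\<Sum>s\<le>n. (-1) ^ s * c s / 2 ^ (n + m) * ((1 - x) powr (al + real s) * (1 + x) powr (be + real (n - s + m))))"
    proof (intro sum.cong refl)
      fix s assume "s \<in> {..n}"
      have 1: "((x - 1) / 2) ^ s = (-1) ^ s * (1 - x) ^ s / 2 ^ s"
        by (simp add: power_divide flip: power_mult_distrib)
      have 2: "((x + 1) / 2) ^ (n - s) * ((1 + x) / 2) ^ m = (1 + x) ^ (n - s + m) / 2 ^ (n - s + m)"
        by (simp only: power_divide power_add add.commute[of x 1] times_divide_times_eq)
      have 3: "(2::real) ^ (n + m) = 2 ^ s * 2 ^ (n - s + m)" using \<open>s \<in> {..n}\<close> by (simp flip: power_add)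
      have "c s * ((x - 1) / 2) ^ s * ((x + 1) / 2) ^ (n - s) * ((1 + x) / 2) ^ m * ((1 - x) powr al * (1 + x) powr be)
        = (-1) ^ s * c s / 2 ^ (n + m) * (((1 - x) ^ s * (1 - x) powr al) * ((1 + x) ^ (n - s + m) * (1 + x) powr be))"
        unfolding 3 by (simp only: mult.assoc 1 2) simp
      also have "\<dots> = (-1) ^ s * c s / 2 ^ (n + m) * ((1 - x) powr (al + real s) * (1 + x) powr (be + real (n - s + m)))"
        using that by (simp add: power_mult_powr_nonneg)
      finally show "c s * ((x - 1) / 2) ^ s * ((x + 1) / 2) ^ (n - s) * ((1 + x) / 2) ^ m * ((1 - x) powr al * (1 + x) powr be)
        = (-1) ^ s * c s / 2 ^ (n + m) * ((1 - x) powr (al + real s) * (1 + x) powr (be + real (n - s + m)))" .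
    qed
    finally show ?thesis .
  qed
  \<comment> \<open>The Gamma factors that do not depend on the summation index
    \<open>s\<close>.\<close>
  define G where "G = 2 powr (al + be + 1) * Gamma (real n + al + 1) * Gamma (real n + be + 1) / Gamma (real n + real m + al + be + 2)"
  have "integral\<^sup>L I11 (\<lambda>x. ((1 + x) / 2) ^ m * jacobiP al be n x * ((1 - x) powr al * (1 + x) powr be))
     = integral\<^sup>L I11 (\<lambda>x. \<Sum>s\<le>n. (-1) ^ s * c s / 2 ^ (n + m) * ((1 - x) powr (al + real s) * (1 + x) powr (be + real (n - s + m))))"
    by (rule Bochner_Integration.integral_cong) (auto simp: eq)
  also have "\<dots> = (\<Sum>s\<le>n. (-1) ^ s * c s / 2 ^ (n + m) * (2 powr (al + real s + (be + real (n - s + m)) + 1)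
        * Beta (al + real s + 1) (be + real (n - s + m) + 1)))"
    using ab by (subst Bochner_Integration.integral_sum)
      (auto simp: jacobi_weight_integral intro!: integrable_mult_right jacobi_weight_integral(1))
  also have "\<dots> = (\<Sum>s\<le>n. G / fact n * ((-1) ^ s * real (n choose s) * pochhammer ((be + 1) + real (n - s)) m))"
  proof (intro sum.cong refl)
    fix s assume s: "s \<in> {..n}"
    then have rs: "real (n - s) = real n - real s" by (simp add: of_nat_diff)
    have bp: "be + 1 + real (n - s) > 0" using ab of_nat_0_le_iff[of "n - s"] by linarith
    have ap: "al + real s + 1 > 0" using ab by linarith
    have p2: "2 powr (al + real s + (be + real (n - s + m)) + 1) = 2 powr (al + be + 1) * 2 ^ (n + m)"
    proof -
      have "al + real s + (be + real (n - s + m)) + 1 = (al + be + 1) + real (n + m)" using rs by simp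
      then show ?thesis by (simp add: powr_add powr_realpow power_add)
    qed
    have c1: "(real n + al) gchoose (n - s) = Gamma (real n + al + 1) / (fact (n - s) * Gamma (al + real s + 1))"
    proof -
      have "real n + al - real (n - s) + 1 = al + real s + 1" by (simp add: rs)
      then show ?thesis using gbinomial_eq_Gamma[of "real n + al" "n - s"] ab by simp
    qed
    have c2: "(real n + be) gchoose s = Gamma (real n + be + 1) / (fact s * Gamma (be + 1 + real (n - s)))"
    proof -
      have "real n + be - real s + 1 = be + 1 + real (n - s)" by (simp add: rs)
      then show ?thesis using gbinomial_eq_Gamma[of "real n + be" s] bp by (simp only:)
    qed
    have po: "pochhammer (be + 1 + real (n - s)) m = Gamma (be + real (n - s + m) + 1) / Gamma (be + 1 + real (n - s))"
    proof -
      have "be + real (n - s + m) + 1 = be + 1 + real (n - s) + real m" by simp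
      then show ?thesis using pochhammer_eq_Gamma[OF bp] by (simp only:)
    qed
    have be: "Beta (al + real s + 1) (be + real (n - s + m) + 1)
       = Gamma (al + real s + 1) * Gamma (be + real (n - s + m) + 1) / Gamma (real n + real m + al + be + 2)"
    proof -
      have "al + real s + 1 + (be + real (n - s + m) + 1) = real n + real m + al + be + 2" by (simp add: rs)
      then show ?thesis unfolding Beta_def by (simp only:)
    qed
    have bi: "real (n choose s) = fact n / (fact s * fact (n - s))" using s by (simp add: binomial_fact)
    have pos: "Gamma (al + real s + 1) > 0" "Gamma (be + 1 + real (n - s)) > 0"
      using ap bp by (auto intro!: Gamma_real_pos)
    have "(-1) ^ s * c s / 2 ^ (n + m) * (2 powr (al + real s + (be + real (n - s + m)) + 1)
        * Beta (al + real s + 1) (be + real (n - s + m) + 1))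
      = (-1) ^ s * c s * 2 powr (al + be + 1) * Beta (al + real s + 1) (be + real (n - s + m) + 1)"
      unfolding p2 by simp
    also have "\<dots> = G / fact n * ((-1) ^ s * real (n choose s) * pochhammer ((be + 1) + real (n - s)) m)"
    proof -
      \<comment> \<open>\<open>u\<close> is Gamma(al+s+1), common to the first binomial and the Beta
        value, and cancels; \<open>v\<close> comes from the second binomial and becomes the
        denominator of the rising factorial.\<close>
      have alg: "(-1) ^ s * (g1 / (f1 * u) * (g2 / (f2 * v))) * w * (u * z / d)
          = w * g1 * g2 / d / fn * ((-1) ^ s * (fn / (f2 * f1)) * (z / v))"
        if "u \<noteq> 0" "fn \<noteq> 0" for g1 f1 u g2 f2 v w z d fn :: real
        using that by (simp add: mult_ac)
      show ?thesis
        unfolding c_def c1 c2 po be bi G_def by (rule alg) (use pos in auto)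
    qed
    finally show "(-1) ^ s * c s / 2 ^ (n + m) * (2 powr (al + real s + (be + real (n - s + m)) + 1)
        * Beta (al + real s + 1) (be + real (n - s + m) + 1))
      = G / fact n * ((-1) ^ s * real (n choose s) * pochhammer ((be + 1) + real (n - s)) m)" .
  qed
  also have "\<dots> = G / fact n * (if m < n then 0 else fact n)"
    unfolding sum_distrib_left[symmetric] forward_difference_pochhammer[OF m] ..
  also have "\<dots> = (if m < n then 0 else 2 powr (al + be + 1) * Gamma (real n + al + 1) * Gamma (real n + be + 1) / Gamma (2 * real n + al + be + 2))"
    using m by (auto simp: G_def)
  finally show ?thesis .
qed

section \<open>Degree, leading coefficient and orthogonality of the Jacobi polynomials\<close>

definition jacobi_poly :: "real \<Rightarrow> real \<Rightarrow> nat \<Rightarrow> real poly" where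
  "jacobi_poly al be n = (\<Sum>s\<le>n. Polynomial.smult (((real n + al) gchoose (n - s)) * ((real n + be) gchoose s))
     ([:- (1 / 2), 1 / 2:] ^ s * [:1/2, 1/2:] ^ (n - s)))"

lemma poly_jacobi_poly: "poly (jacobi_poly al be n) x = jacobiP al be n x"
proof -
  have "poly [:- (1/2), 1/2:] x = (x - 1) / 2" "poly [:1/2, 1/2:] x = (x + 1) / 2" by (auto simp: field_simps)
  then show ?thesis unfolding jacobi_poly_def jacobiP_def
    by (simp only: poly_sum poly_smult poly_mult poly_power mult.assoc)
qed

lemma jacobi_poly_summand:
  assumes "s \<le> n"
  shows "degree ([:- (1 / 2), 1 / 2:] ^ s * [:1/2, 1/2:] ^ (n - s) :: real poly) = n"
    and "coeff ([:- (1 / 2), 1 / 2:] ^ s * [:1/2, 1/2:] ^ (n - s) :: real poly) n = (1/2) ^ n"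
proof -
  let ?p = "[:- (1 / 2), 1 / 2:] ^ s * [:1/2, 1/2:] ^ (n - s) :: real poly"
  show d: "degree ?p = n" using assms by (simp add: degree_mult_eq degree_power_eq)
  have "lead_coeff ?p = (1/2) ^ n"
    using assms by (simp add: lead_coeff_mult lead_coeff_power flip: power_add)
  then show "coeff ?p n = (1/2) ^ n" by (simp only: d)
qed

lemma degree_jacobi_poly: "degree (jacobi_poly al be n) \<le> n"
  unfolding jacobi_poly_def
  by (intro degree_sum_le order.trans[OF degree_smult_le]) (auto simp: jacobi_poly_summand)

text \<open>Each summand has leading coefficient 2^(-n), so the coefficient is a Chu-Vandermonde
  convolution of the two binomials.\<close>

lemma coeff_jacobi_poly: "coeff (jacobi_poly al be n) n = (2 * real n + al + be gchoose n) / 2 ^ n"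
proof -
  have "coeff (jacobi_poly al be n) n = (\<Sum>s\<le>n. (real n + be gchoose s) * (real n + al gchoose (n - s)) * (1/2) ^ n)"
    unfolding jacobi_poly_def coeff_sum by (intro sum.cong refl) (simp add: jacobi_poly_summand)
  also have "\<dots> = (\<Sum>s=0..n. (real n + be gchoose s) * (real n + al gchoose (n - s))) * (1/2) ^ n"
    by (simp add: sum_distrib_right atLeast0AtMost)
  also have "\<dots> = (2 * real n + al + be gchoose n) / 2 ^ n"
    unfolding gbinomial_Vandermonde by (simp add: power_one_over algebra_simps)
  finally show ?thesis .
qed

context
  fixes al be :: real
  assumes ab: "al > -1" "be > -1"
begin

lemma integrable_poly_jacobi_weight:
  "integrable I11 (\<lambda>x. poly p x * ((1 - x) powr al * (1 + x) powr be))"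
proof -
  obtain B where B: "\<And>x. x \<in> {-1..1} \<Longrightarrow> \<bar>poly p x\<bar> \<le> B"
  proof -
    have "compact (poly p ` {-1..1})" by (intro compact_continuous_image continuous_intros) auto
    then have "bounded (poly p ` {-1..1})" by (rule compact_imp_bounded)
    then obtain B where "\<forall>x\<in>{-1..1}. \<bar>poly p x\<bar> \<le> B" by (auto simp: bounded_iff)
    then show ?thesis using that[of B] by blast
  qed
  have 1: "integrable I11 (\<lambda>x. B * ((1 - x) powr al * (1 + x) powr be))"
    by (intro integrable_mult_right jacobi_weight_integral ab)
  have 2: "AE x in I11. norm (poly p x * ((1 - x) powr al * (1 + x) powr be)) \<le> norm (B * ((1 - x) powr al * (1 + x) powr be))"
  proof (rule AE_I2)
    fix x assume "x \<in> space I11"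
    then have "\<bar>poly p x\<bar> \<le> \<bar>B\<bar>" using B[of x] by auto
    then show "norm (poly p x * ((1 - x) powr al * (1 + x) powr be)) \<le> norm (B * ((1 - x) powr al * (1 + x) powr be))"
      by (simp add: abs_mult mult_right_mono)
  qed
  have 3: "(\<lambda>x. poly p x * ((1 - x) powr al * (1 + x) powr be)) \<in> borel_measurable I11"
  proof -
    have "poly p \<in> borel_measurable borel" by (intro borel_measurable_continuous_onI continuous_intros)
    then show ?thesis by (intro borel_measurable_I11 borel_measurable_times) auto
  qed
  show ?thesis by (rule Bochner_Integration.integrable_bound[OF 1 3 2])
qed

lemma poly_shifted_expansion:
  fixes q :: "real poly"
  shows "poly q x = (\<Sum>m\<le>degree q. coeff (q \<circ>\<^sub>p [:-1, 2:]) m * ((1 + x) / 2) ^ m)"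
proof -
  have "poly q x = poly (q \<circ>\<^sub>p [:-1, 2:]) ((1 + x) / 2)" by (simp add: poly_pcompose field_simps)
  also have "\<dots> = (\<Sum>m\<le>degree q. coeff (q \<circ>\<^sub>p [:-1, 2:]) m * ((1 + x) / 2) ^ m)"
    by (subst poly_altdef) (simp add: degree_pcompose)
  finally show ?thesis .
qed

lemma integrable_shifted_power_jacobi:
  "integrable I11 (\<lambda>x. ((1 + x) / 2) ^ m * jacobiP al be n x * ((1 - x) powr al * (1 + x) powr be))"
proof -
  have "poly ([:1/2, 1/2:] ^ m * jacobi_poly al be n) x = ((1 + x) / 2) ^ m * jacobiP al be n x" for x
    by (simp add: poly_jacobi_poly field_simps)
  then show ?thesis
    using integrable_poly_jacobi_weight[of "[:1/2, 1/2:] ^ m * jacobi_poly al be n"] by (simp only:)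
qed

lemma jacobi_orthogonal:
  assumes "degree q < n"
  shows "integral\<^sup>L I11 (\<lambda>x. poly q x * jacobiP al be n x * ((1 - x) powr al * (1 + x) powr be)) = 0"
proof -
  have "integral\<^sup>L I11 (\<lambda>x. poly q x * jacobiP al be n x * ((1 - x) powr al * (1 + x) powr be))
    = integral\<^sup>L I11 (\<lambda>x. \<Sum>m\<le>degree q. coeff (q \<circ>\<^sub>p [:-1, 2:]) m *
        (((1 + x) / 2) ^ m * jacobiP al be n x * ((1 - x) powr al * (1 + x) powr be)))"
    by (subst poly_shifted_expansion) (simp add: sum_distrib_right mult.assoc)
  also have "\<dots> = (\<Sum>m\<le>degree q. coeff (q \<circ>\<^sub>p [:-1, 2:]) m *
       integral\<^sup>L I11 (\<lambda>x. ((1 + x) / 2) ^ m * jacobiP al be n x * ((1 - x) powr al * (1 + x) powr be)))"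
    by (subst Bochner_Integration.integral_sum)
       (auto intro!: integrable_mult_right integrable_shifted_power_jacobi)
  also have "\<dots> = 0" using assms by (intro sum.neutral) (auto simp: jacobi_moment[OF ab])
  finally show ?thesis .
qed

text \<open>The top term is written in the power of (1+x)/2 whose moment is known; this power has
  leading coefficient 2^(-n), which removes the denominator of
  \<open>coeff_jacobi_poly\<close>.\<close>

lemma jacobi_poly_split:
  obtains r where "degree r < n \<or> r = 0"
    "jacobi_poly al be n = Polynomial.smult (2 * real n + al + be gchoose n) ([:1/2, 1/2:] ^ n) + r"
proof -
  let ?k = "2 * real n + al + be gchoose n"
  define r where "r = jacobi_poly al be n - Polynomial.smult ?k ([:1/2, 1/2:] ^ n)"
  have d: "degree ([:1/2, 1/2:] ^ n :: real poly) = n" by (simp add: degree_power_eq)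
  have c: "coeff ([:1/2, 1/2:] ^ n :: real poly) n = (1/2) ^ n"
    using jacobi_poly_summand(2)[of 0 n] by simp
  have "degree r \<le> n" unfolding r_def
    by (intro degree_diff_le degree_jacobi_poly order.trans[OF degree_smult_le]) (simp add: d)
  moreover have "coeff r n = 0" unfolding r_def by (simp add: coeff_jacobi_poly c power_one_over)
  ultimately have "degree r < n \<or> r = 0"
    using le_neq_implies_less leading_coeff_0_iff by metis
  moreover have "jacobi_poly al be n = Polynomial.smult ?k ([:1/2, 1/2:] ^ n) + r" by (simp add: r_def)
  ultimately show ?thesis using that by blast
qed

text \<open>One of the two factors is split into its top power of (1+x)/2 and a rest of lower
  degree. Orthogonality removes the rest, and the moment with \<open>m = n\<close> remains.\<close>

lemma jacobi_norm:
  "integral\<^sup>L I11 (\<lambda>x. jacobiP al be n x * jacobiP al be n x * ((1 - x) powr al * (1 + x) powr be)) = jacobi_h al be n"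
proof -
  let ?W = "\<lambda>x::real. (1 - x) powr al * (1 + x) powr be" and ?k = "2 * real n + al + be gchoose n"
  obtain r where r: "degree r < n \<or> r = 0" "jacobi_poly al be n = Polynomial.smult ?k ([:1/2, 1/2:] ^ n) + r"
    by (rule jacobi_poly_split)
  have P: "jacobiP al be n x = ?k * ((1 + x) / 2) ^ n + poly r x" for x
    unfolding poly_jacobi_poly[symmetric] r(2) by (simp add: field_simps)
  have ir: "integrable I11 (\<lambda>x. poly r x * jacobiP al be n x * ?W x)"
    using integrable_poly_jacobi_weight[of "r * jacobi_poly al be n"] by (simp add: poly_jacobi_poly)
  have "integral\<^sup>L I11 (\<lambda>x. poly r x * jacobiP al be n x * ?W x) = 0"
    using r(1) jacobi_orthogonal[of r n] by auto
  moreover have "integral\<^sup>L I11 (\<lambda>x. jacobiP al be n x * jacobiP al be n x * ?W x)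
     = integral\<^sup>L I11 (\<lambda>x. ?k * (((1 + x) / 2) ^ n * jacobiP al be n x * ?W x) + poly r x * jacobiP al be n x * ?W x)"
    by (rule Bochner_Integration.integral_cong[OF refl]) (subst P, simp add: algebra_simps)
  ultimately have "integral\<^sup>L I11 (\<lambda>x. jacobiP al be n x * jacobiP al be n x * ?W x)
     = ?k * (2 powr (al + be + 1) * Gamma (real n + al + 1) * Gamma (real n + be + 1) / Gamma (2 * real n + al + be + 2))"
    using ir integrable_shifted_power_jacobi by (simp add: jacobi_moment[OF ab])
  also have "\<dots> = jacobi_h al be n"
  \<comment> \<open>For n = 0 the generic expression contains Gamma(al+be+1), which has a pole at
    al+be+1 = 0; \<open>jacobi_h\<close> therefore has a separate branch.\<close>
  proof (cases "n = 0")
    case True then show ?thesis by (simp add: jacobi_h_def)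
  next
    case False
    then have n: "real n \<ge> 1" by simp
    have "?k = Gamma (2 * real n + al + be + 1) / (fact n * Gamma (real n + al + be + 1))"
    proof -
      have "2 * real n + al + be - real n + 1 = real n + al + be + 1" by simp
      then show ?thesis using gbinomial_eq_Gamma[of "2 * real n + al + be" n] ab n by (simp only:)
    qed
    moreover have "Gamma (2 * real n + al + be + 2) = (2 * real n + al + be + 1) * Gamma (2 * real n + al + be + 1)"
    proof -
      have "2 * real n + al + be + 1 > 0" using n ab by simp
      then have "2 * real n + al + be + 1 \<notin> \<int>\<^sub>\<le>\<^sub>0" by (auto elim!: nonpos_Ints_cases)
      from Gamma_plus1[OF this] show ?thesis by (simp add: add.assoc)
    qed
    moreover have "Gamma (2 * real n + al + be + 1) > 0" using n ab by (intro Gamma_real_pos) simp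
    ultimately show ?thesis using False by (simp add: jacobi_h_def mult_ac)
  qed
  finally show ?thesis .
qed

lemma jacobi_h_pos: "jacobi_h al be n > 0"
proof (cases "n = 0")
  case True
  then show ?thesis using ab by (auto simp: jacobi_h_def intro!: divide_pos_pos mult_pos_pos Gamma_real_pos)
next
  case False
  then have "real n \<ge> 1" by simp
  then show ?thesis using False ab
    by (auto simp: jacobi_h_def intro!: divide_pos_pos mult_pos_pos Gamma_real_pos)
qed

lemma coeff_jacobi_poly_pos: "coeff (jacobi_poly al be n) n > 0"
proof (cases "n = 0")
  case True then show ?thesis by (simp add: coeff_jacobi_poly)
next
  case False
  then have n: "real n \<ge> 1" by simp
  have "2 * real n + al + be - real n + 1 > 0" using ab n by simp
  then have "(2 * real n + al + be gchoose n) > 0"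
    by (subst gbinomial_eq_Gamma) (use ab n in \<open>auto intro!: divide_pos_pos mult_pos_pos Gamma_real_pos\<close>)
  then show ?thesis by (simp add: coeff_jacobi_poly)
qed

end

section \<open>The operator with kernel sgn(x - y)/2\<close>

interpretation I11: sigma_finite_measure I11
  by (rule sigma_finite_I11)

interpretation I11: pair_sigma_finite I11 I11 ..

interpretation PI11: product_sigma_finite "\<lambda>_::nat. I11"
  by unfold_locales

lemma finite_measure_I11: "finite_measure I11"
  by (rule finite_measureI) (simp add: emeasure_restrict_space)

lemma abs_eps_kernel_le: "\<bar>eps_kernel x y\<bar> \<le> 1"
  by (auto simp: eps_kernel_def sgn_if)

lemma eps_kernel_skew: "eps_kernel y x = - eps_kernel x y"
  by (auto simp: eps_kernel_def sgn_if)

lemma borel_measurable_pair_I11: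
  assumes "h \<in> borel_measurable (borel \<Otimes>\<^sub>M borel)"
  shows "h \<in> borel_measurable (I11 \<Otimes>\<^sub>M I11)"
proof -
  have i: "(\<lambda>x. x) \<in> measurable I11 borel" by (rule borel_measurable_I11) auto
  have "(\<lambda>z. (fst z, snd z)) \<in> measurable (I11 \<Otimes>\<^sub>M I11) (borel \<Otimes>\<^sub>M borel)"
    by (intro measurable_Pair measurable_compose[OF measurable_fst i] measurable_compose[OF measurable_snd i])
  from measurable_compose[OF this assms] show ?thesis by simp
qed

lemma eps_kernel_measurable: "(\<lambda>(x,y). eps_kernel x y) \<in> borel_measurable (I11 \<Otimes>\<^sub>M I11)"
  by (rule borel_measurable_pair_I11) (unfold eps_kernel_def case_prod_unfold, measurable)

text \<open>The hypothesis of Fubini's theorem for all later exchanges of integrals; L^1 functions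
  and a bounded kernel are the only regularity available.\<close>

lemma integrable_tensor_kernel:
  fixes u v :: "real \<Rightarrow> real" and K :: "real \<Rightarrow> real \<Rightarrow> real"
  assumes u: "integrable I11 u" and v: "integrable I11 v"
    and K: "(\<lambda>(x,y). K x y) \<in> borel_measurable (I11 \<Otimes>\<^sub>M I11)" "\<And>x y. \<bar>K x y\<bar> \<le> 1"
  shows "integrable (I11 \<Otimes>\<^sub>M I11) (\<lambda>(x,y). u x * v y * K x y)"
proof -
  have um: "(\<lambda>z. u (fst z)) \<in> borel_measurable (I11 \<Otimes>\<^sub>M I11)" "(\<lambda>z. v (snd z)) \<in> borel_measurable (I11 \<Otimes>\<^sub>M I11)"
    using u v by (auto intro!: measurable_compose[OF measurable_fst] measurable_compose[OF measurable_snd])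
  have "integrable (I11 \<Otimes>\<^sub>M I11) (\<lambda>(x,y). u x * v y)"
  proof (rule I11.Fubini_integrable)
    show "(\<lambda>(x,y). u x * v y) \<in> borel_measurable (I11 \<Otimes>\<^sub>M I11)"
      using um by (simp add: case_prod_unfold borel_measurable_times)
    have "(\<lambda>x. \<integral>y. norm (case (x, y) of (x, y) \<Rightarrow> u x * v y) \<partial>I11) = (\<lambda>x. \<bar>u x\<bar> * (\<integral>y. \<bar>v y\<bar> \<partial>I11))"
      by (simp add: abs_mult)
    then show "integrable I11 (\<lambda>x. \<integral>y. norm (case (x, y) of (x, y) \<Rightarrow> u x * v y) \<partial>I11)"
      using u by (simp add: integrable_mult_left)
    show "AE x in I11. integrable I11 (\<lambda>y. case (x, y) of (x, y) \<Rightarrow> u x * v y)"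
      using v by simp
  qed
  then show ?thesis
  proof (rule Bochner_Integration.integrable_bound)
    show "(\<lambda>(x,y). u x * v y * K x y) \<in> borel_measurable (I11 \<Otimes>\<^sub>M I11)"
      using um K(1) by (simp add: case_prod_unfold borel_measurable_times)
    show "AE z in I11 \<Otimes>\<^sub>M I11. norm (case z of (x,y) \<Rightarrow> u x * v y * K x y) \<le> norm (case z of (x,y) \<Rightarrow> u x * v y)"
      using K(2) by (intro AE_I2) (auto simp: abs_mult intro!: mult_left_le)
  qed
qed

lemma eps_integrand_integrable:
  assumes "integrable I11 u"
  shows "integrable I11 (\<lambda>y. eps_kernel x y * u y)"
proof (rule Bochner_Integration.integrable_bound[OF assms])
  have "(\<lambda>y. eps_kernel x y) \<in> borel_measurable I11"
    by (rule borel_measurable_I11) (unfold eps_kernel_def, measurable)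
  then show "(\<lambda>y. eps_kernel x y * u y) \<in> borel_measurable I11" using assms by (intro borel_measurable_times) auto
  show "AE y in I11. norm (eps_kernel x y * u y) \<le> norm (u y)"
    using abs_eps_kernel_le by (auto simp: abs_mult intro!: mult_left_le_one_le)
qed

lemma eps_op_measurable:
  assumes "integrable I11 u"
  shows "eps_op u \<in> borel_measurable I11"
proof -
  have um: "(\<lambda>z. u (snd z)) \<in> borel_measurable (I11 \<Otimes>\<^sub>M I11)"
    using assms by (auto intro!: measurable_compose[OF measurable_snd])
  have "(\<lambda>(x,y). eps_kernel x y * u y) \<in> borel_measurable (I11 \<Otimes>\<^sub>M I11)"
    using eps_kernel_measurable um by (simp add: case_prod_unfold borel_measurable_times)
  from sigma_finite_measure.borel_measurable_lebesgue_integral[OF sigma_finite_I11 this]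
  show ?thesis by (simp add: eps_op_def[abs_def])
qed

text \<open>The operator maps L^1 into bounded functions, so that u times eps v is integrable for
  any two L^1 functions.\<close>

lemma abs_eps_op_le:
  assumes "integrable I11 u"
  shows "\<bar>eps_op u x\<bar> \<le> (\<integral>y. \<bar>u y\<bar> \<partial>I11)"
proof -
  have "\<bar>eps_op u x\<bar> \<le> (\<integral>y. \<bar>eps_kernel x y * u y\<bar> \<partial>I11)" unfolding eps_op_def
    by (rule integral_abs_bound)
  also have "\<dots> \<le> (\<integral>y. \<bar>u y\<bar> \<partial>I11)"
  proof (rule integral_mono)
    show "integrable I11 (\<lambda>y. \<bar>eps_kernel x y * u y\<bar>)"
      by (rule integrable_abs[OF eps_integrand_integrable[OF assms]])
    show "integrable I11 (\<lambda>y. \<bar>u y\<bar>)" by (rule integrable_abs[OF assms])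
    show "\<bar>eps_kernel x y * u y\<bar> \<le> \<bar>u y\<bar>" for y
      using abs_eps_kernel_le by (auto simp: abs_mult intro!: mult_left_le_one_le)
  qed
  finally show ?thesis .
qed

lemma integrable_mult_bounded:
  fixes u g :: "real \<Rightarrow> real"
  assumes "integrable I11 u" "g \<in> borel_measurable I11" "\<And>x. x \<in> {-1..1} \<Longrightarrow> \<bar>g x\<bar> \<le> B"
  shows "integrable I11 (\<lambda>x. u x * g x)"
proof -
  have 1: "integrable I11 (\<lambda>x. B * u x)" using assms by simp
  have 2: "(\<lambda>x. u x * g x) \<in> borel_measurable I11" using assms by (intro borel_measurable_times) auto
  have 3: "AE x in I11. norm (u x * g x) \<le> norm (B * u x)"
  proof (rule AE_I2)
    fix x assume "x \<in> space I11"
    then have "\<bar>g x\<bar> \<le> \<bar>B\<bar>" using assms(3)[of x] by auto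
    then show "norm (u x * g x) \<le> norm (B * u x)" by (simp add: abs_mult mult.commute mult_right_mono)
  qed
  show ?thesis by (rule Bochner_Integration.integrable_bound[OF 1 2 3])
qed

lemma integrable_mult_continuous:
  fixes u g :: "real \<Rightarrow> real"
  assumes "integrable I11 u" "continuous_on {-1..1} g"
  shows "integrable I11 (\<lambda>x. u x * g x)"
proof -
  have "bounded (g ` {-1..1})" using assms(2) by (intro compact_imp_bounded compact_continuous_image) auto
  then obtain B where B: "\<forall>x\<in>{-1..1}. \<bar>g x\<bar> \<le> B" by (auto simp: bounded_iff)
  have m: "g \<in> borel_measurable I11"
    using borel_measurable_continuous_on_restrict[OF assms(2)]
    by (simp add: measurable_cong_sets[OF sets_restrict_space_cong[OF sets_lborel] refl])
  show ?thesis by (rule integrable_mult_bounded[OF assms(1) m]) (use B in auto)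
qed

lemma integrable_mult_eps_op:
  assumes "integrable I11 u" "integrable I11 v"
  shows "integrable I11 (\<lambda>x. u x * eps_op v x)"
  by (rule integrable_mult_bounded[OF assms(1) eps_op_measurable[OF assms(2)] abs_eps_op_le[OF assms(2)]])

definition skew_form :: "(real \<Rightarrow> real) \<Rightarrow> (real \<Rightarrow> real) \<Rightarrow> real" where
  "skew_form u v = integral\<^sup>L I11 (\<lambda>x. u x * eps_op v x)"

lemma skew_form_Fubini:
  assumes u: "integrable I11 u" and v: "integrable I11 v"
  shows "skew_form u v = (\<integral>y. (\<integral>x. u x * v y * eps_kernel x y \<partial>I11) \<partial>I11)"
proof -
  have "skew_form u v = (\<integral>x. (\<integral>y. u x * v y * eps_kernel x y \<partial>I11) \<partial>I11)"
    unfolding skew_form_def eps_op_def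
    by (simp add: mult_ac flip: Bochner_Integration.integral_mult_right_zero)
  also have "\<dots> = (\<integral>y. (\<integral>x. u x * v y * eps_kernel x y \<partial>I11) \<partial>I11)"
    by (rule I11.Fubini_integral[symmetric])
       (rule integrable_tensor_kernel[OF u v eps_kernel_measurable abs_eps_kernel_le])
  finally show ?thesis .
qed

text \<open>The kernel is antisymmetric, so by Fubini the adjoint of eps is -eps.\<close>

lemma skew_form_eq_neg:
  assumes u: "integrable I11 u" and v: "integrable I11 v"
  shows "skew_form u v = - integral\<^sup>L I11 (\<lambda>x. eps_op u x * v x)"
proof -
  have "(\<integral>x. u x * v y * eps_kernel x y \<partial>I11) = - (eps_op u y * v y)" for y
  proof -
    have "(\<integral>x. u x * v y * eps_kernel x y \<partial>I11) = (\<integral>x. - v y * (eps_kernel y x * u x) \<partial>I11)"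
      by (simp add: eps_kernel_skew[of _ y] mult_ac)
    also have "\<dots> = - v y * eps_op u y" unfolding eps_op_def by (rule Bochner_Integration.integral_mult_right_zero)
    finally show ?thesis by simp
  qed
  then show ?thesis by (simp add: skew_form_Fubini[OF u v])
qed

lemma skew_form_skew:
  assumes "integrable I11 u" "integrable I11 v"
  shows "skew_form v u = - skew_form u v"
  using skew_form_eq_neg[OF assms] by (simp add: skew_form_def mult.commute)

lemma eps_op_sum:
  assumes "finite A" "\<And>k. k \<in> A \<Longrightarrow> integrable I11 (u k)"
  shows "eps_op (\<lambda>y. \<Sum>k\<in>A. c k * u k y) x = (\<Sum>k\<in>A. c k * eps_op (u k) x)"
proof -
  have "eps_op (\<lambda>y. \<Sum>k\<in>A. c k * u k y) x = integral\<^sup>L I11 (\<lambda>y. \<Sum>k\<in>A. c k * (eps_kernel x y * u k y))"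
    unfolding eps_op_def by (simp add: sum_distrib_left mult_ac)
  also have "\<dots> = (\<Sum>k\<in>A. c k * eps_op (u k) x)"
    unfolding eps_op_def
    by (subst Bochner_Integration.integral_sum) (auto intro!: integrable_mult_right eps_integrand_integrable assms)
  finally show ?thesis .
qed

lemma eps_op_add:
  assumes "integrable I11 u" "integrable I11 v"
  shows "eps_op (\<lambda>y. u y + c * v y) x = eps_op u x + c * eps_op v x"
  unfolding eps_op_def
  using eps_integrand_integrable[OF assms(1), of x] eps_integrand_integrable[OF assms(2), of x]
  by (simp add: distrib_left mult.left_commute[of _ c])

lemma skew_form_sum:
  assumes "finite A" "finite B" "\<And>k. k \<in> A \<Longrightarrow> integrable I11 (u k)" "\<And>k. k \<in> B \<Longrightarrow> integrable I11 (v k)"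
  shows "skew_form (\<lambda>x. \<Sum>k\<in>A. c k * u k x) (\<lambda>y. \<Sum>l\<in>B. d l * v l y) = (\<Sum>k\<in>A. \<Sum>l\<in>B. c k * skew_form (u k) (v l) * d l)"
proof -
  have "skew_form (\<lambda>x. \<Sum>k\<in>A. c k * u k x) (\<lambda>y. \<Sum>l\<in>B. d l * v l y)
      = integral\<^sup>L I11 (\<lambda>x. \<Sum>k\<in>A. \<Sum>l\<in>B. c k * d l * (u k x * eps_op (v l) x))"
    unfolding skew_form_def by (simp add: eps_op_sum[OF assms(2,4)] sum_product mult_ac)
  also have "\<dots> = (\<Sum>k\<in>A. \<Sum>l\<in>B. c k * d l * skew_form (u k) (v l))"
  proof -
    have i: "integrable I11 (\<lambda>x. c k * d l * (u k x * eps_op (v l) x))" if "k \<in> A" "l \<in> B" for k l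
      by (intro integrable_mult_right integrable_mult_eps_op assms that)
    have "integral\<^sup>L I11 (\<lambda>x. \<Sum>k\<in>A. \<Sum>l\<in>B. c k * d l * (u k x * eps_op (v l) x))
       = (\<Sum>k\<in>A. integral\<^sup>L I11 (\<lambda>x. \<Sum>l\<in>B. c k * d l * (u k x * eps_op (v l) x)))"
      by (rule Bochner_Integration.integral_sum) (rule Bochner_Integration.integrable_sum, rule i)
    also have "\<dots> = (\<Sum>k\<in>A. \<Sum>l\<in>B. integral\<^sup>L I11 (\<lambda>x. c k * d l * (u k x * eps_op (v l) x)))"
      by (intro sum.cong refl Bochner_Integration.integral_sum i)
    finally show ?thesis unfolding skew_form_def by simp
  qed
  finally show ?thesis by (simp add: mult_ac)
qed

text \<open>In general eps F' = F - (F(1) + F(-1))/2, by the fundamental theorem on both sides of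
  \<open>x\<close>. The finite exceptional set \<open>S\<close> admits functions with a kink, as
  they arise in the commutator.\<close>

lemma eps_op_derivative:
  fixes F F' :: "real \<Rightarrow> real"
  assumes S: "finite S" and cont: "continuous_on {-1..1} F" and bd: "F 1 + F (-1) = 0"
    and der: "\<And>z. z \<in> {-1<..<1} - S \<Longrightarrow> (F has_real_derivative F' z) (at z)"
    and int: "integrable I11 F'" and x: "x \<in> {-1..1}"
  shows "eps_op F' x = F x"
proof -
  have l: "(F' has_integral F x - F (-1)) {-1..x}"
    by (rule fundamental_theorem_of_calculus_interior_strong[OF S])
       (use x der cont in \<open>auto simp: has_real_derivative_iff_has_vector_derivative[symmetric] intro: continuous_on_subset\<close>)
  have r: "(F' has_integral F 1 - F x) {x..1}"
    by (rule fundamental_theorem_of_calculus_interior_strong[OF S])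
       (use x der cont in \<open>auto simp: has_real_derivative_iff_has_vector_derivative[symmetric] intro: continuous_on_subset\<close>)
  have l': "((\<lambda>y. eps_kernel x y * F' y) has_integral 1/2 * (F x - F (-1))) {-1..x}"
    by (rule has_integral_spike_finite[OF finite.insertI[OF finite.emptyI, of x] _ has_integral_mult_right[OF l, of "1/2"]])
       (auto simp: eps_kernel_def sgn_if)
  have r': "((\<lambda>y. eps_kernel x y * F' y) has_integral -1/2 * (F 1 - F x)) {x..1}"
    by (rule has_integral_spike_finite[OF finite.insertI[OF finite.emptyI, of x] _ has_integral_mult_right[OF r, of "-1/2"]])
       (auto simp: eps_kernel_def sgn_if)
  have "((\<lambda>y. eps_kernel x y * F' y) has_integral 1/2 * (F x - F (-1)) + -1/2 * (F 1 - F x)) {-1..1}"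
    by (rule has_integral_combine[OF _ _ l' r']) (use x in auto)
  moreover have "((\<lambda>y. eps_kernel x y * F' y) has_integral eps_op F' x) {-1..1}"
    unfolding eps_op_def by (rule integrable_I11_has_integral[OF eps_integrand_integrable[OF int]])
  ultimately have "eps_op F' x = 1/2 * (F x - F (-1)) + -1/2 * (F 1 - F x)"
    by (rule has_integral_unique[rotated])
  then show ?thesis using bd by (simp add: field_simps)
qed

text \<open>Since \<open>u\<close> is only in L^1, eps u is not differentiated; the identity is
  proved for kernels and then integrated against \<open>u\<close>. The kernel of eps f' eps at (x,
  y) is eps applied to z -> eps(z, y) f'(z), which away from z = y is the derivative of eps(z, y)
  (f(z) - f(y)). The factor f(z) - f(y) cancels the jump at z = y.\<close>

lemma eps_op_commutator:
  fixes f f' :: "real \<Rightarrow> real"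
  assumes der: "\<And>x. x \<in> {-1..1} \<Longrightarrow> (f has_real_derivative f' x) (at x within {-1..1})"
    and cont: "continuous_on {-1..1} f'" and f0: "f (-1) = 0" "f 1 = 0"
    and u: "integrable I11 u" and x: "x \<in> {-1..1}"
  shows "eps_op (\<lambda>z. f' z * eps_op u z) x = f x * eps_op u x - eps_op (\<lambda>z. f z * u z) x"
proof -
  interpret fm: finite_measure I11 by (rule finite_measure_I11)
  have contf: "continuous_on {-1..1} f"
    by (rule DERIV_continuous_on[OF der])
  have if': "integrable I11 f'"
    using integrable_mult_continuous[of "\<lambda>_. 1", OF _ cont] by simp
  have kern: "eps_op (\<lambda>z. eps_kernel z y * f' z) x = eps_kernel x y * (f x - f y)" if y: "y \<in> {-1..1}" for y
  proof (rule eps_op_derivative[of "{y}" "\<lambda>z. eps_kernel z y * (f z - f y)"])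
    show "continuous_on {-1..1} (\<lambda>z. eps_kernel z y * (f z - f y))"
    proof -
      have e1: "continuous_on {-1..y} (\<lambda>z. eps_kernel z y * (f z - f y))"
        by (rule continuous_on_eq[of _ "\<lambda>z. - ((f z - f y) / 2)"])
           (use y in \<open>auto simp: eps_kernel_def sgn_if diff_divide_distrib intro!: continuous_intros continuous_on_subset[OF contf]\<close>)
      have e2: "continuous_on {y..1} (\<lambda>z. eps_kernel z y * (f z - f y))"
        by (rule continuous_on_eq[of _ "\<lambda>z. (f z - f y) / 2"])
           (use y in \<open>auto simp: eps_kernel_def sgn_if intro!: continuous_intros continuous_on_subset[OF contf]\<close>)
      have "{-1..1} = {-1..y} \<union> {y..1}" using y by auto
      then show ?thesis using continuous_on_closed_Un[OF _ _ e1 e2] by simp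
    qed
    \<comment> \<open>For interior \<open>y\<close> the kernel values are 1/2 and -1/2 and f(1) =
      f(-1) = 0. For y = 1 or y = -1 one kernel value is 0 instead, but then f(y) = 0 as
      well.\<close>
    show "eps_kernel 1 y * (f 1 - f y) + eps_kernel (-1) y * (f (-1) - f y) = 0"
      using y f0 by (auto simp: eps_kernel_def sgn_if)
    show "((\<lambda>z. eps_kernel z y * (f z - f y)) has_real_derivative eps_kernel z y * f' z) (at z)"
      if z: "z \<in> {-1<..<1} - {y}" for z
    proof -
      have d: "(f has_real_derivative f' z) (at z)"
        using der[of z] z at_within_interior[of z "{-1..1}"] by (simp add: interior_atLeastAtMost_real)
      have "((\<lambda>w. eps_kernel z y * (f w - f y)) has_real_derivative eps_kernel z y * f' z) (at z)"
        by (rule DERIV_cmult) (use d in \<open>auto intro!: derivative_eq_intros\<close>)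
      moreover have "\<forall>\<^sub>F w in nhds z. eps_kernel w y * (f w - f y) = eps_kernel z y * (f w - f y)"
      proof (cases "z < y")
        case True
        then have "\<forall>\<^sub>F w in nhds z. w < y" by (rule order_tendstoD[OF filterlim_ident])
        then show ?thesis by eventually_elim (use True in \<open>auto simp: eps_kernel_def sgn_if\<close>)
      next
        case False
        then have zy: "y < z" using z by auto
        then have "\<forall>\<^sub>F w in nhds z. y < w" by (rule order_tendstoD[OF filterlim_ident])
        then show ?thesis by eventually_elim (use zy in \<open>auto simp: eps_kernel_def sgn_if\<close>)
      qed
      ultimately show ?thesis by (subst DERIV_cong_ev[OF refl _ refl])
    qed
    show "integrable I11 (\<lambda>z. eps_kernel z y * f' z)"
      using eps_integrand_integrable[OF if', of y] by (simp add: eps_kernel_skew[of _ y])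
  qed (use x in auto)
  let ?K = "\<lambda>z y. eps_kernel x z * eps_kernel z y"
  have Km: "(\<lambda>(z,y). ?K z y) \<in> borel_measurable (I11 \<Otimes>\<^sub>M I11)"
    by (rule borel_measurable_pair_I11) (unfold eps_kernel_def case_prod_unfold, measurable)
  have Kb: "\<bar>?K z y\<bar> \<le> 1" for z y
    using abs_eps_kernel_le[of x z] abs_eps_kernel_le[of z y] by (simp add: abs_mult mult_le_one)
  have "eps_op (\<lambda>z. f' z * eps_op u z) x = (\<integral>z. (\<integral>y. f' z * u y * ?K z y \<partial>I11) \<partial>I11)"
    unfolding eps_op_def by (simp add: mult_ac flip: Bochner_Integration.integral_mult_right_zero)
  also have "\<dots> = (\<integral>y. (\<integral>z. f' z * u y * ?K z y \<partial>I11) \<partial>I11)"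
    by (rule I11.Fubini_integral[symmetric]) (rule integrable_tensor_kernel[OF if' u Km Kb])
  also have "\<dots> = (\<integral>y. u y * eps_op (\<lambda>z. eps_kernel z y * f' z) x \<partial>I11)"
    unfolding eps_op_def by (simp add: mult_ac flip: Bochner_Integration.integral_mult_right_zero)
  also have "\<dots> = (\<integral>y. f x * (eps_kernel x y * u y) - eps_kernel x y * (f y * u y) \<partial>I11)"
  proof (rule Bochner_Integration.integral_cong[OF refl])
    fix y assume "y \<in> space I11"
    then show "u y * eps_op (\<lambda>z. eps_kernel z y * f' z) x = f x * (eps_kernel x y * u y) - eps_kernel x y * (f y * u y)"
      by (subst kern) (simp_all add: algebra_simps)
  qed
  also have "\<dots> = f x * eps_op u x - eps_op (\<lambda>z. f z * u z) x"
  proof -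
    have "integrable I11 (\<lambda>y. f y * u y)"
      using integrable_mult_continuous[OF u contf] by (simp add: mult.commute)
    then show ?thesis unfolding eps_op_def using eps_integrand_integrable[OF u, of x]
      by (subst Bochner_Integration.integral_diff) (auto intro: eps_integrand_integrable)
  qed
  finally show ?thesis .
qed

section \<open>The integral formula of de Bruijn\<close>

context
  fixes a b :: "nat \<Rightarrow> real \<Rightarrow> real" and p q :: "nat \<Rightarrow> nat"
  assumes a: "\<And>i. integrable I11 (a i)" and b: "\<And>i. integrable I11 (b i)"
begin

abbreviation pair_integrand :: "nat \<Rightarrow> (nat \<Rightarrow> real) \<Rightarrow> real" where
  "pair_integrand i x \<equiv> a i (x (p i)) * b i (x (q i)) * eps_kernel (x (p i)) (x (q i))"

lemma pair_integrand_measurable: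
  assumes "p i \<in> J" "q i \<in> J"
  shows "pair_integrand i \<in> borel_measurable (PiM J (\<lambda>_. I11))"
proof -
  have p: "(\<lambda>x. x (p i)) \<in> measurable (PiM J (\<lambda>_. I11)) I11" and q: "(\<lambda>x. x (q i)) \<in> measurable (PiM J (\<lambda>_. I11)) I11"
    using assms by (auto intro: measurable_component_singleton)
  have "(\<lambda>x. (x (p i), x (q i))) \<in> measurable (PiM J (\<lambda>_. I11)) (I11 \<Otimes>\<^sub>M I11)"
    by (rule measurable_Pair[OF p q])
  from measurable_compose[OF this eps_kernel_measurable]
  have "(\<lambda>x. eps_kernel (x (p i)) (x (q i))) \<in> borel_measurable (PiM J (\<lambda>_. I11))" by simp
  moreover have "(\<lambda>x. a i (x (p i))) \<in> borel_measurable (PiM J (\<lambda>_. I11))"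
    "(\<lambda>x. b i (x (q i))) \<in> borel_measurable (PiM J (\<lambda>_. I11))"
    using a b by (auto intro!: measurable_compose[OF p] measurable_compose[OF q])
  ultimately show ?thesis by (intro borel_measurable_times)
qed

text \<open>The i-th factor reads only the coordinates \<open>p i\<close> and \<open>q i\<close>,
  and all these are distinct. Dropping the bounded kernels leaves a product of functions of single
  coordinates as a majorant.\<close>

lemma prod_pair_integrand_integrable:
  assumes A: "finite A" and inj: "inj_on p A" "inj_on q A" and disj: "p ` A \<inter> q ` A = {}"
  shows "integrable (PiM (p ` A \<union> q ` A) (\<lambda>_. I11)) (\<lambda>x. \<Prod>i\<in>A. pair_integrand i x)"
proof -
  \<comment> \<open>The one-variable factor of coordinate \<open>k\<close>: an \<open>a\<close> or a
    \<open>b\<close>, whose index is recovered by inverting \<open>p\<close> or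
    \<open>q\<close>.\<close>
  define c where "c k = (if k \<in> p ` A then a (inv_into A p k) else b (inv_into A q k))" for k
  have "integrable (PiM (p ` A \<union> q ` A) (\<lambda>_. I11)) (\<lambda>x. \<Prod>k\<in>p ` A \<union> q ` A. c k (x k))"
    by (rule PI11.product_integrable_prod) (use A a b in \<open>auto simp: c_def\<close>)
  moreover have "(\<Prod>k\<in>p ` A \<union> q ` A. c k (x k)) = (\<Prod>i\<in>A. a i (x (p i)) * b i (x (q i)))" for x
  proof -
    have "(\<Prod>k\<in>p ` A \<union> q ` A. c k (x k)) = (\<Prod>k\<in>p ` A. c k (x k)) * (\<Prod>k\<in>q ` A. c k (x k))"
      by (rule prod.union_disjoint) (use A disj in auto)
    also have "(\<Prod>k\<in>p ` A. c k (x k)) = (\<Prod>i\<in>A. a i (x (p i)))"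
      using inj by (simp add: prod.reindex c_def)
    also have "(\<Prod>k\<in>q ` A. c k (x k)) = (\<Prod>i\<in>A. b i (x (q i)))"
    proof -
      have "q i \<notin> p ` A" if "i \<in> A" for i using disj that by auto
      then show ?thesis using inj by (simp add: prod.reindex c_def)
    qed
    finally show ?thesis by (simp add: prod.distrib)
  qed
  ultimately have "integrable (PiM (p ` A \<union> q ` A) (\<lambda>_. I11)) (\<lambda>x. \<Prod>i\<in>A. a i (x (p i)) * b i (x (q i)))"
    by simp
  then show ?thesis
  proof (rule Bochner_Integration.integrable_bound)
    show "(\<lambda>x. \<Prod>i\<in>A. pair_integrand i x) \<in> borel_measurable (PiM (p ` A \<union> q ` A) (\<lambda>_. I11))"
      by (rule borel_measurable_prod) (rule pair_integrand_measurable; auto)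
    show "AE x in PiM (p ` A \<union> q ` A) (\<lambda>_. I11).
        norm (\<Prod>i\<in>A. pair_integrand i x) \<le> norm (\<Prod>i\<in>A. a i (x (p i)) * b i (x (q i)))"
      unfolding prod_norm[symmetric]
      by (intro AE_I2 prod_mono) (auto simp: abs_mult intro!: mult_left_le abs_eps_kernel_le)
  qed
qed

lemma integral_pair_integrand:
  assumes pq: "p i \<noteq> q i"
  shows "integral\<^sup>L (PiM {p i, q i} (\<lambda>_. I11)) (pair_integrand i) = skew_form (a i) (b i)"
proof -
  have int: "integrable (PiM {p i, q i} (\<lambda>_. I11)) (pair_integrand i)"
    using prod_pair_integrand_integrable[of "{i}"] pq by (simp add: insert_commute)
  have "integral\<^sup>L (PiM {p i, q i} (\<lambda>_. I11)) (pair_integrand i)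
     = (\<integral>x. (\<integral>y. a i y * b i (x (q i)) * eps_kernel y (x (q i)) \<partial>I11) \<partial>PiM {q i} (\<lambda>_. I11))"
    using pq by (subst PI11.product_integral_insert[OF _ _ int]) auto
  also have "\<dots> = (\<integral>z. (\<integral>y. a i y * b i z * eps_kernel y z \<partial>I11) \<partial>I11)"
  proof (rule PI11.product_integral_singleton[where f = "\<lambda>z. \<integral>y. a i y * b i z * eps_kernel y z \<partial>I11"])
    have "(\<lambda>(y,z). a i y * b i z * eps_kernel y z) \<in> borel_measurable (I11 \<Otimes>\<^sub>M I11)"
      using integrable_tensor_kernel[OF a b eps_kernel_measurable abs_eps_kernel_le] by auto
    from measurable_compose[OF measurable_pair_swap' this]
    have "(\<lambda>(z,y). a i y * b i z * eps_kernel y z) \<in> borel_measurable (I11 \<Otimes>\<^sub>M I11)"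
      by (simp add: case_prod_unfold)
    from sigma_finite_measure.borel_measurable_lebesgue_integral[OF sigma_finite_I11 this]
    show "(\<lambda>z. \<integral>y. a i y * b i z * eps_kernel y z \<partial>I11) \<in> borel_measurable I11" by simp
  qed
  also have "\<dots> = skew_form (a i) (b i)" by (rule skew_form_Fubini[OF a b, symmetric])
  finally show ?thesis .
qed

text \<open>Disjoint pairs of coordinates are integrated out one after the other, each contributing
  one value of the skew form.\<close>

lemma integral_prod_pair_integrand:
  assumes "finite A" "inj_on p A" "inj_on q A" "p ` A \<inter> q ` A = {}"
  shows "integral\<^sup>L (PiM (p ` A \<union> q ` A) (\<lambda>_. I11)) (\<lambda>x. \<Prod>i\<in>A. pair_integrand i x) = (\<Prod>i\<in>A. skew_form (a i) (b i))"
  using assms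
proof (induction A rule: finite_induct)
  case empty
  show ?case using PI11.product_integral_prod[of "{}" "\<lambda>_ _. 1::real"] by simp
next
  case (insert i A)
  let ?I = "p ` A \<union> q ` A" and ?J = "{p i, q i}"
  have un: "p ` insert i A \<union> q ` insert i A = ?I \<union> ?J" by auto
  have disj: "?I \<inter> ?J = {}" using insert by (auto simp: inj_on_def)
  have pq: "p i \<noteq> q i" using insert by auto
  have int: "integrable (PiM (?I \<union> ?J) (\<lambda>_. I11)) (\<lambda>x. \<Prod>j\<in>insert i A. pair_integrand j x)"
    unfolding un[symmetric] by (rule prod_pair_integrand_integrable) (use insert in auto)
  have "integral\<^sup>L (PiM (?I \<union> ?J) (\<lambda>_. I11)) (\<lambda>x. \<Prod>j\<in>insert i A. pair_integrand j x)
     = (\<integral>x. (\<integral>y. (\<Prod>j\<in>insert i A. pair_integrand j (merge ?I ?J (x, y))) \<partial>PiM ?J (\<lambda>_. I11)) \<partial>PiM ?I (\<lambda>_. I11))"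
    by (rule PI11.product_integral_fold[OF disj _ _ int]) (use insert in auto)
  also have "\<dots> = (\<integral>x. (\<integral>y. (\<Prod>j\<in>A. pair_integrand j x) * pair_integrand i y \<partial>PiM ?J (\<lambda>_. I11)) \<partial>PiM ?I (\<lambda>_. I11))"
  proof -
    have m1: "merge ?I ?J (x, y) (p j) = x (p j)" "merge ?I ?J (x, y) (q j) = x (q j)" if "j \<in> A" for x y :: "nat \<Rightarrow> real" and j
      using that by (auto simp: merge_def)
    have m2: "merge ?I ?J (x, y) (p i) = y (p i)" "merge ?I ?J (x, y) (q i) = y (q i)" for x y :: "nat \<Rightarrow> real"
      using disj by (auto simp: merge_def)
    have "(\<Prod>j\<in>insert i A. pair_integrand j (merge ?I ?J (x, y))) = (\<Prod>j\<in>A. pair_integrand j x) * pair_integrand i y" for x y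
      using insert.hyps m1 m2 by (simp add: mult.commute cong: prod.cong)
    then show ?thesis by simp
  qed
  also have "\<dots> = skew_form (a i) (b i) * (\<Prod>j\<in>A. skew_form (a j) (b j))"
    using insert by (simp add: integral_pair_integrand[OF pq])
  finally show ?case unfolding un using insert.hyps by simp
qed

end

section \<open>The absolute value of the Vandermonde product\<close>

lemma strict_mono_rearrangement:
  fixes x :: "nat \<Rightarrow> real"
  assumes "inj_on x {..<n}"
  obtains p where "p permutes {..<n}" "\<And>i j. i < j \<Longrightarrow> j < n \<Longrightarrow> x (p i) < x (p j)"
proof -
  define l where "l = sorted_list_of_set (x ` {..<n})"
  define h where "h i = l ! i" for i
  have l: "length l = n" "set l = x ` {..<n}" "sorted_wrt (<) l"
    using assms by (simp_all add: l_def card_image)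
  have h_mem: "h i \<in> x ` {..<n}" if "i < n" for i
    using nth_mem[of i l] that unfolding l(1) l(2) h_def by blast
  have h_less: "h i < h j" if "i < j" "j < n" for i j
    using sorted_wrt_nth_less[OF l(3), of i j] that l(1) by (simp add: h_def)
  define r where "r i = inv_into {..<n} x (h i)" for i
  have hr: "x (r i) = h i" and rn: "r i < n" if "i < n" for i
  proof -
    from h_mem[OF that] show "x (r i) = h i" "r i < n" unfolding r_def
      using f_inv_into_f[of "h i" x "{..<n}"] inv_into_into[of "h i" x "{..<n}"] by auto
  qed
  have inj: "inj_on r {..<n}"
  proof (rule inj_onI)
    fix i j assume ij: "i \<in> {..<n}" "j \<in> {..<n}" "r i = r j"
    then have "h i = h j" using hr[of i] hr[of j] by simp
    then show "i = j" using h_less[of i j] h_less[of j i] ij by (cases i j rule: linorder_cases) auto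
  qed
  have fs: "r \<in> {..<n} \<rightarrow> {..<n}" using rn by auto
  show ?thesis
  proof (rule that)
    show "(\<lambda>i. if i < n then r i else i) permutes {..<n}" by (rule permutes_extend[OF fs inj])
    fix i j assume ij: "i < j" "j < n"
    then have "h i < h j" by (rule h_less)
    then show "x (if i < n then r i else i) < x (if j < n then r j else j)" using ij hr by simp
  qed
qed

lemma vandermonde_permute:
  fixes x :: "nat \<Rightarrow> real"
  assumes p: "p permutes {..<n}"
  shows "(\<Prod>k<n. \<Prod>j<k. x (p k) - x (p j)) = of_int (sign p) * (\<Prod>k<n. \<Prod>j<k. x k - x j)"
proof -
  have "leibniz_det n (\<lambda>i j. x (p i) ^ j) = leibniz_det n (\<lambda>i j. x (p j) ^ i)"
    by (rule leibniz_det_transpose[symmetric])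
  also have "\<dots> = of_int (sign p) * leibniz_det n (\<lambda>i j. x j ^ i)"
    by (rule leibniz_det_permute_columns[OF p, of "\<lambda>i j. x j ^ i"])
  also have "leibniz_det n (\<lambda>i j. x j ^ i) = leibniz_det n (\<lambda>i j. x i ^ j)"
    by (rule leibniz_det_transpose)
  finally show ?thesis unfolding leibniz_det_vandermonde .
qed

text \<open>The Pfaffian of the sign matrix detects the sign of the Vandermonde product. Sorting the
  points multiplies both by the same sign; for sorted points the sign matrix is that of 0, 1, 2,
  ..., whose Pfaffian sum is kept as an unevaluated constant. If two points coincide, the
  Vandermonde products vanish.\<close>

lemma vandermonde_times_pfaffian_eps:
  "(\<Prod>k<2*m. \<Prod>j<k. x k - x j) * pfaffian_sum m (\<lambda>i j. eps_kernel (x i) (x j))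
     = pfaffian_sum m (\<lambda>i j. eps_kernel (real i) (real j)) * (\<Prod>k<2*m. \<Prod>j<k. \<bar>x j - x k\<bar>)"
proof (cases "inj_on x {..<2*m}")
  case False
  then obtain i j where ij: "i < j" "j < 2*m" "x i = x j"
    unfolding inj_on_def by (metis lessThan_iff linorder_neqE_nat)
  have "(\<Prod>l<j. x j - x l) = 0" "(\<Prod>l<j. \<bar>x l - x j\<bar>) = 0"
    using ij by (auto intro!: prod_zero bexI[of _ i])
  then have "(\<Prod>k<2*m. \<Prod>l<k. x k - x l) = 0" "(\<Prod>k<2*m. \<Prod>l<k. \<bar>x l - x k\<bar>) = 0"
    using ij(2) by (auto intro!: prod_zero)
  then show ?thesis by (simp only: mult_zero_left mult_zero_right)
next
  case True
  then obtain p where p: "p permutes {..<2*m}" and mono: "\<And>i j. i < j \<Longrightarrow> j < 2*m \<Longrightarrow> x (p i) < x (p j)"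
    by (rule strict_mono_rearrangement) blast
  let ?s = "real_of_int (sign p)" and ?D = "\<Prod>k<2*m. \<Prod>j<k. x k - x j"
  have ss: "?s * ?s = 1" "\<bar>?s\<bar> = 1" by (simp_all flip: of_int_mult of_int_abs)
  have pos: "?s * ?D \<ge> 0" unfolding vandermonde_permute[OF p, symmetric]
    using mono by (intro prod_nonneg ballI) (auto intro: less_imp_le)
  have "(\<Prod>k<2*m. \<Prod>j<k. \<bar>x j - x k\<bar>) = \<bar>?D\<bar>"
    by (simp add: abs_prod abs_minus_commute)
  also have "\<dots> = \<bar>?s * ?D\<bar>" by (simp add: abs_mult ss)
  also have "\<dots> = ?s * ?D" using pos by simp
  finally have abs: "(\<Prod>k<2*m. \<Prod>j<k. \<bar>x j - x k\<bar>) = ?s * ?D" .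
  have "pfaffian_sum m (\<lambda>i j. eps_kernel (real i) (real j)) = pfaffian_sum m (\<lambda>i j. eps_kernel (x (p i)) (x (p j)))"
  proof (rule pfaffian_sum_cong)
    fix i j assume "i < 2*m" "j < 2*m"
    then show "eps_kernel (real i) (real j) = eps_kernel (x (p i)) (x (p j))"
      using mono[of i j] mono[of j i] by (cases i j rule: linorder_cases) (auto simp: eps_kernel_def sgn_if)
  qed
  also have "\<dots> = ?s * pfaffian_sum m (\<lambda>i j. eps_kernel (x i) (x j))"
    by (rule pfaffian_sum_permute[OF p, of "\<lambda>i j. eps_kernel (x i) (x j)"])
  finally show ?thesis unfolding abs using ss(1) by (simp add: algebra_simps)
qed

text \<open>Absolute values are traded for Vandermonde determinant times Pfaffian, and both are
  expanded into sums over permutations \<open>s\<close> and \<open>t\<close>. Each \<open>t\<close>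
  groups the variables into pairs and contributes the same Pfaffian sum of skew forms, whence the
  factorial.\<close>

theorem de_Bruijn_integral:
  fixes g :: "real \<Rightarrow> real"
  assumes g: "\<And>j. integrable I11 (\<lambda>x. x ^ j * g x)"
  shows "pfaffian_sum m (\<lambda>i j. eps_kernel (real i) (real j)) *
      integral\<^sup>L (PiM {..<2*m} (\<lambda>_. I11)) (\<lambda>x. (\<Prod>k<2*m. \<Prod>j<k. \<bar>x j - x k\<bar>) * (\<Prod>j<2*m. g (x j)))
    = fact (2*m) * pfaffian_sum m (\<lambda>j k. skew_form (\<lambda>x. x ^ j * g x) (\<lambda>x. x ^ k * g x))"
proof -
  let ?n = "2*m" and ?\<psi> = "\<lambda>j x. x ^ j * g x"
  let ?M = "\<lambda>j k. skew_form (?\<psi> j) (?\<psi> k)" and ?PM = "PiM {..<2*m} (\<lambda>_. I11)"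
  \<comment> \<open>Here \<open>t\<close> pairs the variables and \<open>s\<close> distributes the
    powers among them; the factors are arranged by pairs so that the integral splits.\<close>
  define T where "T t s x = (\<Prod>i<m. ?\<psi> (s (t (2*i))) (x (t (2*i))) * ?\<psi> (s (t (2*i+1))) (x (t (2*i+1)))
      * eps_kernel (x (t (2*i))) (x (t (2*i+1))))" for t s :: "nat \<Rightarrow> nat" and x :: "nat \<Rightarrow> real"
  have T: "integrable ?PM (T t s)" "integral\<^sup>L ?PM (T t s) = (\<Prod>i<m. ?M (s (t (2*i))) (s (t (2*i+1))))"
    if t: "t permutes {..<?n}" for t s
  proof -
    have inj: "inj t" by (rule permutes_inj[OF t])
    let ?p = "\<lambda>i. t (2*i)" and ?q = "\<lambda>i. t (2*i+1)"
    have ip: "inj_on ?p {..<m}" "inj_on ?q {..<m}" using inj by (auto intro!: inj_onI dest!: injD)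
    have d: "?p ` {..<m} \<inter> ?q ` {..<m} = {}"
    proof -
      have "2 * i \<noteq> 2 * j + 1" for i j :: nat by presburger
      then have "t (2 * i) \<noteq> t (2 * j + 1)" for i j using inj unfolding inj_def by blast
      then show ?thesis by blast
    qed
    have "(\<lambda>i. 2*i) ` {..<m} \<union> (\<lambda>i. 2*i+1) ` {..<m} = {..<?n}"
    proof (intro equalityI subsetI)
      fix k assume k: "k \<in> {..<?n}"
      show "k \<in> (\<lambda>i. 2*i) ` {..<m} \<union> (\<lambda>i. 2*i+1) ` {..<m}"
      proof (cases "even k")
        case True then obtain i where "k = 2*i" by (elim evenE)
        then show ?thesis using k by auto
      next
        case False then obtain i where "k = 2*i+1" by (elim oddE)
        then show ?thesis using k by auto
      qed
    qed auto
    then have "t ` ((\<lambda>i. 2*i) ` {..<m} \<union> (\<lambda>i. 2*i+1) ` {..<m}) = {..<?n}"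
      using permutes_image[OF t] by simp
    then have un: "?p ` {..<m} \<union> ?q ` {..<m} = {..<?n}" by (simp add: image_Un image_image)
    show "integrable ?PM (T t s)"
      using prod_pair_integrand_integrable[of "\<lambda>i. ?\<psi> (s (?p i))" "\<lambda>i. ?\<psi> (s (?q i))" "{..<m}" ?p ?q, OF g g _ ip d]
      unfolding un T_def by simp
    show "integral\<^sup>L ?PM (T t s) = (\<Prod>i<m. ?M (s (?p i)) (s (?q i)))"
      using integral_prod_pair_integrand[of "\<lambda>i. ?\<psi> (s (?p i))" "\<lambda>i. ?\<psi> (s (?q i))" "{..<m}" ?p ?q, OF g g _ ip d]
      unfolding un T_def by simp
  qed
  have expand: "pfaffian_sum m (\<lambda>i j. eps_kernel (real i) (real j)) *
      ((\<Prod>k<?n. \<Prod>j<k. \<bar>x j - x k\<bar>) * (\<Prod>j<?n. g (x j)))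
    = (\<Sum>t | t permutes {..<?n}. \<Sum>s | s permutes {..<?n}. of_int (sign t) * of_int (sign s) * T t s x)" for x
  proof -
    have "pfaffian_sum m (\<lambda>i j. eps_kernel (real i) (real j)) *
      ((\<Prod>k<?n. \<Prod>j<k. \<bar>x j - x k\<bar>) * (\<Prod>j<?n. g (x j)))
      = pfaffian_sum m (\<lambda>i j. eps_kernel (x i) (x j)) * ((\<Prod>k<?n. \<Prod>j<k. x k - x j) * (\<Prod>j<?n. g (x j)))"
      unfolding mult.assoc[symmetric] vandermonde_times_pfaffian_eps[symmetric] by (simp only: mult_ac)
    also have "(\<Prod>k<?n. \<Prod>j<k. x k - x j) * (\<Prod>j<?n. g (x j))
      = (\<Sum>s | s permutes {..<?n}. of_int (sign s) * (\<Prod>k<?n. ?\<psi> (s k) (x k)))"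
      unfolding leibniz_det_vandermonde[symmetric] leibniz_det_def
      by (simp add: sum_distrib_right prod.distrib mult.assoc)
    also have "pfaffian_sum m (\<lambda>i j. eps_kernel (x i) (x j)) * \<dots>
      = (\<Sum>t | t permutes {..<?n}. \<Sum>s | s permutes {..<?n}.
          (of_int (sign t) * (\<Prod>i<m. eps_kernel (x (t (2*i))) (x (t (2*i+1))))) * (of_int (sign s) * (\<Prod>k<?n. ?\<psi> (s k) (x k))))"
      unfolding pfaffian_sum_def by (rule sum_product)
    also have "\<dots> = (\<Sum>t | t permutes {..<?n}. \<Sum>s | s permutes {..<?n}. of_int (sign t) * of_int (sign s) * T t s x)"
    proof (intro sum.cong refl)
      fix t s assume "t \<in> {t. t permutes {..<?n}}"
      then have t: "t permutes {..<?n}" by simp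
      have "(\<Prod>k<?n. ?\<psi> (s k) (x k)) = (\<Prod>k<?n. ?\<psi> (s (t k)) (x (t k)))"
        using prod.permute[OF t, of "\<lambda>k. ?\<psi> (s k) (x k)"] by (simp add: o_def)
      also have "\<dots> = (\<Prod>i<m. ?\<psi> (s (t (2*i))) (x (t (2*i))) * ?\<psi> (s (t (2*i+1))) (x (t (2*i+1))))"
        by (rule prod_pairs)
      finally have e: "(\<Prod>k<?n. ?\<psi> (s k) (x k)) = \<dots>" .
      show "(of_int (sign t) * (\<Prod>i<m. eps_kernel (x (t (2*i))) (x (t (2*i+1))))) * (of_int (sign s) * (\<Prod>k<?n. ?\<psi> (s k) (x k)))
        = of_int (sign t) * of_int (sign s) * T t s x"
        unfolding e T_def by (simp only: prod.distrib mult_ac)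
    qed
    finally show ?thesis .
  qed
  have "pfaffian_sum m (\<lambda>i j. eps_kernel (real i) (real j)) *
      integral\<^sup>L ?PM (\<lambda>x. (\<Prod>k<?n. \<Prod>j<k. \<bar>x j - x k\<bar>) * (\<Prod>j<?n. g (x j)))
    = integral\<^sup>L ?PM (\<lambda>x. \<Sum>t | t permutes {..<?n}. \<Sum>s | s permutes {..<?n}. of_int (sign t) * of_int (sign s) * T t s x)"
    unfolding expand[symmetric] by (rule Bochner_Integration.integral_mult_right_zero[symmetric])
  also have "\<dots> = (\<Sum>t | t permutes {..<?n}. \<Sum>s | s permutes {..<?n}.
      of_int (sign t) * of_int (sign s) * (\<Prod>i<m. ?M (s (t (2*i))) (s (t (2*i+1)))))"
  proof -
    have "integral\<^sup>L ?PM (\<lambda>x. \<Sum>t | t permutes {..<?n}. \<Sum>s | s permutes {..<?n}. of_int (sign t) * of_int (sign s) * T t s x)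
      = (\<Sum>t | t permutes {..<?n}. integral\<^sup>L ?PM (\<lambda>x. \<Sum>s | s permutes {..<?n}. of_int (sign t) * of_int (sign s) * T t s x))"
      by (rule Bochner_Integration.integral_sum) (auto intro!: Bochner_Integration.integrable_sum integrable_mult_right T)
    also have "\<dots> = (\<Sum>t | t permutes {..<?n}. \<Sum>s | s permutes {..<?n}. integral\<^sup>L ?PM (\<lambda>x. of_int (sign t) * of_int (sign s) * T t s x))"
      by (intro sum.cong refl Bochner_Integration.integral_sum) (auto intro!: integrable_mult_right T)
    also have "\<dots> = (\<Sum>t | t permutes {..<?n}. \<Sum>s | s permutes {..<?n}.
      of_int (sign t) * of_int (sign s) * (\<Prod>i<m. ?M (s (t (2*i))) (s (t (2*i+1)))))"
      by (intro sum.cong refl) (simp add: T(2))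
    finally show ?thesis .
  qed
  also have "\<dots> = (\<Sum>t | t permutes {..<?n}. pfaffian_sum m ?M)"
  proof (rule sum.cong[OF refl])
    fix t assume "t \<in> {t. t permutes {..<?n}}"
    then have t: "t permutes {..<?n}" by simp
    \<comment> \<open>Replacing \<open>s\<close> by s o t absorbs \<open>t\<close> together with its
      sign, so the inner sum does not depend on \<open>t\<close>.\<close>
    have "pfaffian_sum m ?M = (\<Sum>s | s permutes {..<?n}. of_int (sign (s \<circ> t)) * (\<Prod>i<m. ?M ((s \<circ> t) (2*i)) ((s \<circ> t) (2*i+1))))"
      unfolding pfaffian_sum_def by (rule sum_permutations_compose_right[OF t])
    also have "\<dots> = (\<Sum>s | s permutes {..<?n}. of_int (sign t) * of_int (sign s) * (\<Prod>i<m. ?M (s (t (2*i))) (s (t (2*i+1)))))"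
    proof (rule sum.cong[OF refl])
      fix s assume "s \<in> {s. s permutes {..<?n}}"
      then have s: "s permutes {..<?n}" by simp
      have "sign (s \<circ> t) = sign t * sign s"
        using sign_compose[OF permutes_imp_permutation[OF finite_lessThan s] permutes_imp_permutation[OF finite_lessThan t]]
        by (simp only: mult.commute)
      then show "of_int (sign (s \<circ> t)) * (\<Prod>i<m. ?M ((s \<circ> t) (2*i)) ((s \<circ> t) (2*i+1)))
        = of_int (sign t) * of_int (sign s) * (\<Prod>i<m. ?M (s (t (2*i))) (s (t (2*i+1))))" by (simp only: of_int_mult o_apply)
    qed
    finally show "(\<Sum>s | s permutes {..<?n}. of_int (sign t) * of_int (sign s) * (\<Prod>i<m. ?M (s (t (2*i))) (s (t (2*i+1))))) = pfaffian_sum m ?M"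
      by simp
  qed
  also have "\<dots> = fact ?n * pfaffian_sum m ?M"
    by (simp add: card_permutations)
  finally show ?thesis .
qed

text \<open>In the quotient the factorial and the Pfaffian sum of the sign matrix cancel, and
  \<open>pfaffian_sum_square\<close> turns squared Pfaffian sums into determinants with constants
  that cancel too.\<close>

theorem de_Bruijn_square_ratio:
  fixes g0 g :: "real \<Rightarrow> real" and m :: nat
  defines "M \<equiv> \<lambda>h j k. skew_form (\<lambda>x. x ^ j * h x) (\<lambda>x. x ^ k * h x)"
    and "Z \<equiv> \<lambda>h. integral\<^sup>L (PiM {..<2*m} (\<lambda>_. I11)) (\<lambda>x. (\<Prod>k<2*m. \<Prod>j<k. \<bar>x j - x k\<bar>) * (\<Prod>j<2*m. h (x j)))"
  assumes g0: "\<And>j. integrable I11 (\<lambda>x. x ^ j * g0 x)" and g: "\<And>j. integrable I11 (\<lambda>x. x ^ j * g x)"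
    and nz: "leibniz_det (2*m) (M g0) \<noteq> 0"
  shows "(Z g / Z g0)\<^sup>2 = leibniz_det (2*m) (M g) / leibniz_det (2*m) (M g0)"
proof -
  let ?c = "pfaffian_sum m (\<lambda>i j. eps_kernel (real i) (real j))"
  have Z: "?c * Z h = fact (2*m) * pfaffian_sum m (M h)" if "\<And>j. integrable I11 (\<lambda>x. x ^ j * h x)" for h
    unfolding Z_def M_def by (rule de_Bruijn_integral[OF that])
  have skew: "skew_upto (2*m) (M h)" if "\<And>j. integrable I11 (\<lambda>x. x ^ j * h x)" for h
    unfolding skew_upto_def M_def by (auto intro: skew_form_skew that)
  let ?J = "leibniz_det (2*m) pair_matrix" and ?P = "pfaffian_sum m pair_matrix"
  note s0 = pfaffian_sum_square[OF skew[OF g0]] and s = pfaffian_sum_square[OF skew[OF g]]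
  have "?P \<noteq> 0" using pfaffian_sum_pair_matrix_pos[of m] by simp
  then have nz': "?J \<noteq> 0" "pfaffian_sum m (M g0) \<noteq> 0" using s0 nz by auto
  \<comment> \<open>A nonzero right side in de Bruijn's formula for \<open>g0\<close> forces both
    factors on its left to be nonzero.\<close>
  then have "?c \<noteq> 0" "Z g0 \<noteq> 0" using Z[OF g0] by auto
  have "Z g / Z g0 = (?c * Z g) / (?c * Z g0)" using \<open>?c \<noteq> 0\<close> by simp
  also have "\<dots> = pfaffian_sum m (M g) / pfaffian_sum m (M g0)" unfolding Z[OF g] Z[OF g0] by simp
  finally have "(Z g / Z g0)\<^sup>2 = (pfaffian_sum m (M g))\<^sup>2 / (pfaffian_sum m (M g0))\<^sup>2" by (simp add: power_divide)
  also have "\<dots> = ((pfaffian_sum m (M g))\<^sup>2 * ?J) / ((pfaffian_sum m (M g0))\<^sup>2 * ?J)" using nz' by simp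
  also have "\<dots> = leibniz_det (2*m) (M g) / leibniz_det (2*m) (M g0)"
    unfolding s s0 using \<open>?P \<noteq> 0\<close> by simp
  finally show ?thesis .
qed

section \<open>Fredholm determinants of finite rank kernels\<close>

text \<open>The principal minor of \<open>G\<close> with index set \<open>A\<close>, defined through
  permutations of \<open>A\<close> so that no enumeration of \<open>A\<close> has to be
  chosen.\<close>

definition det_on :: "nat set \<Rightarrow> (nat \<Rightarrow> nat \<Rightarrow> real) \<Rightarrow> real" where
  "det_on A G = (\<Sum>p | p permutes A. of_int (sign p) * (\<Prod>i\<in>A. G i (p i)))"

text \<open>Transport along \<open>t\<close> preserves signs, so every enumeration of an index set
  gives the same principal minor.\<close>

lemma leibniz_det_reindex_inj:
  assumes inj: "inj_on t {..<n}"
  shows "leibniz_det n (\<lambda>i j. G (t i) (t j)) = det_on (t ` {..<n}) G"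
  unfolding leibniz_det_def det_on_def
proof (rule sum.reindex_bij_witness[where i = "map_permutation (t ` {..<n}) (inv_into {..<n} t)"
      and j = "map_permutation {..<n} t"], goal_cases)
  case (1 p)
  then show ?case using inj by (intro map_permutation_compose_inv[of t "{..<n}" "t ` {..<n}"]) (auto simp: bij_betw_def)
next
  case (2 p)
  then show ?case using inj by (auto intro: map_permutation_permutes simp: bij_betw_def)
next
  case (3 p)
  then show ?case using inj
    by (intro map_permutation_compose_inv[of "inv_into {..<n} t" "t ` {..<n}" "{..<n}"])
       (auto intro: bij_betw_inv_into simp: inj_on_imp_bij_betw f_inv_into_f)
next
  case (4 p)
  then show ?case using inj by (auto intro!: map_permutation_permutes bij_betw_inv_into simp: bij_betw_def)
next
  case (5 p)
  then have p: "p permutes {..<n}" by simp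
  have "(\<Prod>i\<in>t ` {..<n}. G i (map_permutation {..<n} t p i)) = (\<Prod>i<n. G (t i) (t (p i)))"
    using inj by (simp add: prod.reindex map_permutation_apply[OF inj])
  moreover have "sign (map_permutation {..<n} t p) = sign p"
    using sign_map_permutation[OF inj p] by simp
  ultimately show ?case by simp
qed

text \<open>In each Leibniz product choose for every row the entry of \<open>G\<close> (rows in
  \<open>A\<close>) or of the identity. A permutation survives exactly if it fixes the complement of
  \<open>A\<close>, that is, if it permutes \<open>A\<close>.\<close>

lemma leibniz_det_identity_plus:
  "leibniz_det r (\<lambda>i j. (if i = j then 1 else 0) + G i j) = (\<Sum>A\<in>Pow {..<r}. det_on A G)"
proof -
  let ?R = "{..<r}"
  have "leibniz_det r (\<lambda>i j. (if i = j then 1 else 0) + G i j)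
     = (\<Sum>p | p permutes ?R. \<Sum>A\<in>Pow ?R. of_int (sign p) * ((\<Prod>i\<in>A. G i (p i)) * (\<Prod>i\<in>?R - A. if i = p i then 1 else 0)))"
    unfolding leibniz_det_def
  proof (rule sum.cong[OF refl])
    fix p
    have "(\<Prod>i<r. (if i = p i then 1 else 0) + G i (p i)) = (\<Prod>i<r. G i (p i) + (if i = p i then 1 else 0))"
      by (simp add: add.commute)
    also have "\<dots> = (\<Sum>A\<in>Pow ?R. (\<Prod>i\<in>A. G i (p i)) * (\<Prod>i\<in>?R - A. if i = p i then 1 else 0))"
      by (rule prod_add) simp
    finally show "of_int (sign p) * (\<Prod>i<r. (if i = p i then 1 else 0) + G i (p i))
      = (\<Sum>A\<in>Pow ?R. of_int (sign p) * ((\<Prod>i\<in>A. G i (p i)) * (\<Prod>i\<in>?R - A. if i = p i then 1 else 0)))"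
      by (simp only: sum_distrib_left)
  qed
  also have "\<dots> = (\<Sum>A\<in>Pow ?R. \<Sum>p | p permutes ?R. of_int (sign p) * ((\<Prod>i\<in>A. G i (p i)) * (\<Prod>i\<in>?R - A. if i = p i then 1 else 0)))"
    by (rule sum.swap)
  also have "\<dots> = (\<Sum>A\<in>Pow ?R. det_on A G)"
  proof (rule sum.cong[OF refl])
    fix A assume "A \<in> Pow ?R"
    then have A: "A \<subseteq> ?R" by simp
    have "(\<Sum>p | p permutes ?R. of_int (sign p) * ((\<Prod>i\<in>A. G i (p i)) * (\<Prod>i\<in>?R - A. if i = p i then 1 else 0)))
       = (\<Sum>p | p permutes A. of_int (sign p) * ((\<Prod>i\<in>A. G i (p i)) * (\<Prod>i\<in>?R - A. if i = p i then 1 else 0)))"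
    proof (rule sum.mono_neutral_right)
      show "finite {p. p permutes ?R}" by (simp add: finite_permutations)
      show "{p. p permutes A} \<subseteq> {p. p permutes ?R}" using A by (auto intro: permutes_subset)
      show "\<forall>p\<in>{p. p permutes ?R} - {p. p permutes A}.
          of_int (sign p) * ((\<Prod>i\<in>A. G i (p i)) * (\<Prod>i\<in>?R - A. if i = p i then 1 else 0)) = (0::real)"
      proof
        fix p assume p: "p \<in> {p. p permutes ?R} - {p. p permutes A}"
        have "\<exists>i\<in>?R - A. p i \<noteq> i"
        proof (rule ccontr)
          assume "\<not> ?thesis"
          then have "p permutes A" using p by (intro permutes_superset[of p ?R A]) auto
          with p show False by simp
        qed
        then obtain i where i: "i \<in> ?R - A" "i \<noteq> p i" by metis
        have "(\<Prod>i\<in>?R - A. if i = p i then 1 else 0) = (0::real)"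
          by (rule prod_zero) (use i in \<open>auto intro!: bexI[of _ i]\<close>)
        then show "of_int (sign p) * ((\<Prod>i\<in>A. G i (p i)) * (\<Prod>i\<in>?R - A. if i = p i then 1 else 0)) = (0::real)"
          by (simp only: mult_zero_right)
      qed
    qed
    also have "\<dots> = det_on A G" unfolding det_on_def
    proof (rule sum.cong[OF refl])
      fix p assume "p \<in> {p. p permutes A}"
      then have "(\<Prod>i\<in>?R - A. if i = p i then 1 else 0) = (1::real)"
        by (intro prod.neutral) (auto simp: permutes_not_in)
      then show "of_int (sign p) * ((\<Prod>i\<in>A. G i (p i)) * (\<Prod>i\<in>?R - A. if i = p i then 1 else 0))
        = of_int (sign p) * (\<Prod>i\<in>A. G i (p i))" by (simp only: mult_1_right)
    qed
    finally show "(\<Sum>p | p permutes ?R. of_int (sign p) * ((\<Prod>i\<in>A. G i (p i)) * (\<Prod>i\<in>?R - A. if i = p i then 1 else 0))) = det_on A G" .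
  qed
  finally show ?thesis .
qed

text \<open>Tuples with a repetition give two equal columns, and each set of \<open>n\<close>
  indices has n! enumerations with the same minor.\<close>

lemma sum_leibniz_det_tuples:
  "(\<Sum>t\<in>{..<n} \<rightarrow>\<^sub>E {..<r}. leibniz_det n (\<lambda>i j. G (t i) (t j)))
     = fact n * (\<Sum>A | A \<subseteq> {..<r} \<and> card A = n. det_on A G)"
proof -
  let ?T = "{..<n} \<rightarrow>\<^sub>E {..<r}" and ?S = "{A. A \<subseteq> {..<r} \<and> card A = n}"
  have finT: "finite ?T" by (auto intro!: finite_PiE)
  have finS: "finite ?S" by (rule finite_subset[of _ "Pow {..<r}"]) auto
  have "(\<Sum>t\<in>?T. leibniz_det n (\<lambda>i j. G (t i) (t j))) = (\<Sum>t | t \<in> ?T \<and> inj_on t {..<n}. leibniz_det n (\<lambda>i j. G (t i) (t j)))"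
  proof (rule sum.mono_neutral_right[OF finT])
    show "\<forall>t\<in>?T - {t. t \<in> ?T \<and> inj_on t {..<n}}. leibniz_det n (\<lambda>i j. G (t i) (t j)) = 0"
    proof
      fix t assume "t \<in> ?T - {t. t \<in> ?T \<and> inj_on t {..<n}}"
      then show "leibniz_det n (\<lambda>i j. G (t i) (t j)) = 0"
        using leibniz_det_repeated_column[of t n "\<lambda>i k. G (t i) k"] by blast
    qed
  qed auto
  also have "\<dots> = (\<Sum>t | t \<in> ?T \<and> inj_on t {..<n}. det_on (t ` {..<n}) G)"
    by (rule sum.cong[OF refl], rule leibniz_det_reindex_inj) simp
  also have "\<dots> = (\<Sum>A\<in>?S. \<Sum>t\<in>{t \<in> {t. t \<in> ?T \<and> inj_on t {..<n}}. t ` {..<n} = A}. det_on (t ` {..<n}) G)"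
  proof (rule sum.group[symmetric])
    show "finite {t. t \<in> ?T \<and> inj_on t {..<n}}" using finT by simp
    show "(\<lambda>t. t ` {..<n}) ` {t. t \<in> ?T \<and> inj_on t {..<n}} \<subseteq> ?S"
    proof (rule image_subsetI)
      fix t assume "t \<in> {t. t \<in> ?T \<and> inj_on t {..<n}}"
      then have t: "t \<in> ?T" "inj_on t {..<n}" by simp_all
      from t(1) have "t ` {..<n} \<subseteq> {..<r}" by blast
      with card_image[OF t(2)] show "t ` {..<n} \<in> ?S" by simp
    qed
  qed (rule finS)
  also have "\<dots> = (\<Sum>A\<in>?S. fact n * det_on A G)"
  proof (rule sum.cong[OF refl])
    fix A assume "A \<in> ?S"
    then have A: "A \<subseteq> {..<r}" "card A = n" "finite A" by (auto intro: finite_subset)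
    let ?Q = "{t \<in> {t. t \<in> ?T \<and> inj_on t {..<n}}. t ` {..<n} = A}"
    have "?Q = {t \<in> {..<n} \<rightarrow>\<^sub>E A. inj_on t {..<n}}"
    proof (intro equalityI subsetI)
      fix t assume t: "t \<in> {t \<in> {..<n} \<rightarrow>\<^sub>E A. inj_on t {..<n}}"
      then have "t ` {..<n} = A" using A by (intro card_subset_eq) (auto simp: card_image)
      with t A show "t \<in> ?Q" by (auto simp: PiE_iff)
    qed (auto simp: PiE_iff)
    then have "card ?Q = fact n"
      using card_inj_on_subset_funcset[of "{..<n}" A "{..<n}"] A fact_prod_rev[of n, where ?'a = nat] by simp
    moreover have "(\<Sum>t\<in>?Q. det_on (t ` {..<n}) G) = (\<Sum>t\<in>?Q. det_on A G)" by (intro sum.cong) auto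
    ultimately show "(\<Sum>t\<in>?Q. det_on (t ` {..<n}) G) = fact n * det_on A G" by simp
  qed
  finally show ?thesis by (simp add: sum_distrib_left)
qed

text \<open>The n-th Fredholm term is the sum of the n x n principal minors of the Gram matrix
  \<open>G\<close>. There are none beyond the rank, so the series is a finite sum, and the sum of
  all principal minors is det(I + G).\<close>

theorem fredholm_det_finite_rank:
  fixes u v :: "nat \<Rightarrow> real \<Rightarrow> real"
  assumes K: "\<And>x y. x \<in> {-1..1} \<Longrightarrow> y \<in> {-1..1} \<Longrightarrow> K x y = (\<Sum>k<r. u k x * v k y)"
    and int: "\<And>k l. k < r \<Longrightarrow> l < r \<Longrightarrow> integrable I11 (\<lambda>x. v k x * u l x)"
  defines "G \<equiv> \<lambda>k l. integral\<^sup>L I11 (\<lambda>x. v k x * u l x)"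
  shows "summable (fredholm_term K)"
    and "fredholm_det K = leibniz_det r (\<lambda>k l. (if k = l then 1 else 0) + G k l)"
proof -
  have tm: "fredholm_term K n = (\<Sum>A | A \<subseteq> {..<r} \<and> card A = n. det_on A G)" for n :: nat
  proof -
    let ?PM = "PiM {..<n} (\<lambda>_. I11)" and ?T = "{..<n} \<rightarrow>\<^sub>E {..<r}"
    \<comment> \<open>The coordinate x_i occurs on the left in factor i and on the right in the
      factor with index s^(-1)(i). \<open>W\<close> regroups by coordinates, so that the integral
      becomes a product of one-dimensional ones.\<close>
    define W where "W s t x = (\<Prod>i<n. v (t (inv_into UNIV s i)) (x i) * u (t i) (x i))" for s t :: "nat \<Rightarrow> nat" and x :: "nat \<Rightarrow> real"
    have W: "integrable ?PM (W s t)" "integral\<^sup>L ?PM (W s t) = (\<Prod>i<n. G (t i) (t (s i)))"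
      if s: "s permutes {..<n}" and t: "t \<in> ?T" for s t
    proof -
      have i: "integrable I11 (\<lambda>x. v (t (inv_into UNIV s i)) x * u (t i) x)" if "i \<in> {..<n}" for i
        using t that permutes_lessThan[OF permutes_inv[OF s], of i] by (intro int) (auto simp: PiE_iff)
      show "integrable ?PM (W s t)" unfolding W_def
        by (rule PI11.product_integrable_prod[of "{..<n}" "\<lambda>i x. v (t (inv_into UNIV s i)) x * u (t i) x", OF _ i]) auto
      have "integral\<^sup>L ?PM (W s t) = (\<Prod>i<n. G (t (inv_into UNIV s i)) (t i))" unfolding W_def G_def
        by (rule PI11.product_integral_prod[of "{..<n}" "\<lambda>i x. v (t (inv_into UNIV s i)) x * u (t i) x", OF _ i]) auto
      also have "\<dots> = (\<Prod>i<n. G (t i) (t (s i)))"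
        using prod.permute[OF s, of "\<lambda>i. G (t (inv_into UNIV s i)) (t i)"]
        by (simp add: o_def permutes_inverses[OF s])
      finally show "integral\<^sup>L ?PM (W s t) = (\<Prod>i<n. G (t i) (t (s i)))" .
    qed
    have expand: "leibniz_det n (\<lambda>i j. K (x i) (x j)) = (\<Sum>s | s permutes {..<n}. \<Sum>t\<in>?T. of_int (sign s) * W s t x)"
      if "x \<in> space ?PM" for x
      unfolding leibniz_det_def
    proof (rule sum.cong[OF refl])
      fix s assume "s \<in> {s. s permutes {..<n}}"
      then have s: "s permutes {..<n}" by simp
      have xi: "x i \<in> {-1..1}" if "i < n" for i using \<open>x \<in> space ?PM\<close> that by (auto simp: space_PiM PiE_iff)
      have "(\<Prod>i<n. K (x i) (x (s i))) = (\<Prod>i<n. \<Sum>k<r. u k (x i) * v k (x (s i)))"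
        by (intro prod.cong refl K xi) (auto intro: permutes_lessThan[OF s])
      also have "\<dots> = (\<Sum>t\<in>?T. \<Prod>i<n. u (t i) (x i) * v (t i) (x (s i)))"
        by (rule prod_sum_PiE) auto
      also have "\<dots> = (\<Sum>t\<in>?T. W s t x)"
      proof (rule sum.cong[OF refl])
        fix t
        have "(\<Prod>i<n. v (t (inv_into UNIV s i)) (x i)) = (\<Prod>i<n. v (t i) (x (s i)))"
          using prod.permute[OF s, of "\<lambda>i. v (t (inv_into UNIV s i)) (x i)"]
          by (simp add: o_def permutes_inverses[OF s])
        then show "(\<Prod>i<n. u (t i) (x i) * v (t i) (x (s i))) = W s t x"
          unfolding W_def prod.distrib by (simp only: mult.commute)
      qed
      finally show "of_int (sign s) * (\<Prod>i<n. K (x i) (x (s i))) = (\<Sum>t\<in>?T. of_int (sign s) * W s t x)"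
        by (simp only: sum_distrib_left)
    qed
    have "integral\<^sup>L ?PM (\<lambda>x. leibniz_det n (\<lambda>i j. K (x i) (x j)))
        = integral\<^sup>L ?PM (\<lambda>x. \<Sum>s | s permutes {..<n}. \<Sum>t\<in>?T. of_int (sign s) * W s t x)"
      by (rule Bochner_Integration.integral_cong[OF refl]) (rule expand)
    also have "\<dots> = (\<Sum>s | s permutes {..<n}. integral\<^sup>L ?PM (\<lambda>x. \<Sum>t\<in>?T. of_int (sign s) * W s t x))"
      by (rule Bochner_Integration.integral_sum)
         (auto intro!: Bochner_Integration.integrable_sum integrable_mult_right W simp del: integrable_mult_right_iff)
    also have "\<dots> = (\<Sum>s | s permutes {..<n}. \<Sum>t\<in>?T. integral\<^sup>L ?PM (\<lambda>x. of_int (sign s) * W s t x))"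
      by (intro sum.cong refl Bochner_Integration.integral_sum integrable_mult_right W) auto
    also have "\<dots> = (\<Sum>s | s permutes {..<n}. \<Sum>t\<in>?T. of_int (sign s) * (\<Prod>i<n. G (t i) (t (s i))))"
      by (intro sum.cong refl) (simp add: W(2))
    also have "\<dots> = (\<Sum>t\<in>?T. leibniz_det n (\<lambda>i j. G (t i) (t j)))"
      unfolding leibniz_det_def by (rule sum.swap)
    also have "\<dots> = fact n * (\<Sum>A | A \<subseteq> {..<r} \<and> card A = n. det_on A G)"
      by (rule sum_leibniz_det_tuples)
    finally show ?thesis unfolding fredholm_term_def by simp
  qed
  have zero: "fredholm_term K n = 0" if "n \<notin> {..r}" for n
  proof -
    have "{A. A \<subseteq> {..<r} \<and> card A = n} = {}"
      using that card_mono[of "{..<r}"] by fastforce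
    then show ?thesis unfolding tm by (simp only: sum.empty)
  qed
  show "summable (fredholm_term K)" by (rule summable_finite[of "{..r}"]) (use zero in auto)
  have "fredholm_det K = (\<Sum>n\<le>r. fredholm_term K n)"
    unfolding fredholm_det_def by (rule suminf_finite) (use zero in auto)
  also have "\<dots> = (\<Sum>n\<le>r. \<Sum>A\<in>{A \<in> Pow {..<r}. card A = n}. det_on A G)"
    unfolding tm by (intro sum.cong refl) auto
  also have "\<dots> = (\<Sum>A\<in>Pow {..<r}. det_on A G)"
  proof (rule sum.group)
    show "card ` Pow {..<r} \<subseteq> {..r}" using card_mono[of "{..<r}"] by fastforce
  qed auto
  also have "\<dots> = leibniz_det r (\<lambda>k l. (if k = l then 1 else 0) + G k l)"
    by (rule leibniz_det_identity_plus[symmetric])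
  finally show "fredholm_det K = leibniz_det r (\<lambda>k l. (if k = l then 1 else 0) + G k l)" .
qed

section \<open>The Jacobi orthogonal ensemble\<close>

lemma poly_eq_sum_lessThan:
  fixes p :: "real poly"
  assumes "degree p < n"
  shows "poly p x = (\<Sum>i<n. coeff p i * x ^ i)"
  unfolding poly_altdef
  by (rule sum.mono_neutral_left) (use assms in \<open>auto intro: coeff_eq_0\<close>)

lemma mult_powr_nonneg: "0 \<le> y \<Longrightarrow> y * y powr c = y powr (c + 1)" for y :: real
  using power_mult_powr_nonneg[of y 1 c] by simp

context
  fixes a b :: real
  assumes a: "a > -2" and b: "b > -2"
begin

abbreviation w :: "real \<Rightarrow> real" where "w \<equiv> wJ a b"
abbreviation W :: "real \<Rightarrow> real" where "W x \<equiv> (1 - x) powr (a + 1) * (1 + x) powr (b + 1)"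

lemma ab1: "a + 1 > -1" "b + 1 > -1"
  using a b by auto

lemma integrable_poly_wJ: "integrable I11 (\<lambda>x. poly p x * w x)"
  unfolding wJ_def by (rule integrable_poly_jacobi_weight) (use a b in auto)

text \<open>The factor 1 - x^2 of the kernel \<open>SN1\<close> raises the exponents of w^2 by one,
  which turns the half exponents of the ensemble into the orthogonality weight.\<close>

lemma wJ_square: "x \<in> {-1..1} \<Longrightarrow> w x * ((1 - x\<^sup>2) * w x) = W x"
proof -
  assume x: "x \<in> {-1..1}"
  have sq: "y powr (c / 2) * y powr (c / 2) = y powr c" for y c :: real by (simp flip: powr_add)
  have "w x * ((1 - x\<^sup>2) * w x)
     = ((1 - x) * ((1 - x) powr (a / 2) * (1 - x) powr (a / 2))) * ((1 + x) * ((1 + x) powr (b / 2) * (1 + x) powr (b / 2)))"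
    unfolding wJ_def by (simp add: power2_eq_square algebra_simps)
  also have "\<dots> = W x" unfolding sq using x by (simp add: mult_powr_nonneg)
  finally show ?thesis .
qed

section \<open>Orthonormal polynomials for the weight \<open>W\<close>\<close>

definition jacobi_onp :: "nat \<Rightarrow> real poly" where
  "jacobi_onp j = Polynomial.smult (1 / sqrt (jacobi_h (a + 1) (b + 1) j)) (jacobi_poly (a + 1) (b + 1) j)"

lemma phi1_eq: "phi1 a b j x = poly (jacobi_onp j) x * w x"
  by (simp add: phi1_def jacobi_onp_def wJ_def poly_jacobi_poly)

lemma degree_jacobi_onp: "degree (jacobi_onp j) \<le> j"
  unfolding jacobi_onp_def using order.trans[OF degree_smult_le degree_jacobi_poly] .

lemma coeff_jacobi_onp_pos: "coeff (jacobi_onp j) j > 0"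
  unfolding jacobi_onp_def using coeff_jacobi_poly_pos[OF ab1] jacobi_h_pos[OF ab1] by simp

lemma integrable_poly_W: "integrable I11 (\<lambda>x. poly p x * W x)"
  by (rule integrable_poly_jacobi_weight[OF ab1])

lemma jacobi_onp_orthogonal:
  assumes "degree p < j \<or> p = 0"
  shows "integral\<^sup>L I11 (\<lambda>x. poly (p * jacobi_onp j) x * W x) = 0"
proof (cases "p = 0")
  case False
  then have "integral\<^sup>L I11 (\<lambda>x. poly p x * jacobiP (a + 1) (b + 1) j x * W x) = 0"
    using assms by (intro jacobi_orthogonal[OF ab1]) auto
  moreover have "poly (p * jacobi_onp j) x * W x
     = 1 / sqrt (jacobi_h (a + 1) (b + 1) j) * (poly p x * jacobiP (a + 1) (b + 1) j x * W x)" for x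
    by (simp add: jacobi_onp_def poly_jacobi_poly)
  ultimately show ?thesis by (simp only: Bochner_Integration.integral_mult_right_zero mult_zero_right)
qed simp

lemma jacobi_onp_norm: "integral\<^sup>L I11 (\<lambda>x. poly (jacobi_onp j * jacobi_onp j) x * W x) = 1"
proof -
  have h: "jacobi_h (a + 1) (b + 1) j > 0" by (rule jacobi_h_pos[OF ab1])
  have "poly (jacobi_onp j * jacobi_onp j) x * W x
     = 1 / jacobi_h (a + 1) (b + 1) j * (jacobiP (a + 1) (b + 1) j x * jacobiP (a + 1) (b + 1) j x * W x)" for x
    using h by (simp add: jacobi_onp_def poly_jacobi_poly)
  then show ?thesis using h jacobi_norm[OF ab1, of j] by (simp only: Bochner_Integration.integral_mult_right_zero) simp
qed

lemma jacobi_onp_orthonormal: "integral\<^sup>L I11 (\<lambda>x. poly (jacobi_onp j * jacobi_onp k) x * W x) = (if j = k then 1 else 0)"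
proof (cases j k rule: linorder_cases)
  case less
  then show ?thesis using jacobi_onp_orthogonal[of "jacobi_onp j" k] degree_jacobi_onp[of j] by simp
next
  case greater
  then show ?thesis using jacobi_onp_orthogonal[of "jacobi_onp k" j] degree_jacobi_onp[of k] by (simp add: mult.commute)
next
  case equal
  then show ?thesis using jacobi_onp_norm[of k] by simp
qed

lemma integral_poly_times_phi:
  "integral\<^sup>L I11 (\<lambda>x. (poly p x * w x) * ((1 - x\<^sup>2) * (poly q x * w x))) = integral\<^sup>L I11 (\<lambda>x. poly (p * q) x * W x)"
proof (rule Bochner_Integration.integral_cong[OF refl])
  fix x assume "x \<in> space I11"
  then have "W x = w x * ((1 - x\<^sup>2) * w x)" by (simp add: wJ_square)
  then show "(poly p x * w x) * ((1 - x\<^sup>2) * (poly q x * w x)) = poly (p * q) x * W x" by (simp add: mult_ac)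
qed

text \<open>Pairing a nonzero \<open>d\<close> of degree e with the orthonormal polynomial of degree
  e yields the quotient \<open>c\<close> of the leading coefficients, because the remainder has
  degree below e. This quotient is not 0.\<close>

lemma orthogonal_to_jacobi_onp_imp:
  assumes d: "degree d < n \<or> d = 0" and orth: "\<And>j. j < n \<Longrightarrow> integral\<^sup>L I11 (\<lambda>x. poly (d * jacobi_onp j) x * W x) = 0"
  shows "d = 0"
proof (rule ccontr)
  assume "d \<noteq> 0"
  define e where "e = degree d"
  have e: "e < n" using d \<open>d \<noteq> 0\<close> by (auto simp: e_def)
  define c where "c = coeff d e / coeff (jacobi_onp e) e"
  have "c \<noteq> 0" using \<open>d \<noteq> 0\<close> coeff_jacobi_onp_pos[of e] by (simp add: c_def e_def)
  define r where "r = d - Polynomial.smult c (jacobi_onp e)"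
  have "degree r \<le> e" unfolding r_def
    by (intro degree_diff_le order.trans[OF degree_smult_le] degree_jacobi_onp) (simp add: e_def)
  moreover have "coeff r e = 0" using coeff_jacobi_onp_pos[of e] by (simp add: r_def c_def)
  ultimately have r: "degree r < e \<or> r = 0" using le_neq_implies_less leading_coeff_0_iff by metis
  have "poly (d * jacobi_onp e) x * W x = poly (r * jacobi_onp e) x * W x + c * (poly (jacobi_onp e * jacobi_onp e) x * W x)" for x
    by (simp add: r_def algebra_simps)
  then have "integral\<^sup>L I11 (\<lambda>x. poly (d * jacobi_onp e) x * W x) = 0 + c * 1"
    using jacobi_onp_orthogonal[OF r] jacobi_onp_norm[of e] integrable_poly_W[of "r * jacobi_onp e"] integrable_poly_W[of "jacobi_onp e * jacobi_onp e"]
    by (simp only: Bochner_Integration.integral_add Bochner_Integration.integral_mult_right_zero integrable_mult_right)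
  with orth[OF e] \<open>c \<noteq> 0\<close> show False by simp
qed

text \<open>The polynomial \<open>wt_deriv p\<close> is defined by \<open>((1 - x\<^sup>2) w p)' = w (wt_deriv p)\<close>.\<close>
definition wt_deriv :: "real poly \<Rightarrow> real poly" where
  "wt_deriv p = [:1, 0, -1:] * pderiv p + [:b / 2 - a / 2, - (a / 2 + b / 2 + 2):] * p"

text \<open>The term -x^2 p' contributes -j, and the linear factor contributes -(a/2 + b/2 + 2).
  This is the coefficient that C has to cancel for j = N - 1.\<close>

lemma coeff_wt_deriv:
  assumes "degree p \<le> j"
  shows "coeff (wt_deriv p) (Suc j) = - (real j + a / 2 + b / 2 + 2) * coeff p j"
proof -
  have "coeff p (Suc j) = 0" "coeff p (Suc (Suc j)) = 0" "coeff p (Suc (Suc (Suc j))) = 0"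
    using assms by (auto intro: coeff_eq_0)
  then show ?thesis
    by (cases j) (simp_all add: wt_deriv_def coeff_pderiv coeff_pCons algebra_simps split: nat.splits)
qed

lemma degree_wt_deriv: "degree (wt_deriv p) \<le> Suc (degree p)"
proof -
  have "degree ([:1, 0, -1:] * pderiv p) \<le> Suc (degree p)"
  proof (cases "degree p = 0")
    case True
    then have "pderiv p = 0" by (simp add: pderiv_eq_0_iff)
    then show ?thesis by simp
  next
    case False
    have "degree ([:1, 0, -1:] * pderiv p) \<le> degree [:1, 0, -1::real:] + degree (pderiv p)" by (rule degree_mult_le)
    also have "\<dots> \<le> Suc (degree p)" using False by (simp add: degree_pderiv)
    finally show ?thesis .
  qed
  moreover have "degree ([:b / 2 - a / 2, - (a / 2 + b / 2 + 2):] * p) \<le> Suc (degree p)"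
    by (rule order.trans[OF degree_mult_le]) simp
  ultimately show ?thesis unfolding wt_deriv_def by (rule degree_add_le)
qed

text \<open>An instance of \<open>eps_op_derivative\<close>. With the factor 1 - x^2 absorbed, the
  exponents a/2 + 1 and b/2 + 1 are positive by \<open>a, b > -2\<close>, so the function is
  continuous and vanishes at both endpoints.\<close>

lemma eps_op_wt_deriv:
  assumes x: "x \<in> {-1..1}"
  shows "eps_op (\<lambda>y. poly (wt_deriv p) y * w y) x = (1 - x\<^sup>2) * (poly p x * w x)"
proof (rule eps_op_derivative[of "{}" "\<lambda>x. (1 - x\<^sup>2) * (poly p x * w x)"])
  let ?F = "\<lambda>x. (1 - x) powr (a / 2 + 1) * (1 + x) powr (b / 2 + 1) * poly p x"
  have F: "(1 - x\<^sup>2) * (poly p x * w x) = ?F x" if "x \<in> {-1..1}" for x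
  proof -
    have "(1 - x\<^sup>2) * (poly p x * w x) = ((1 - x) * (1 - x) powr (a / 2)) * ((1 + x) * (1 + x) powr (b / 2)) * poly p x"
      unfolding wJ_def by (simp add: power2_eq_square algebra_simps)
    moreover have "(1 - x) * (1 - x) powr (a / 2) = (1 - x) powr (a / 2 + 1)"
      "(1 + x) * (1 + x) powr (b / 2) = (1 + x) powr (b / 2 + 1)"
      using that by (auto intro!: mult_powr_nonneg)
    ultimately show ?thesis by (simp only:)
  qed
  have "continuous_on {-1..1} ?F"
    by (intro continuous_intros continuous_on_powr') (use a b in auto)
  then show "continuous_on {-1..1} (\<lambda>x. (1 - x\<^sup>2) * (poly p x * w x))"
    by (rule continuous_on_eq) (simp add: F)
  show "((\<lambda>x. (1 - x\<^sup>2) * (poly p x * w x)) has_real_derivative poly (wt_deriv p) z * w z) (at z)"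
    if z: "z \<in> {-1<..<1} - {}" for z
  proof -
    have z': "1 - z > 0" "1 + z > 0" using z by auto
    let ?u = "(1 - z) powr (a / 2)" and ?v = "(1 + z) powr (b / 2)"
    have p1: "(1 - z) powr (a / 2 + 1) = (1 - z) * ?u" and p2: "(1 + z) powr (b / 2 + 1) = (1 + z) * ?v"
      using z' by (auto intro!: mult_powr_nonneg[symmetric])
    have d1: "((\<lambda>x. (1 - x) powr (a / 2 + 1)) has_real_derivative ((a / 2 + 1) * (1 - z) powr (a / 2 + 1 - 1)) * (-1)) (at z)"
      by (rule DERIV_chain2[OF has_real_derivative_powr]) (use z' in \<open>auto intro!: derivative_eq_intros\<close>)
    have d2: "((\<lambda>x. (1 + x) powr (b / 2 + 1)) has_real_derivative ((b / 2 + 1) * (1 + z) powr (b / 2 + 1 - 1)) * 1) (at z)"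
      by (rule DERIV_chain2[OF has_real_derivative_powr]) (use z' in \<open>auto intro!: derivative_eq_intros\<close>)
    have "(?F has_real_derivative
        (((a / 2 + 1) * (1 - z) powr (a / 2 + 1 - 1) * (-1)) * (1 + z) powr (b / 2 + 1)
          + ((b / 2 + 1) * (1 + z) powr (b / 2 + 1 - 1) * 1) * (1 - z) powr (a / 2 + 1)) * poly p z
        + poly (pderiv p) z * ((1 - z) powr (a / 2 + 1) * (1 + z) powr (b / 2 + 1))) (at z)"
      by (rule DERIV_mult[OF DERIV_mult[OF d1 d2] poly_DERIV])
    moreover have "(((a / 2 + 1) * (1 - z) powr (a / 2 + 1 - 1) * (-1)) * (1 + z) powr (b / 2 + 1)
          + ((b / 2 + 1) * (1 + z) powr (b / 2 + 1 - 1) * 1) * (1 - z) powr (a / 2 + 1)) * poly p z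
        + poly (pderiv p) z * ((1 - z) powr (a / 2 + 1) * (1 + z) powr (b / 2 + 1)) = poly (wt_deriv p) z * w z"
    proof -
      have e: "(((A + 1) * u * (-1)) * ((1 + z) * v) + ((B + 1) * v * 1) * ((1 - z) * u)) * P + P' * ((1 - z) * u * ((1 + z) * v))
        = ((1 - z * z) * P' + (B - A - z * (A + B + 2)) * P) * (u * v)" for A B u v P P' :: real
        by (simp add: algebra_simps)
      have dp: "poly (wt_deriv p) z = (1 - z * z) * poly (pderiv p) z + (b / 2 - a / 2 - z * (a / 2 + b / 2 + 2)) * poly p z"
        by (simp add: wt_deriv_def algebra_simps)
      have "a / 2 + 1 - 1 = a / 2" "b / 2 + 1 - 1 = b / 2" by simp_all
      then show ?thesis
        unfolding p1 p2 wJ_def dp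
        using e[of "a / 2" ?u ?v "b / 2" "poly p z" "poly (pderiv p) z"] by (simp only:)
    qed
    ultimately have "(?F has_real_derivative poly (wt_deriv p) z * w z) (at z)" by (simp only:)
    then show ?thesis
      by (rule has_field_derivative_transform_within_open[of _ _ _ "{-1<..<1}"]) (use z in \<open>auto simp: F\<close>)
  qed
qed (use x integrable_poly_wJ in auto)

text \<open>The origin of the constant: it is the quotient by which phi_N cancels the top
  coefficient of \<open>wt_deriv (jacobi_onp (N - 1))\<close>. Gamma recurrences give the ratios of
  consecutive leading coefficients and norms; the identity is checked for squares and holds because
  both sides are nonnegative.\<close>

lemma CN1_lead:
  assumes N: "N \<ge> 2"
  shows "CN1 a b N * coeff (jacobi_onp N) N = (real N + a / 2 + b / 2 + 1) * coeff (jacobi_onp (N - 1)) (N - 1)"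
proof -
  \<comment> \<open>\<open>s\<close> is the sum of the shifted parameters a+1 and b+1. From N >= 2
    and s > -2 all Gamma arguments below are positive, and N - 1 >= 1 falls under the generic branch
    of \<open>jacobi_h\<close>.\<close>
  define n s k h where "n = real N" and "s = a + b + 2"
    and "k j = coeff (jacobi_poly (a + 1) (b + 1) j) j" and "h j = jacobi_h (a + 1) (b + 1) j" for j
  have n: "n \<ge> 2" and s: "s > -2" using N a b by (auto simp: n_def s_def)
  have n1: "real (N - 1) = n - 1" using N by (simp add: n_def of_nat_diff)
  have G: "Gamma (z + 1) = z * Gamma z" if "z > 0" for z :: real
    using that by (intro Gamma_plus1) (auto elim!: nonpos_Ints_cases)
  have hp: "h N > 0" "h (N - 1) > 0" and kp: "k N > 0" "k (N - 1) > 0"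
    unfolding h_def k_def using jacobi_h_pos[OF ab1] coeff_jacobi_poly_pos[OF ab1] by auto
  have fN: "fact N = n * fact (N - 1)" using N by (simp add: n_def fact_reduce)
  have kk: "k N * (2 * n * (n + s)) = (2 * n + s) * (2 * n + s - 1) * k (N - 1)"
  proof -
    have "k N = Gamma (2 * n + s + 1) / (fact N * Gamma (n + s + 1)) / 2 ^ N"
    proof -
      have e: "2 * real N + (a + 1) + (b + 1) = 2 * n + s" "2 * n + s - real N + 1 = n + s + 1"
        by (simp_all add: n_def s_def)
      then show ?thesis unfolding k_def coeff_jacobi_poly e(1)
        using n s by (subst gbinomial_eq_Gamma) (simp_all add: e(2))
    qed
    moreover have "k (N - 1) = Gamma (2 * n + s - 1) / (fact (N - 1) * Gamma (n + s)) / 2 ^ (N - 1)"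
    proof -
      have e: "2 * real (N - 1) + (a + 1) + (b + 1) = 2 * n + s - 2" "2 * n + s - 2 - real (N - 1) + 1 = n + s"
          "2 * n + s - 2 + 1 = 2 * n + s - 1"
        unfolding n1 by (simp_all add: s_def)
      have g: "2 * n + s - 2 - real (N - 1) + 1 > 0" unfolding e(2) using n s by simp
      show ?thesis unfolding k_def coeff_jacobi_poly e(1) gbinomial_eq_Gamma[OF g] e(2) e(3) ..
    qed
    moreover have "Gamma (2 * n + s + 1) = (2 * n + s) * ((2 * n + s - 1) * Gamma (2 * n + s - 1))"
      using G[of "2 * n + s"] G[of "2 * n + s - 1"] n s by simp
    moreover have "Gamma (n + s + 1) = (n + s) * Gamma (n + s)" using n s by (intro G) simp
    moreover have "(2::real) ^ N = 2 * 2 ^ (N - 1)" using N by (simp flip: power_Suc)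
    moreover have "P * (A * g) / (n * f * (E * G)) / (2 * t) * (2 * n * E) = P * A * (g / (f * G) / t)"
      if "E \<noteq> 0" for P A g f E G t :: real
      using that n by (simp add: mult_ac)
    moreover have "n + s \<noteq> 0" using n s by simp
    ultimately show ?thesis using fN by (simp only:)
  qed
  have hh: "h N * (n * (2 * n + s + 1) * (n + s)) = h (N - 1) * ((n + a + 1) * (n + b + 1) * (2 * n + s - 1))"
  proof -
    have "h N = 2 powr (s + 1) * Gamma (n + a + 2) * Gamma (n + b + 2) / (fact N * (2 * n + s + 1) * Gamma (n + s + 1))"
      unfolding h_def jacobi_h_def using N by (simp add: n_def s_def algebra_simps)
    moreover have "h (N - 1) = 2 powr (s + 1) * Gamma (n + a + 1) * Gamma (n + b + 1) / (fact (N - 1) * (2 * n + s - 1) * Gamma (n + s))"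
      unfolding h_def jacobi_h_def n1 using N by (simp add: s_def algebra_simps)
    moreover have "Gamma (n + s + 1) = (n + s) * Gamma (n + s)" using n s by (intro G) simp
    moreover have "Gamma (n + a + 2) = (n + a + 1) * Gamma (n + a + 1)" "Gamma (n + b + 2) = (n + b + 1) * Gamma (n + b + 1)"
    proof -
      have e: "n + a + 1 + 1 = n + a + 2" "n + b + 1 + 1 = n + b + 2" by simp_all
      have "Gamma (n + a + 1 + 1) = (n + a + 1) * Gamma (n + a + 1)" "Gamma (n + b + 1 + 1) = (n + b + 1) * Gamma (n + b + 1)"
        by (rule G, use n a b in linarith)+
      then show "Gamma (n + a + 2) = (n + a + 1) * Gamma (n + a + 1)" "Gamma (n + b + 2) = (n + b + 1) * Gamma (n + b + 1)"
        unfolding e .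
    qed
    moreover have "Gamma (n + s) > 0" using n s by (intro Gamma_real_pos) simp
    ultimately show ?thesis using n s fN by (simp add: mult_ac)
  qed
  have C2: "(CN1 a b N)\<^sup>2 = n * (n + a + 1) * (n + b + 1) * (n + s) / ((2 * n + s - 1) * (2 * n + s + 1))"
  proof -
    have e: "n + a + b + 2 = n + s" "2 * n + a + b + 1 = 2 * n + s - 1" "2 * n + a + b + 3 = 2 * n + s + 1"
      by (simp_all add: s_def)
    have "0 \<le> n * (n + a + 1) * (n + b + 1) * (n + s) / ((2 * n + s - 1) * (2 * n + s + 1))"
      using n s a b by (intro divide_nonneg_nonneg mult_nonneg_nonneg) auto
    then show ?thesis unfolding CN1_def n_def[symmetric] e by simp
  qed
  \<comment> \<open>Insert the ratios \<open>kk\<close> and \<open>hh\<close>: everything except the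
    square of (2n + s)/2 = N + a/2 + b/2 + 1 cancels.\<close>
  have "(CN1 a b N)\<^sup>2 * ((k N)\<^sup>2 * h (N - 1)) = ((2 * n + s) / 2)\<^sup>2 * ((k (N - 1))\<^sup>2 * h N)"
  proof -
    define p q A B E where "p = n + a + 1" and "q = n + b + 1" and "A = 2 * n + s - 1" and "B = 2 * n + s + 1" and "E = n + s"
    note defs = p_def[symmetric] q_def[symmetric] A_def[symmetric] B_def[symmetric] E_def[symmetric]
    have pos: "n \<noteq> 0" "A \<noteq> 0" "B \<noteq> 0" "E \<noteq> 0" using n s by (auto simp: A_def B_def E_def)
    have "k N = (2 * n + s) * A * k (N - 1) / (2 * n * E)" "h N = h (N - 1) * (p * q * A) / (n * B * E)"
      using kk hh pos unfolding defs by (simp_all add: eq_divide_eq)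
    then show ?thesis unfolding C2 defs using pos by (simp add: power2_eq_square mult_ac)
  qed
  then have "(CN1 a b N)\<^sup>2 * ((k N)\<^sup>2 / h N) = ((2 * n + s) / 2)\<^sup>2 * ((k (N - 1))\<^sup>2 / h (N - 1))"
    using hp by (simp add: field_simps)
  then have "(CN1 a b N * (k N / sqrt (h N)))\<^sup>2 = ((2 * n + s) / 2 * (k (N - 1) / sqrt (h (N - 1))))\<^sup>2"
    using hp by (simp add: power_mult_distrib power_divide)
  moreover have "0 \<le> CN1 a b N * (k N / sqrt (h N))" "0 \<le> (2 * n + s) / 2 * (k (N - 1) / sqrt (h (N - 1)))"
    using hp kp n s a b
    by (auto intro!: mult_nonneg_nonneg divide_nonneg_nonneg simp: CN1_def n_def[symmetric])
  ultimately have "CN1 a b N * (k N / sqrt (h N)) = (2 * n + s) / 2 * (k (N - 1) / sqrt (h (N - 1)))"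
    by (meson power2_eq_imp_eq)
  moreover have "coeff (jacobi_onp j) j = k j / sqrt (h j)" for j by (simp add: jacobi_onp_def k_def h_def)
  moreover have "(2 * n + s) / 2 = real N + a / 2 + b / 2 + 1" by (simp add: n_def s_def field_simps)
  ultimately show ?thesis by simp
qed

lemma skew_form_poly:
  assumes g: "\<And>j. integrable I11 (\<lambda>x. x ^ j * g x)" and p: "degree p < n" and q: "degree q < n"
  shows "skew_form (\<lambda>x. poly p x * g x) (\<lambda>x. poly q x * g x)
     = (\<Sum>i<n. \<Sum>j<n. coeff p i * skew_form (\<lambda>x. x ^ i * g x) (\<lambda>x. x ^ j * g x) * coeff q j)"
proof -
  have "(\<lambda>x. poly r x * g x) = (\<lambda>x. \<Sum>i<n. coeff r i * (x ^ i * g x))" if "degree r < n" for r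
    unfolding poly_eq_sum_lessThan[OF that] by (simp add: sum_distrib_right mult.assoc)
  then show ?thesis unfolding p q
    using skew_form_sum[of "{..<n}" "{..<n}" "\<lambda>i x. x ^ i * g x" "\<lambda>i x. x ^ i * g x" "coeff p" "coeff q"] g p q by simp
qed

lemma integrable_power_wJ: "integrable I11 (\<lambda>x. x ^ j * w x)"
  using integrable_poly_wJ[of "Polynomial.monom 1 j"] by (simp add: poly_monom)

text \<open>\<open>skew_form\<close> is degenerate on the space of \<open>w\<close> times polynomials of degree at most \<open>N\<close>, whose dimension is odd.
  By partial integration a vector of its radical is orthogonal to \<open>(1 - x\<^sup>2) \<phi>\<^sub>j\<close> for \<open>j < N\<close>, so it is a multiple of \<open>\<phi>\<^sub>N\<close>.\<close>
lemma skew_form_phi_N: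
  assumes N: "even N" and p: "degree p \<le> N"
  shows "skew_form (\<lambda>x. poly p x * w x) (\<lambda>x. poly (jacobi_onp N) x * w x) = 0"
proof -
  let ?n = "Suc N"
  let ?E = "\<lambda>i j. skew_form (\<lambda>x. x ^ i * w x) (\<lambda>x. x ^ j * w x)"
  have sk: "?E j i = - ?E i j" for i j by (rule skew_form_skew[OF integrable_power_wJ integrable_power_wJ])
  have "leibniz_det ?n ?E = leibniz_det ?n (\<lambda>i j. ?E j i)" by (rule leibniz_det_transpose[symmetric])
  also have "\<dots> = leibniz_det ?n (\<lambda>i j. - ?E i j)" by (rule leibniz_det_cong) (rule sk)
  also have "\<dots> = - leibniz_det ?n ?E" using N by (simp add: leibniz_det_neg)
  finally have "leibniz_det ?n ?E = 0" by simp
  then obtain c where c: "\<exists>i<?n. c i \<noteq> 0" "\<And>i. i < ?n \<Longrightarrow> (\<Sum>j<?n. ?E i j * c j) = 0"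
    by (rule leibniz_det_zero_kernel) blast
  define r where "r = (\<Sum>j<?n. Polynomial.monom (c j) j)"
  have coeff_r: "coeff r i = (if i < ?n then c i else 0)" for i
    unfolding r_def by (simp add: coeff_sum)
  have deg_r: "degree r < ?n" by (rule degree_lessI) (auto simp: coeff_r)
  have "r \<noteq> 0"
  proof
    assume "r = 0"
    then have "c i = 0" if "i < ?n" for i using coeff_r[of i] that by simp
    with c(1) show False by blast
  qed
  have rad: "skew_form (\<lambda>x. poly q x * w x) (\<lambda>x. poly r x * w x) = 0" if "degree q < ?n" for q
  proof -
    have "(\<Sum>j<?n. coeff q i * ?E i j * coeff r j) = 0" if "i < ?n" for i
    proof -
      have "(\<Sum>j<?n. coeff q i * ?E i j * coeff r j) = coeff q i * (\<Sum>j<?n. ?E i j * c j)"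
        unfolding sum_distrib_left by (intro sum.cong refl) (simp add: coeff_r)
      then show ?thesis using c(2)[OF that] by simp
    qed
    then show ?thesis unfolding skew_form_poly[OF integrable_power_wJ that deg_r] by (intro sum.neutral) auto
  qed
  have orth: "integral\<^sup>L I11 (\<lambda>x. poly (r * jacobi_onp j) x * W x) = 0" if "j < N" for j
  proof -
    have "degree (wt_deriv (jacobi_onp j)) < ?n" using degree_wt_deriv[of "jacobi_onp j"] degree_jacobi_onp[of j] that by linarith
    then have "0 = skew_form (\<lambda>x. poly (wt_deriv (jacobi_onp j)) x * w x) (\<lambda>x. poly r x * w x)" by (simp add: rad)
    also have "\<dots> = - integral\<^sup>L I11 (\<lambda>x. eps_op (\<lambda>x. poly (wt_deriv (jacobi_onp j)) x * w x) x * (poly r x * w x))"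
      by (rule skew_form_eq_neg[OF integrable_poly_wJ integrable_poly_wJ])
    also have "integral\<^sup>L I11 (\<lambda>x. eps_op (\<lambda>x. poly (wt_deriv (jacobi_onp j)) x * w x) x * (poly r x * w x))
       = integral\<^sup>L I11 (\<lambda>x. (poly r x * w x) * ((1 - x\<^sup>2) * (poly (jacobi_onp j) x * w x)))"
    proof (rule Bochner_Integration.integral_cong[OF refl])
      fix x assume "x \<in> space I11"
      then have "eps_op (\<lambda>x. poly (wt_deriv (jacobi_onp j)) x * w x) x = (1 - x\<^sup>2) * (poly (jacobi_onp j) x * w x)" by (simp add: eps_op_wt_deriv)
      then show "eps_op (\<lambda>x. poly (wt_deriv (jacobi_onp j)) x * w x) x * (poly r x * w x) = (poly r x * w x) * ((1 - x\<^sup>2) * (poly (jacobi_onp j) x * w x))"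
        by (simp only: mult.commute)
    qed
    finally show ?thesis by (simp only: integral_poly_times_phi neg_0_equal_iff_equal)
  qed
  define e where "e = coeff r N / coeff (jacobi_onp N) N"
  define d where "d = r - Polynomial.smult e (jacobi_onp N)"
  have "degree d \<le> N" unfolding d_def using deg_r
    by (intro degree_diff_le order.trans[OF degree_smult_le] degree_jacobi_onp) simp
  moreover have "coeff d N = 0" using coeff_jacobi_onp_pos[of N] by (simp add: d_def e_def)
  ultimately have "degree d < N \<or> d = 0" using le_neq_implies_less leading_coeff_0_iff by metis
  moreover have "integral\<^sup>L I11 (\<lambda>x. poly (d * jacobi_onp j) x * W x) = 0" if "j < N" for j
  proof -
    have "poly (d * jacobi_onp j) x * W x = poly (r * jacobi_onp j) x * W x - e * (poly (jacobi_onp N * jacobi_onp j) x * W x)" for x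
      by (simp add: d_def algebra_simps)
    then have "integral\<^sup>L I11 (\<lambda>x. poly (d * jacobi_onp j) x * W x) = 0 - e * 0"
      using orth[OF that] jacobi_onp_orthonormal[of N j] that integrable_poly_W[of "r * jacobi_onp j"] integrable_poly_W[of "jacobi_onp N * jacobi_onp j"]
      by (simp only: Bochner_Integration.integral_diff Bochner_Integration.integral_mult_right_zero integrable_mult_right) simp
    then show ?thesis by simp
  qed
  ultimately have "d = 0" by (rule orthogonal_to_jacobi_onp_imp)
  then have r: "r = Polynomial.smult e (jacobi_onp N)" by (simp add: d_def)
  with \<open>r \<noteq> 0\<close> have "e \<noteq> 0" by auto
  \<comment> \<open>Sums over a one-element set, so that \<open>skew_form_sum\<close> also provides
    homogeneity.\<close>
  have rr: "(\<lambda>x. poly r x * w x) = (\<lambda>x. \<Sum>l\<in>{0::nat}. e * (poly (jacobi_onp N) x * w x))" unfolding r by (simp add: mult.assoc)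
  have "0 = skew_form (\<lambda>x. \<Sum>l\<in>{0::nat}. 1 * (poly p x * w x)) (\<lambda>x. \<Sum>l\<in>{0::nat}. e * (poly (jacobi_onp N) x * w x))"
    using rad[of p] p unfolding rr by simp
  also have "\<dots> = skew_form (\<lambda>x. poly p x * w x) (\<lambda>x. poly (jacobi_onp N) x * w x) * e"
    by (subst skew_form_sum) (auto intro: integrable_poly_wJ)
  finally show ?thesis using \<open>e \<noteq> 0\<close> by simp
qed

text \<open>The correction at the last index absorbs all terms of \<open>T_JOE\<close> with the
  factor C, so the kernel is a sum of \<open>N\<close> products instead of N + 1.\<close>

definition chi_poly :: "nat \<Rightarrow> nat \<Rightarrow> real poly" where
  "chi_poly N j = wt_deriv (jacobi_onp j) + (if Suc j = N then Polynomial.smult (CN1 a b N) (jacobi_onp N) else 0)"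

lemma degree_chi_poly:
  assumes N: "N \<ge> 2" and j: "j < N"
  shows "degree (chi_poly N j) < N"
proof (cases "Suc j = N")
  case False
  then have "chi_poly N j = wt_deriv (jacobi_onp j)" by (simp add: chi_poly_def)
  then show ?thesis using degree_wt_deriv[of "jacobi_onp j"] degree_jacobi_onp[of j] False j by simp
next
  case True
  have "degree (chi_poly N j) \<le> N" unfolding chi_poly_def
    using degree_wt_deriv[of "jacobi_onp j"] degree_jacobi_onp[of j] True
    by (intro degree_add_le) (auto intro!: order.trans[OF degree_smult_le] degree_jacobi_onp)
  moreover have "coeff (chi_poly N j) N = 0"
  proof -
    have "coeff (wt_deriv (jacobi_onp j)) N = - (real j + a / 2 + b / 2 + 2) * coeff (jacobi_onp j) j"
      using coeff_wt_deriv[OF degree_jacobi_onp, of j] True by simp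
    moreover have "N - 1 = j" "real N = real j + 1" using True by auto
    moreover from this have "real N + a / 2 + b / 2 + 1 = real j + a / 2 + b / 2 + 2" by simp
    ultimately show ?thesis using CN1_lead[OF N] True unfolding chi_poly_def
      by (simp only: coeff_add if_True coeff_smult) (simp add: algebra_simps)
  qed
  ultimately show ?thesis using N j
    by (metis degree_0 gr0I le_neq_implies_less leading_coeff_0_iff not_numeral_le_zero)
qed

lemma eps_op_chi:
  assumes x: "x \<in> {-1..1}"
  shows "eps_op (\<lambda>y. poly (chi_poly N j) y * w y) x
    = (1 - x\<^sup>2) * phi1 a b j x + (if Suc j = N then CN1 a b N * eps_op (phi1 a b N) x else 0)"
proof -
  define c where "c = (if Suc j = N then CN1 a b N else 0)"
  have "eps_op (\<lambda>y. poly (chi_poly N j) y * w y) x = eps_op (\<lambda>y. poly (wt_deriv (jacobi_onp j)) y * w y + c * (poly (jacobi_onp N) y * w y)) x"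
    by (rule arg_cong[where f = "\<lambda>h. eps_op h x"]) (auto simp: chi_poly_def c_def fun_eq_iff algebra_simps)
  also have "\<dots> = (1 - x\<^sup>2) * (poly (jacobi_onp j) x * w x) + c * eps_op (\<lambda>y. poly (jacobi_onp N) y * w y) x"
    by (simp only: eps_op_add[OF integrable_poly_wJ integrable_poly_wJ] eps_op_wt_deriv[OF x])
  finally show ?thesis by (simp add: c_def phi1_eq[abs_def])
qed

lemma integrable_phi1: "integrable I11 (phi1 a b j)"
  unfolding phi1_eq[abs_def] by (rule integrable_poly_wJ)

text \<open>By \<open>eps_op_wt_deriv\<close> the main part is the orthonormality relation for
  \<open>W\<close>; the correction term pairs with phi_N and vanishes by
  \<open>skew_form_phi_N\<close>, which is where \<open>N\<close> must be even.\<close>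

lemma skew_form_phi_chi:
  assumes N: "even N" and j: "j < N"
  shows "skew_form (\<lambda>x. poly (jacobi_onp j) x * w x) (\<lambda>x. poly (chi_poly N k) x * w x) = (if j = k then 1 else 0)"
proof -
  define c where "c = (if Suc k = N then CN1 a b N else 0)"
  have i1: "integrable I11 (\<lambda>x. (poly (jacobi_onp j) x * w x) * ((1 - x\<^sup>2) * (poly (jacobi_onp k) x * w x)))"
  proof -
    have "integrable I11 (\<lambda>x. (poly (jacobi_onp j) x * w x) * eps_op (\<lambda>y. poly (wt_deriv (jacobi_onp k)) y * w y) x)"
      by (rule integrable_mult_eps_op[OF integrable_poly_wJ integrable_poly_wJ])
    then show ?thesis by (rule Bochner_Integration.integrable_cong[OF refl, THEN iffD1, rotated]) (simp add: eps_op_wt_deriv)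
  qed
  have i2: "integrable I11 (\<lambda>x. c * ((poly (jacobi_onp j) x * w x) * eps_op (\<lambda>y. poly (jacobi_onp N) y * w y) x))"
    by (intro integrable_mult_right integrable_mult_eps_op integrable_poly_wJ)
  have "skew_form (\<lambda>x. poly (jacobi_onp j) x * w x) (\<lambda>x. poly (chi_poly N k) x * w x)
    = integral\<^sup>L I11 (\<lambda>x. (poly (jacobi_onp j) x * w x) * ((1 - x\<^sup>2) * (poly (jacobi_onp k) x * w x))
        + c * ((poly (jacobi_onp j) x * w x) * eps_op (\<lambda>y. poly (jacobi_onp N) y * w y) x))"
    unfolding skew_form_def
  proof (rule Bochner_Integration.integral_cong[OF refl])
    fix x assume "x \<in> space I11"
    then have x: "x \<in> {-1..1}" by simp
    show "(poly (jacobi_onp j) x * w x) * eps_op (\<lambda>x. poly (chi_poly N k) x * w x) x = (poly (jacobi_onp j) x * w x) * ((1 - x\<^sup>2) * (poly (jacobi_onp k) x * w x))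
        + c * ((poly (jacobi_onp j) x * w x) * eps_op (\<lambda>y. poly (jacobi_onp N) y * w y) x)"
      unfolding eps_op_chi[OF x] phi1_eq[abs_def] c_def by (simp add: algebra_simps)
  qed
  also have "\<dots> = integral\<^sup>L I11 (\<lambda>x. poly (jacobi_onp j * jacobi_onp k) x * W x)
      + c * skew_form (\<lambda>x. poly (jacobi_onp j) x * w x) (\<lambda>x. poly (jacobi_onp N) x * w x)"
    unfolding Bochner_Integration.integral_add[OF i1 i2] integral_poly_times_phi Bochner_Integration.integral_mult_right_zero skew_form_def ..
  also have "\<dots> = (if j = k then 1 else 0)"
    using skew_form_phi_N[OF N, of "jacobi_onp j"] degree_jacobi_onp[of j] j by (simp only: jacobi_onp_orthonormal mult_zero_right add_0_right less_imp_le)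
  finally show ?thesis .
qed

section \<open>The ensemble with the factor 1 + f\<close>

context
  fixes N :: nat and f f' :: "real \<Rightarrow> real"
  assumes N: "N \<ge> 2" "even N"
    and der: "\<And>x. x \<in> {-1..1} \<Longrightarrow> (f has_real_derivative f' x) (at x within {-1..1})"
    and cont: "continuous_on {-1..1} f'" and f0: "f (-1) = 0" "f 1 = 0"
begin

lemma continuous_on_f: "continuous_on {-1..1} f"
  by (rule DERIV_continuous_on[OF der])

lemma integrable_f_mult: "integrable I11 u \<Longrightarrow> integrable I11 (\<lambda>x. f x * u x)"
  using integrable_mult_continuous[OF _ continuous_on_f, of u] by (simp add: mult.commute)

definition left_factor :: "nat \<Rightarrow> real \<Rightarrow> real" where
  "left_factor k = eps_op (\<lambda>y. poly (chi_poly N k) y * w y)"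

text \<open>The row vector phi_k A of the factorization. Acting from the right, eps becomes its
  transpose -eps; hence the terms with eps f' have a minus sign in \<open>T_JOE\<close> and a plus
  sign here.\<close>

definition right_factor :: "nat \<Rightarrow> real \<Rightarrow> real" where
  "right_factor k y = phi1 a b k y * ((f y)\<^sup>2 + 2 * f y) + (eps_op (phi1 a b k) y + eps_op (\<lambda>z. f z * phi1 a b k z) y) * f' y"

lemma integrable_f'_mult_eps_op:
  assumes "integrable I11 u"
  shows "integrable I11 (\<lambda>x. f' x * eps_op u x)"
proof -
  interpret fm: finite_measure I11 by (rule finite_measure_I11)
  have "integrable I11 f'" using integrable_mult_continuous[of "\<lambda>_. 1", OF _ cont] by simp
  then show ?thesis by (rule integrable_mult_eps_op[OF _ assms])
qed

lemma integrable_right_factor: "integrable I11 (right_factor k)"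
proof -
  have "integrable I11 (\<lambda>x. phi1 a b k x * ((f x)\<^sup>2 + 2 * f x))"
    by (rule integrable_mult_continuous[OF integrable_phi1]) (intro continuous_intros continuous_on_f)
  moreover have "integrable I11 (\<lambda>x. f' x * eps_op (phi1 a b k) x)" "integrable I11 (\<lambda>x. f' x * eps_op (\<lambda>z. f z * phi1 a b k z) x)"
    by (intro integrable_f'_mult_eps_op integrable_f_mult integrable_phi1)+
  ultimately have "integrable I11 (\<lambda>x. phi1 a b k x * ((f x)\<^sup>2 + 2 * f x) + (f' x * eps_op (phi1 a b k) x + f' x * eps_op (\<lambda>z. f z * phi1 a b k z) x))"
    by (intro Bochner_Integration.integrable_add)
  then show ?thesis unfolding right_factor_def[abs_def] by (simp add: algebra_simps)
qed

lemma integral_eps_right: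
  assumes "integrable I11 u"
  shows "integral\<^sup>L I11 (\<lambda>z. u z * eps_kernel z y) = - eps_op u y"
proof -
  have "(\<lambda>z. u z * eps_kernel z y) = (\<lambda>z. - (eps_kernel y z * u z))"
    by (simp add: fun_eq_iff eps_kernel_skew[of _ y])
  then show ?thesis by (simp add: eps_op_def)
qed

text \<open>The three terms with C share the factor eps phi_N in \<open>x\<close>, and their factors
  in \<open>y\<close> add up to \<open>right_factor (N - 1)\<close>. They therefore merge with the
  summand k = N - 1 of the part that comes from \<open>SN1\<close>.\<close>

lemma T_JOE_finite_rank:
  assumes x: "x \<in> {-1..1}"
  shows "T_JOE a b N f f' x y = (\<Sum>k<N. left_factor k x * right_factor k y)"
proof -
  let ?S = "SN1 a b N" and ?C = "CN1 a b N" and ?u = "eps_op (phi1 a b N)" and ?v = "phi1 a b (N - 1)"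
  let ?U = "\<lambda>k. (1 - x\<^sup>2) * phi1 a b k x"
  have S1: "kcomp ?S eps_kernel x y = (\<Sum>k<N. ?U k * - eps_op (phi1 a b k) y)"
  proof -
    have "kcomp ?S eps_kernel x y = integral\<^sup>L I11 (\<lambda>z. \<Sum>k<N. ?U k * (phi1 a b k z * eps_kernel z y))"
      unfolding kcomp_def SN1_def by (simp add: sum_distrib_right mult.assoc)
    also have "\<dots> = (\<Sum>k<N. ?U k * integral\<^sup>L I11 (\<lambda>z. phi1 a b k z * eps_kernel z y))"
    proof -
      have "integrable I11 (\<lambda>z. phi1 a b k z * eps_kernel z y)" for k
        using eps_integrand_integrable[OF integrable_phi1, of y k] by (simp add: eps_kernel_skew[of _ y] mult.commute)
      then show ?thesis by (subst Bochner_Integration.integral_sum) auto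
    qed
    finally show ?thesis by (simp only: integral_eps_right[OF integrable_phi1])
  qed
  have S2: "kcomp (kmulr ?S f) eps_kernel x y = (\<Sum>k<N. ?U k * - eps_op (\<lambda>z. f z * phi1 a b k z) y)"
  proof -
    have "kcomp (kmulr ?S f) eps_kernel x y = integral\<^sup>L I11 (\<lambda>z. \<Sum>k<N. ?U k * (f z * phi1 a b k z * eps_kernel z y))"
      unfolding kcomp_def kmulr_def SN1_def sum_distrib_right by (simp only: mult_ac)
    also have "\<dots> = (\<Sum>k<N. ?U k * integral\<^sup>L I11 (\<lambda>z. f z * phi1 a b k z * eps_kernel z y))"
    proof -
      have "integrable I11 (\<lambda>z. f z * phi1 a b k z * eps_kernel z y)" for k
        using eps_integrand_integrable[OF integrable_f_mult[OF integrable_phi1], of y k]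
        by (simp add: eps_kernel_skew[of _ y] mult_ac)
      then show ?thesis by (subst Bochner_Integration.integral_sum) auto
    qed
    finally show ?thesis by (simp only: integral_eps_right[OF integrable_f_mult[OF integrable_phi1]])
  qed
  have S3: "kcomp (kmulr (ktensor ?u ?v) f) eps_kernel x y = ?u x * - eps_op (\<lambda>z. f z * ?v z) y"
  proof -
    have "kcomp (kmulr (ktensor ?u ?v) f) eps_kernel x y = integral\<^sup>L I11 (\<lambda>z. ?u x * (f z * ?v z * eps_kernel z y))"
      unfolding kcomp_def kmulr_def ktensor_def by (simp add: mult_ac)
    also have "\<dots> = ?u x * integral\<^sup>L I11 (\<lambda>z. f z * ?v z * eps_kernel z y)"
      by (rule Bochner_Integration.integral_mult_right_zero)
    finally show ?thesis by (simp only: integral_eps_right[OF integrable_f_mult[OF integrable_phi1]])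
  qed
  have "(\<Sum>k<N. left_factor k x * right_factor k y)
     = (\<Sum>k<N. ?U k * right_factor k y) + (\<Sum>k<N. (if k = N - 1 then ?C * ?u x * right_factor k y else 0))"
    unfolding sum.distrib[symmetric]
  proof (rule sum.cong[OF refl])
    fix k assume "k \<in> {..<N}"
    then have "Suc k = N \<longleftrightarrow> k = N - 1" by auto
    then show "left_factor k x * right_factor k y = ?U k * right_factor k y + (if k = N - 1 then ?C * ?u x * right_factor k y else 0)"
      unfolding left_factor_def eps_op_chi[OF x] by (simp add: algebra_simps)
  qed
  also have "(\<Sum>k<N. (if k = N - 1 then ?C * ?u x * right_factor k y else 0)) = ?C * ?u x * right_factor (N - 1) y"
    using N by simp
  finally have rhs: "(\<Sum>k<N. left_factor k x * right_factor k y) = (\<Sum>k<N. ?U k * right_factor k y) + ?C * ?u x * right_factor (N - 1) y" .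
  have "T_JOE a b N f f' x y
     = (\<Sum>k<N. ?U k * phi1 a b k y) * ((f y)\<^sup>2 + 2 * f y)
       - (\<Sum>k<N. ?U k * - eps_op (phi1 a b k) y) * f' y
       - (\<Sum>k<N. ?U k * - eps_op (\<lambda>z. f z * phi1 a b k z) y) * f' y
       + ?C * (?u x * ?v y * ((f y)\<^sup>2 + 2 * f y)) + ?C * (?u x * eps_op ?v y * f' y)
       - ?C * (?u x * - eps_op (\<lambda>z. f z * ?v z) y * f' y)"
    unfolding T_JOE_def Let_def kmulr_def[of _ f'] S1 S2 S3 kmulr_def[of _ "\<lambda>t. (f t)\<^sup>2 + 2 * f t"] ktensor_def SN1_def ..
  also have "\<dots> = (\<Sum>k<N. ?U k * right_factor k y) + ?C * ?u x * right_factor (N - 1) y"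
  proof -
    define U where "U k = (1 - x\<^sup>2) * phi1 a b k x" for k
    have "(\<Sum>k<N. U k * right_factor k y) = (\<Sum>k<N. U k * phi1 a b k y) * ((f y)\<^sup>2 + 2 * f y)
        + (\<Sum>k<N. U k * eps_op (phi1 a b k) y) * f' y + (\<Sum>k<N. U k * eps_op (\<lambda>z. f z * phi1 a b k z) y) * f' y"
      unfolding right_factor_def sum_distrib_right sum.distrib[symmetric]
      by (intro sum.cong refl) (simp only: distrib_left distrib_right mult_ac add_ac)
    then show ?thesis unfolding U_def[symmetric] by (simp add: right_factor_def sum_negf algebra_simps)
  qed
  finally show ?thesis unfolding rhs .
qed

lemma integrable_right_factor_left_factor: "integrable I11 (\<lambda>x. right_factor k x * left_factor l x)"
  unfolding left_factor_def by (rule integrable_mult_eps_op[OF integrable_right_factor integrable_poly_wJ])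

text \<open>Skewness moves eps from phi and f phi onto f' eps chi, where the commutator identity
  applies. The Kronecker delta is itself the skew form of phi_k and chi_l, so everything is one
  integral of phi_k against values of eps chi_l and eps(f chi_l).\<close>

lemma identity_plus_gram:
  assumes k: "k < N"
  shows "(if k = l then 1 else 0) + integral\<^sup>L I11 (\<lambda>x. right_factor k x * left_factor l x)
    = skew_form (\<lambda>x. poly (jacobi_onp k) x * (w x * (1 + f x))) (\<lambda>x. poly (chi_poly N l) x * (w x * (1 + f x)))"
proof -
  define ph ch where "ph = phi1 a b k" and "ch = (\<lambda>x. poly (chi_poly N l) x * w x)"
  have i: "integrable I11 ph" "integrable I11 ch" "integrable I11 (\<lambda>x. f x * ph x)" "integrable I11 (\<lambda>x. f x * ch x)"
    unfolding ph_def ch_def by (intro integrable_phi1 integrable_poly_wJ integrable_f_mult)+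
  have comm: "eps_op (\<lambda>z. f' z * eps_op ch z) x = f x * eps_op ch x - eps_op (\<lambda>z. f z * ch z) x" if "x \<in> {-1..1}" for x
    by (rule eps_op_commutator[OF der cont f0 i(2) that])
  have move: "integral\<^sup>L I11 (\<lambda>x. eps_op u x * (f' x * eps_op ch x))
      = - integral\<^sup>L I11 (\<lambda>x. u x * (f x * eps_op ch x - eps_op (\<lambda>z. f z * ch z) x))" if u: "integrable I11 u" for u
  proof -
    have "integral\<^sup>L I11 (\<lambda>x. eps_op u x * (f' x * eps_op ch x)) = - skew_form u (\<lambda>x. f' x * eps_op ch x)"
      using skew_form_eq_neg[OF u integrable_f'_mult_eps_op[OF i(2)]] by simp
    also have "skew_form u (\<lambda>x. f' x * eps_op ch x) = integral\<^sup>L I11 (\<lambda>x. u x * (f x * eps_op ch x - eps_op (\<lambda>z. f z * ch z) x))"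
      unfolding skew_form_def by (rule Bochner_Integration.integral_cong[OF refl]) (simp add: comm)
    finally show ?thesis .
  qed
  have j1: "integrable I11 (\<lambda>x. (f x * (f x * ph x) + 2 * (f x * ph x)) * eps_op ch x)"
    by (intro integrable_mult_eps_op i Bochner_Integration.integrable_add integrable_mult_right integrable_f_mult)
  have j2: "integrable I11 (\<lambda>x. eps_op u x * (f' x * eps_op ch x))" if "integrable I11 u" for u
    using integrable_mult_eps_op[OF integrable_f'_mult_eps_op[OF i(2)] that] by (simp add: mult.commute)
  have j3: "integrable I11 (\<lambda>x. u x * (f x * eps_op ch x - eps_op (\<lambda>z. f z * ch z) x))" if u: "integrable I11 u" for u
  proof -
    have "integrable I11 (\<lambda>x. u x * eps_op (\<lambda>z. f' z * eps_op ch z) x)"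
      by (rule integrable_mult_eps_op[OF u integrable_f'_mult_eps_op[OF i(2)]])
    then show ?thesis by (rule Bochner_Integration.integrable_cong[OF refl, THEN iffD1, rotated]) (simp add: comm)
  qed
  have "integral\<^sup>L I11 (\<lambda>x. right_factor k x * left_factor l x)
     = integral\<^sup>L I11 (\<lambda>x. (f x * (f x * ph x) + 2 * (f x * ph x)) * eps_op ch x
         + (eps_op ph x * (f' x * eps_op ch x) + eps_op (\<lambda>z. f z * ph z) x * (f' x * eps_op ch x)))"
    unfolding right_factor_def left_factor_def ph_def[symmetric] ch_def[symmetric]
    by (rule arg_cong[where f = "integral\<^sup>L I11"]) (simp add: fun_eq_iff power2_eq_square algebra_simps)
  also have "\<dots> = integral\<^sup>L I11 (\<lambda>x. (f x * (f x * ph x) + 2 * (f x * ph x)) * eps_op ch x)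
       + (- integral\<^sup>L I11 (\<lambda>x. ph x * (f x * eps_op ch x - eps_op (\<lambda>z. f z * ch z) x))
          + - integral\<^sup>L I11 (\<lambda>x. (f x * ph x) * (f x * eps_op ch x - eps_op (\<lambda>z. f z * ch z) x)))"
    using j1 j2[OF i(1)] j2[OF i(3)] move[OF i(1)] move[OF i(3)] by simp
  also have "\<dots> = integral\<^sup>L I11 (\<lambda>x. (f x * (f x * ph x) + 2 * (f x * ph x)) * eps_op ch x
       - (ph x * (f x * eps_op ch x - eps_op (\<lambda>z. f z * ch z) x)
          + (f x * ph x) * (f x * eps_op ch x - eps_op (\<lambda>z. f z * ch z) x)))"
    using j1 j3[OF i(1)] j3[OF i(3)] by simp
  finally have G: "integral\<^sup>L I11 (\<lambda>x. right_factor k x * left_factor l x) = \<dots>" .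
  have one: "(if k = l then 1 else 0) = integral\<^sup>L I11 (\<lambda>x. ph x * eps_op ch x)"
    using skew_form_phi_chi[OF N(2) k, of l] unfolding skew_form_def ph_def ch_def phi1_eq[abs_def] by simp
  have "(if k = l then 1 else 0) + integral\<^sup>L I11 (\<lambda>x. right_factor k x * left_factor l x)
    = integral\<^sup>L I11 (\<lambda>x. ph x * eps_op ch x + ((f x * (f x * ph x) + 2 * (f x * ph x)) * eps_op ch x
       - (ph x * (f x * eps_op ch x - eps_op (\<lambda>z. f z * ch z) x)
          + (f x * ph x) * (f x * eps_op ch x - eps_op (\<lambda>z. f z * ch z) x))))"
    unfolding G one using j1 j3[OF i(1)] j3[OF i(3)] integrable_mult_eps_op[OF i(1,2)] by simp
  \<comment> \<open>The coefficient of phi eps chi is 1 + (f^2 + 2f) - f - f^2 = 1 + f, and that of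
    phi eps(f chi) is also 1 + f. This is why \<open>T_JOE\<close> contains f^2 + 2f.\<close>
  also have "\<dots> = integral\<^sup>L I11 (\<lambda>x. (ph x * (1 + f x)) * (eps_op ch x + 1 * eps_op (\<lambda>z. f z * ch z) x))"
    by (rule arg_cong[where f = "integral\<^sup>L I11"]) (simp add: fun_eq_iff algebra_simps)
  also have "\<dots> = skew_form (\<lambda>x. poly (jacobi_onp k) x * (w x * (1 + f x))) (\<lambda>x. poly (chi_poly N l) x * (w x * (1 + f x)))"
  proof -
    have "(\<lambda>x. poly (chi_poly N l) x * (w x * (1 + f x))) = (\<lambda>x. ch x + 1 * (f x * ch x))"
      by (simp add: ch_def fun_eq_iff algebra_simps)
    moreover have "poly (jacobi_onp k) x * (w x * (1 + f x)) = ph x * (1 + f x)" for x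
      by (simp add: ph_def phi1_eq mult.assoc)
    ultimately show ?thesis unfolding skew_form_def by (simp only: eps_op_add[OF i(2,4)])
  qed
  finally show ?thesis .
qed

text \<open>The coefficient matrices of the phi_k and the chi_l do not depend on \<open>f\<close>.
  Hence det(I + G) is det M_f times the same prefactor that occurs at f = 0, where the determinant
  is 1.\<close>

lemma GN1_square_eq_fredholm_det:
  "summable (fredholm_term (T_JOE a b N f f')) \<and> (GN1 a b N f)\<^sup>2 = fredholm_det (T_JOE a b N f f')"
proof -
  obtain m where m: "N = 2 * m" using N(2) by (elim evenE)
  let ?wf = "\<lambda>x. w x * (1 + f x)"
  define M where "M g j k = skew_form (\<lambda>x. x ^ j * g x) (\<lambda>x. x ^ k * g x)" for g j k
  have ig: "integrable I11 (\<lambda>x. x ^ j * ?wf x)" for j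
    using integrable_mult_continuous[OF integrable_power_wJ, of "\<lambda>x. 1 + f x" j]
    by (simp add: mult.assoc continuous_on_f continuous_on_add)
  let ?X = "leibniz_det N (\<lambda>k i. coeff (jacobi_onp k) i)" and ?Y = "leibniz_det N (\<lambda>l j. coeff (chi_poly N l) j)"
  have degQ: "degree (jacobi_onp k) < N" if "k < N" for k using degree_jacobi_onp[of k] that by simp
  have det: "leibniz_det N (\<lambda>k l. skew_form (\<lambda>x. poly (jacobi_onp k) x * g x) (\<lambda>x. poly (chi_poly N l) x * g x))
      = ?X * leibniz_det N (M g) * ?Y" if g: "\<And>j. integrable I11 (\<lambda>x. x ^ j * g x)" for g
  proof -
    have "leibniz_det N (\<lambda>k l. skew_form (\<lambda>x. poly (jacobi_onp k) x * g x) (\<lambda>x. poly (chi_poly N l) x * g x))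
      = leibniz_det N (\<lambda>k l. \<Sum>i<N. \<Sum>j<N. coeff (jacobi_onp k) i * M g i j * coeff (chi_poly N l) j)"
      unfolding M_def by (rule leibniz_det_cong) (rule skew_form_poly[OF g degQ degree_chi_poly[OF N(1)]])
    then show ?thesis by (simp only: leibniz_det_congruence)
  qed
  have "leibniz_det N (\<lambda>k l. skew_form (\<lambda>x. poly (jacobi_onp k) x * w x) (\<lambda>x. poly (chi_poly N l) x * w x))
      = leibniz_det N (\<lambda>k l. if k = l then 1 else 0)"
    by (rule leibniz_det_cong) (rule skew_form_phi_chi[OF N(2)])
  also have "\<dots> = 1" by (subst leibniz_det_triangular) auto
  \<comment> \<open>This single equation identifies the prefactor as 1 / det M_0 and shows that det
    M_0 is nonzero.\<close>
  finally have one: "?X * leibniz_det N (M w) * ?Y = 1" unfolding det[OF integrable_power_wJ] .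
  then have nz: "leibniz_det N (M w) \<noteq> 0" by auto
  have fr: "summable (fredholm_term (T_JOE a b N f f'))"
    "fredholm_det (T_JOE a b N f f')
       = leibniz_det N (\<lambda>k l. (if k = l then 1 else 0) + integral\<^sup>L I11 (\<lambda>x. right_factor k x * left_factor l x))"
    by (rule fredholm_det_finite_rank[where u = left_factor and v = right_factor];
        simp only: T_JOE_finite_rank integrable_right_factor_left_factor)+
  have "fredholm_det (T_JOE a b N f f')
     = leibniz_det N (\<lambda>k l. skew_form (\<lambda>x. poly (jacobi_onp k) x * ?wf x) (\<lambda>x. poly (chi_poly N l) x * ?wf x))"
    unfolding fr(2) by (rule leibniz_det_cong) (rule identity_plus_gram)
  also have "\<dots> = ?X * leibniz_det N (M ?wf) * ?Y" by (rule det[OF ig])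
  also have "\<dots> = leibniz_det N (M ?wf) / leibniz_det N (M w)"
    using one nz by (simp add: eq_divide_eq mult_ac)
  also have "\<dots> = (GN1 a b N f)\<^sup>2"
    unfolding GN1_def M_def m
    by (rule de_Bruijn_square_ratio[OF integrable_power_wJ ig, symmetric]) (use nz in \<open>simp add: M_def[abs_def] m\<close>)
  finally show ?thesis using fr(1) by simp
qed

end

end

theorem theorem12:
  fixes a b :: real and N :: nat and f f' :: "real \<Rightarrow> real"
  assumes "a > -2" "b > -2" "N \<ge> 2" "even N"
    and "\<forall>x\<in>{-1..1}. (f has_real_derivative f' x) (at x within {-1..1})"
    and "continuous_on {-1..1} f'"
    and "f (-1) = 0" "f 1 = 0"
  shows "summable (fredholm_term (T_JOE a b N f f'))
         \<and> (GN1 a b N f)\<^sup>2 = fredholm_det (T_JOE a b N f f')"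
  by (rule GN1_square_eq_fredholm_det) (use assms in auto)

end
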